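(* Let $M$ be a 4-dimensional manifold and let $F$ be any $(\alpha,\beta)$-metric on $M$, constructed from a pseudo-Riemannian metric $a$ and a 1-form $b$, such that: (i) $a$ solves the classical Einstein equations in vacuum (its Ricci tensor vanishes); (ii) $b$ is covariantly constant with respect to the Levi-Civita connection of $a$. Then, provided that $a$ has Lorentzian signature $(-,+,+,+)$, $F$ must belong to one of the following two classes, where the expressions for $a$ and $b$ hold in suitable local coordinates: Class 1: $a=-dt^2+dx^2+dy^2+dz^2$ and $b=b_\mu\,dx^\mu$ with all $b_\mu$ constant, in coordinates $(x^\mu)=(t,x,y,z)$; Class 2: $a=-2\,du\,dv+H(u,x,y)\,du^2+dx^2+dy^2$ and $b=du$, with $(\partial_x^2+\partial_y^2)H=0$, in coordinates $(u,v,x,y)$.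
   Context: An $(\alpha,\beta)$-metric on $M$ is a Finsler metric of the form $F=\alpha\,\phi(\beta/\alpha)$ with $\alpha=\sqrt{|a_{\mu\nu}y^\mu y^\nu|}$, $\beta=b_\mu y^\mu$ (with $(x^\mu,y^\mu)$ induced coordinates on $TM$), where $a=a_{\mu\nu}dx^\mu dx^\nu$ is a pseudo-Riemannian metric, $b=b_\mu dx^\mu$ a smooth 1-form and $\phi$ a smooth function of one real variable; here a Finsler metric is a smooth function $F$ on an open conic subset $\mathcal A\subset TM$ projecting onto $M$ (here with $\alpha\neq0$ on $\mathcal A$), positively 1-homogeneous in $y$, with nondegenerate $\tfrac12\partial^2F^2/\partial y^\mu\partial y^\nu$. $dx^\mu dx^\nu$ denotes the symmetrized tensor product.
   Formalization: The 1-form b is assumed not identically zero on any connected component of M (for b = 0 the claim fails, e.g. Schwarzschild a with F = α), and the choice between Class 1 and Class 2 is made on each connected component of M; for connected M this is the stated dichotomy. *)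

theory Defs
  imports "HOL-Analysis.Analysis"
begin

section \<open>Smooth maps between normed spaces\<close>

text \<open>Only meaningful on open sets \<open>S\<close>: \<open>frechet_derivative\<close> is taken in the ambient space.\<close>

primrec times_differentiable_on ::
    "nat \<Rightarrow> ('a::real_normed_vector \<Rightarrow> 'b::real_normed_vector) \<Rightarrow> 'a set \<Rightarrow> bool" where
  "times_differentiable_on 0 f S \<longleftrightarrow> continuous_on S f"
| "times_differentiable_on (Suc k) f S \<longleftrightarrow>
     (\<forall>x\<in>S. f differentiable (at x)) \<and>
     (\<forall>v. times_differentiable_on k (\<lambda>x. frechet_derivative f (at x) v) S)"

definition smooth_on ::
    "'a set \<Rightarrow> ('a::real_normed_vector \<Rightarrow> 'b::real_normed_vector) \<Rightarrow> bool" where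
  "smooth_on S f \<longleftrightarrow> (\<forall>k. times_differentiable_on k f S)"

definition partial_deriv :: "4 \<Rightarrow> (real^4 \<Rightarrow> real) \<Rightarrow> real^4 \<Rightarrow> real" where
  "partial_deriv i f x = frechet_derivative f (at x) (axis i 1)"


section \<open>Four-dimensional smooth manifolds\<close>

text \<open>A chart is a pair of its domain and its coordinate map; the values of the coordinate map
  outside the domain are irrelevant. A smooth structure is a maximal smooth atlas, so that
  ``local coordinates'' are precisely its members.\<close>

type_synonym 'a chart = "'a set \<times> ('a \<Rightarrow> real^4)"

definition chart_on :: "'a topology \<Rightarrow> 'a chart \<Rightarrow> bool" where
  "chart_on X c \<longleftrightarrow>
     openin X (fst c) \<and> open (snd c ` fst c) \<and>
     homeomorphic_map (subtopology X (fst c)) (top_of_set (snd c ` fst c)) (snd c)"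

definition chart_inv :: "'a chart \<Rightarrow> real^4 \<Rightarrow> 'a" where
  "chart_inv c = inv_into (fst c) (snd c)"

definition transition :: "'a chart \<Rightarrow> 'a chart \<Rightarrow> real^4 \<Rightarrow> real^4" where
  "transition c d = snd d \<circ> chart_inv c"

definition smoothly_compatible :: "'a chart \<Rightarrow> 'a chart \<Rightarrow> bool" where
  "smoothly_compatible c d \<longleftrightarrow>
     smooth_on (snd c ` (fst c \<inter> fst d)) (transition c d) \<and>
     smooth_on (snd d ` (fst c \<inter> fst d)) (transition d c)"

definition smooth_structure :: "'a topology \<Rightarrow> 'a chart set \<Rightarrow> bool" where
  "smooth_structure X S \<longleftrightarrow>
     (\<forall>c\<in>S. chart_on X c) \<and>
     (\<Union>c\<in>S. fst c) = topspace X \<and>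
     (\<forall>c\<in>S. \<forall>d\<in>S. smoothly_compatible c d) \<and>
     (\<forall>c. chart_on X c \<and> (\<forall>d\<in>S. smoothly_compatible c d) \<longrightarrow> c \<in> S)"

definition smooth_manifold :: "'a topology \<Rightarrow> 'a chart set \<Rightarrow> bool" where
  "smooth_manifold X S \<longleftrightarrow>
     Hausdorff_space X \<and> second_countable X \<and> smooth_structure X S"


section \<open>Tangent vectors\<close>

text \<open>A tangent vector at \<open>p\<close> assigns to every chart around \<open>p\<close> its components
  in that chart, subject to the contravariant transformation law; it is \<open>0\<close> on all other charts.
  Vector space operations are therefore pointwise.\<close>

type_synonym 'a tangent = "'a chart \<Rightarrow> real^4"

definition tangent_space :: "'a chart set \<Rightarrow> 'a \<Rightarrow> 'a tangent set" where
  "tangent_space S p =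
     {v. (\<forall>c\<in>S. \<forall>d\<in>S. p \<in> fst c \<and> p \<in> fst d \<longrightarrow>
            v d = frechet_derivative (transition c d) (at (snd c p)) (v c)) \<and>
         (\<forall>c. \<not> (c \<in> S \<and> p \<in> fst c) \<longrightarrow> v c = 0)}"

definition tangent_bundle :: "'a topology \<Rightarrow> 'a chart set \<Rightarrow> ('a \<times> 'a tangent) set" where
  "tangent_bundle X S = Sigma (topspace X) (tangent_space S)"

text \<open>The tangent vector at \<open>p\<close> with components \<open>y\<close> in the chart \<open>c\<close>.\<close>

definition tangent_of :: "'a chart set \<Rightarrow> 'a chart \<Rightarrow> 'a \<Rightarrow> real^4 \<Rightarrow> 'a tangent" where
  "tangent_of S c p y =
     (\<lambda>d. if d \<in> S \<and> p \<in> fst d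
           then frechet_derivative (transition c d) (at (snd c p)) y else 0)"

definition coord_vector :: "'a chart set \<Rightarrow> 'a chart \<Rightarrow> 'a \<Rightarrow> 4 \<Rightarrow> 'a tangent" where
  "coord_vector S c p i = tangent_of S c p (axis i 1)"

text \<open>The image of a set of tangent vectors under the induced coordinates of the tangent bundle.\<close>

definition induced_image :: "'a chart \<Rightarrow> ('a \<times> 'a tangent) set \<Rightarrow> ((real^4) \<times> (real^4)) set" where
  "induced_image c A = {(snd c p, v c) | p v. (p, v) \<in> A \<and> p \<in> fst c}"

definition induced_rep ::
    "'a chart set \<Rightarrow> 'a chart \<Rightarrow> ('a \<times> 'a tangent \<Rightarrow> real) \<Rightarrow> (real^4) \<times> (real^4) \<Rightarrow> real" where
  "induced_rep S c F = (\<lambda>(x, y). F (chart_inv c x, tangent_of S c (chart_inv c x) y))"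


section \<open>One-forms and pseudo-Riemannian metrics\<close>

type_synonym 'a form = "'a \<Rightarrow> 'a tangent \<Rightarrow> real"
type_synonym 'a bilinear_field = "'a \<Rightarrow> 'a tangent \<Rightarrow> 'a tangent \<Rightarrow> real"

definition form_comp :: "'a chart set \<Rightarrow> 'a form \<Rightarrow> 'a chart \<Rightarrow> real^4 \<Rightarrow> real^4" where
  "form_comp S b c x = (\<chi> i. b (chart_inv c x) (coord_vector S c (chart_inv c x) i))"

definition metric_comp :: "'a chart set \<Rightarrow> 'a bilinear_field \<Rightarrow> 'a chart \<Rightarrow> real^4 \<Rightarrow> real^4^4" where
  "metric_comp S a c x =
     (\<chi> i j. a (chart_inv c x) (coord_vector S c (chart_inv c x) i)
                              (coord_vector S c (chart_inv c x) j))"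

definition linear_on_tangent :: "'a chart set \<Rightarrow> 'a \<Rightarrow> ('a tangent \<Rightarrow> real) \<Rightarrow> bool" where
  "linear_on_tangent S p f \<longleftrightarrow>
     (\<forall>v\<in>tangent_space S p. \<forall>w\<in>tangent_space S p. f (\<lambda>c. v c + w c) = f v + f w) \<and>
     (\<forall>v\<in>tangent_space S p. \<forall>r. f (\<lambda>c. r *\<^sub>R v c) = r * f v)"

definition one_form :: "'a topology \<Rightarrow> 'a chart set \<Rightarrow> 'a form \<Rightarrow> bool" where
  "one_form X S b \<longleftrightarrow>
     (\<forall>p\<in>topspace X. linear_on_tangent S p (b p)) \<and>
     (\<forall>c\<in>S. smooth_on (snd c ` fst c) (form_comp S b c))"

definition pseudo_riemannian_metric ::
    "'a topology \<Rightarrow> 'a chart set \<Rightarrow> 'a bilinear_field \<Rightarrow> bool" where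
  "pseudo_riemannian_metric X S a \<longleftrightarrow>
     (\<forall>p\<in>topspace X.
        (\<forall>v\<in>tangent_space S p. linear_on_tangent S p (a p v)) \<and>
        (\<forall>v\<in>tangent_space S p. \<forall>w\<in>tangent_space S p. a p v w = a p w v) \<and>
        (\<forall>v\<in>tangent_space S p. (\<forall>w\<in>tangent_space S p. a p v w = 0) \<longrightarrow> v = (\<lambda>c. 0))) \<and>
     (\<forall>c\<in>S. smooth_on (snd c ` fst c) (metric_comp S a c))"

definition minkowski :: "real^4^4" where
  "minkowski = vector [vector [-1, 0, 0, 0],
                       vector [ 0, 1, 0, 0],
                       vector [ 0, 0, 1, 0],
                       vector [ 0, 0, 0, 1]]"

text \<open>Four vectors satisfying these relations automatically form a basis.\<close>

definition lorentzian :: "'a topology \<Rightarrow> 'a chart set \<Rightarrow> 'a bilinear_field \<Rightarrow> bool" where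
  "lorentzian X S a \<longleftrightarrow>
     (\<forall>p\<in>topspace X. \<exists>e :: 4 \<Rightarrow> 'a tangent.
        (\<forall>i. e i \<in> tangent_space S p) \<and> (\<forall>i j. a p (e i) (e j) = minkowski $ i $ j))"


section \<open>Levi-Civita connection and curvature\<close>

text \<open>In the following \<open>g\<close> is the component matrix of a metric in some chart;
  \<open>christoffel g k i j\<close> has upper index \<open>k\<close>, and \<open>riemann g r s m n\<close> has upper index \<open>r\<close>.\<close>

definition christoffel :: "(real^4 \<Rightarrow> real^4^4) \<Rightarrow> 4 \<Rightarrow> 4 \<Rightarrow> 4 \<Rightarrow> real^4 \<Rightarrow> real" where
  "christoffel g k i j x =
     (\<Sum>l\<in>UNIV. matrix_inv (g x) $ k $ l *
        (partial_deriv i (\<lambda>z. g z $ j $ l) x + partial_deriv j (\<lambda>z. g z $ i $ l) x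
          - partial_deriv l (\<lambda>z. g z $ i $ j) x)) / 2"

definition riemann :: "(real^4 \<Rightarrow> real^4^4) \<Rightarrow> 4 \<Rightarrow> 4 \<Rightarrow> 4 \<Rightarrow> 4 \<Rightarrow> real^4 \<Rightarrow> real" where
  "riemann g r s m n x =
     partial_deriv m (christoffel g r n s) x - partial_deriv n (christoffel g r m s) x
     + (\<Sum>l\<in>UNIV. christoffel g r m l x * christoffel g l n s x)
     - (\<Sum>l\<in>UNIV. christoffel g r n l x * christoffel g l m s x)"

definition ricci :: "(real^4 \<Rightarrow> real^4^4) \<Rightarrow> 4 \<Rightarrow> 4 \<Rightarrow> real^4 \<Rightarrow> real" where
  "ricci g s n x = (\<Sum>r\<in>UNIV. riemann g r s r n x)"

definition vacuum_einstein :: "'a chart set \<Rightarrow> 'a bilinear_field \<Rightarrow> bool" where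
  "vacuum_einstein S a \<longleftrightarrow>
     (\<forall>c\<in>S. \<forall>x\<in>snd c ` fst c. \<forall>i j. ricci (metric_comp S a c) i j x = 0)"

definition covariantly_constant :: "'a chart set \<Rightarrow> 'a bilinear_field \<Rightarrow> 'a form \<Rightarrow> bool" where
  "covariantly_constant S a b \<longleftrightarrow>
     (\<forall>c\<in>S. \<forall>x\<in>snd c ` fst c. \<forall>i j.
        partial_deriv i (\<lambda>z. form_comp S b c z $ j) x
        - (\<Sum>k\<in>UNIV. christoffel (metric_comp S a c) k i j x * form_comp S b c x $ k) = 0)"


section \<open>Finsler metrics\<close>

definition open_conic_subset ::
    "'a topology \<Rightarrow> 'a chart set \<Rightarrow> ('a \<times> 'a tangent) set \<Rightarrow> bool" where
  "open_conic_subset X S A \<longleftrightarrow>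
     A \<subseteq> tangent_bundle X S \<and>
     (\<forall>c\<in>S. open (induced_image c A)) \<and>
     (\<forall>p v r. (p, v) \<in> A \<and> 0 < r \<longrightarrow> (p, \<lambda>c. r *\<^sub>R v c) \<in> A)"

definition fundamental_tensor ::
    "'a chart set \<Rightarrow> 'a chart \<Rightarrow> ('a \<times> 'a tangent \<Rightarrow> real) \<Rightarrow> real^4 \<Rightarrow> real^4 \<Rightarrow> real^4^4" where
  "fundamental_tensor S c F x y =
     (\<chi> i j. partial_deriv i (partial_deriv j (\<lambda>z. (induced_rep S c F (x, z))\<^sup>2)) y / 2)"

definition finsler_metric ::
    "'a topology \<Rightarrow> 'a chart set \<Rightarrow> ('a \<times> 'a tangent) set \<Rightarrow> ('a \<times> 'a tangent \<Rightarrow> real) \<Rightarrow> bool" where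
  "finsler_metric X S A F \<longleftrightarrow>
     open_conic_subset X S A \<and> fst ` A = topspace X \<and>
     (\<forall>c\<in>S. smooth_on (induced_image c A) (induced_rep S c F)) \<and>
     (\<forall>p v r. (p, v) \<in> A \<and> 0 < r \<longrightarrow> F (p, \<lambda>c. r *\<^sub>R v c) = r * F (p, v)) \<and>
     (\<forall>c\<in>S. \<forall>(x, y)\<in>induced_image c A. invertible (fundamental_tensor S c F x y))"

definition alpha :: "'a bilinear_field \<Rightarrow> 'a \<times> 'a tangent \<Rightarrow> real" where
  "alpha a = (\<lambda>(p, v). sqrt \<bar>a p v v\<bar>)"

definition beta :: "'a form \<Rightarrow> 'a \<times> 'a tangent \<Rightarrow> real" where
  "beta b = (\<lambda>(p, v). b p v)"

text \<open>\<open>\<phi>\<close> need only be smooth on an open set \<open>D\<close> of reals containing the values of \<open>\<beta>/\<alpha>\<close>, so that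
  e.g. \<open>\<phi>(s) = 1/s\<close> (Kropina metrics) is covered.\<close>

definition alpha_beta_metric ::
    "'a topology \<Rightarrow> 'a chart set \<Rightarrow> ('a \<times> 'a tangent) set \<Rightarrow> ('a \<times> 'a tangent \<Rightarrow> real) \<Rightarrow>
     'a bilinear_field \<Rightarrow> 'a form \<Rightarrow> (real \<Rightarrow> real) \<Rightarrow> bool" where
  "alpha_beta_metric X S A F a b \<phi> \<longleftrightarrow>
     pseudo_riemannian_metric X S a \<and> one_form X S b \<and> finsler_metric X S A F \<and>
     (\<exists>D. open D \<and> smooth_on D \<phi> \<and> (\<forall>w\<in>A. beta b w / alpha a w \<in> D)) \<and>
     (\<forall>w\<in>A. alpha a w \<noteq> 0 \<and> F w = alpha a w * \<phi> (beta b w / alpha a w))"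


section \<open>The two classes\<close>

text \<open>Both classes are relative to a set \<open>C\<close> of points, which is instantiated with a connected
  component of the manifold (with the whole manifold, if that is connected).
  Coordinates are numbered \<open>(t, x, y, z)\<close> and \<open>(u, v, x, y)\<close> as \<open>1, 2, 3, 4\<close>.\<close>

definition class1_on ::
    "'a set \<Rightarrow> 'a chart set \<Rightarrow> ('a \<times> 'a tangent) set \<Rightarrow> ('a \<times> 'a tangent \<Rightarrow> real) \<Rightarrow>
     'a bilinear_field \<Rightarrow> 'a form \<Rightarrow> (real \<Rightarrow> real) \<Rightarrow> bool" where
  "class1_on C S A F a b \<phi> \<longleftrightarrow>
     (\<forall>w\<in>A. fst w \<in> C \<longrightarrow> F w = alpha a w * \<phi> (beta b w / alpha a w)) \<and>
     (\<forall>p\<in>C. \<exists>c\<in>S. p \<in> fst c \<and>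
        (\<forall>\<xi>\<in>snd c ` fst c. metric_comp S a c \<xi> = minkowski) \<and>
        (\<exists>k. \<forall>\<xi>\<in>snd c ` fst c. form_comp S b c \<xi> = k))"

text \<open>The matrix of \<open>-2 du dv + h du\<^sup>2 + dx\<^sup>2 + dy\<^sup>2\<close>. As \<open>du dv\<close> is the symmetrized product
  \<open>(du \<otimes> dv + dv \<otimes> du) / 2\<close>, the off-diagonal entries are \<open>-1\<close>.\<close>

definition pp_wave_matrix :: "real \<Rightarrow> real^4^4" where
  "pp_wave_matrix h = vector [vector [ h, -1, 0, 0],
                              vector [-1,  0, 0, 0],
                              vector [ 0,  0, 1, 0],
                              vector [ 0,  0, 0, 1]]"

definition class2_on ::
    "'a set \<Rightarrow> 'a chart set \<Rightarrow> ('a \<times> 'a tangent) set \<Rightarrow> ('a \<times> 'a tangent \<Rightarrow> real) \<Rightarrow>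
     'a bilinear_field \<Rightarrow> 'a form \<Rightarrow> (real \<Rightarrow> real) \<Rightarrow> bool" where
  "class2_on C S A F a b \<phi> \<longleftrightarrow>
     (\<forall>w\<in>A. fst w \<in> C \<longrightarrow> F w = alpha a w * \<phi> (beta b w / alpha a w)) \<and>
     (\<forall>p\<in>C. \<exists>c\<in>S. \<exists>H :: real \<times> real \<times> real \<Rightarrow> real. p \<in> fst c \<and>
        (\<forall>\<xi>\<in>snd c ` fst c. metric_comp S a c \<xi> = pp_wave_matrix (H (\<xi>$1, \<xi>$3, \<xi>$4))) \<and>
        (\<forall>\<xi>\<in>snd c ` fst c. form_comp S b c \<xi> = vector [1, 0, 0, 0]) \<and>
        smooth_on ((\<lambda>\<xi>. (\<xi>$1, \<xi>$3, \<xi>$4)) ` (snd c ` fst c)) H \<and>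
        (\<forall>(u, x, y)\<in>(\<lambda>\<xi>. (\<xi>$1, \<xi>$3, \<xi>$4)) ` (snd c ` fst c).
           (deriv ^^ 2) (\<lambda>s. H (u, s, y)) x + (deriv ^^ 2) (\<lambda>s. H (u, x, s)) y = 0))"

end

theory Submission
  imports Defs
begin

text \<open>The squared length of the parallel form \<open>b\<close> is locally constant, and the curvature \<open>R\<close>
  annihilates \<open>b\<close>, so at each point \<open>R\<close> is a curvature-like tensor in three dimensions. Let \<open>E\<^sub>3, E\<^sub>4\<close>
  be spacelike, orthonormal and orthogonal to \<open>b\<close>. The vacuum equations force
  \<open>R(\<cdot>, \<cdot>, E\<^sub>3, E\<^sub>4) = 0\<close>, and \<open>R = 0\<close> if \<open>b\<close> is not null.

  If \<open>R = 0\<close>, an orthonormal parallel coframe exists; being closed, it is the differential of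
  flat coordinates, in which the parallel form \<open>b\<close> has constant components.

  If \<open>b\<close> is null, write \<open>b = du\<close>. The connection form of \<open>E\<^sub>3, E\<^sub>4\<close> modulo \<open>b\<close> is abelian and closed,
  so a rotation turns \<open>\<nabla>E\<^sub>a\<close> into multiples of \<open>b\<close>. The Poincare lemma on the
  hypersurfaces of constant \<open>u\<close> then yields \<open>dx, dy = E\<^sub>a + f\<^sub>a du\<close>, and the null covector \<open>\<psi>\<close>
  dual to \<open>b\<close> and orthogonal to \<open>dx, dy\<close> is \<open>dv + f du\<close> for the same reason. Thus
  \<open>a = -2 du \<psi> + dx\<^sup>2 + dy\<^sup>2\<close> has the form of Class 2 with \<open>H = -2 f\<close>; in these coordinates
  \<open>\<nabla>b = 0\<close> says that \<open>H\<close> does not depend on \<open>v\<close>, and the \<open>uu\<close> component of the Ricci tensor is a multiple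
  of the Laplacian of \<open>H\<close>.\<close>

section \<open>Calculus of smooth maps\<close>

text \<open>Frames consist of covectors rather than vectors, because a closed covector is a
  differential and so becomes a coordinate; by symmetry of the Christoffel symbols, closedness can
  be read off from covariant derivatives. The obstacle is the null case. On the quotient by b the
  inverse metric is then degenerate, so the vacuum equations leave the components of a plane wave
  free, and a parallel coframe need not exist. What rescues the argument is that plane rotations
  commute: the differential of the connection form of E3, E4 is a curvature component without a
  quadratic term, so its vanishing yields an angle. All constructions are local, but one alternative
  has to hold on a whole component. The bridge is that the zeros and the null points of b both form
  open sets with open complement. In the null case coordinates are changed twice: once to make b a
  coordinate differential and to normalise the metric at a single point, and once more to normalise
  it in a neighbourhood.\<close>

lemma frechet_derivative_eqI:
  "(f has_derivative D) (at x) \<Longrightarrow> frechet_derivative f (at x) = D"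
  using frechet_derivative_at by force

lemma times_differentiable_on_cong:
  assumes "open S" "\<And>x. x \<in> S \<Longrightarrow> f x = g x"
  shows "times_differentiable_on k f S \<longleftrightarrow> times_differentiable_on k g S"
  using assms(2)
proof (induction k arbitrary: f g)
  case 0
  then show ?case by (auto cong: continuous_on_cong)
next
  case (Suc k)
  have d: "f differentiable (at x) \<longleftrightarrow> g differentiable (at x)" if "x \<in> S" for x
    unfolding differentiable_def
    using has_derivative_transform_within_open[OF _ assms(1) that, of f _ UNIV g]
      has_derivative_transform_within_open[OF _ assms(1) that, of g _ UNIV f] Suc.prems
    by metis
  have "frechet_derivative f (at x) = frechet_derivative g (at x)"
    if "x \<in> S" "f differentiable (at x)" for x
    using frechet_derivative_transform_within_open[OF that(2) assms(1) that(1)] Suc.prems by auto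
  then have "times_differentiable_on k (\<lambda>x. frechet_derivative f (at x) v) S
      \<longleftrightarrow> times_differentiable_on k (\<lambda>x. frechet_derivative g (at x) v) S"
    if "\<forall>x\<in>S. f differentiable (at x)" for v
    using that by (intro Suc.IH) auto
  with d show ?case by (auto simp: )
qed

lemma times_differentiable_on_SucD:
  "times_differentiable_on (Suc k) f S \<Longrightarrow> times_differentiable_on k f S"
proof (induction k arbitrary: f)
  case 0
  then show ?case
    by (auto intro!: continuous_at_imp_continuous_on differentiable_imp_continuous_within)
next
  case (Suc k)
  then show ?case by (auto simp del: times_differentiable_on.simps(2)
      simp: times_differentiable_on.simps(2)[of k] times_differentiable_on.simps(2)[of "Suc k"])
qed

lemma times_differentiable_on_subset:
  "times_differentiable_on k f S \<Longrightarrow> T \<subseteq> S \<Longrightarrow> times_differentiable_on k f T"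
  by (induction k arbitrary: f) (auto intro: continuous_on_subset)

text \<open>Lets a formula for the derivative take the place of \<open>frechet_derivative\<close> in
  the recursion. Most bootstrapping arguments rest on it: if the derivative is an expression in the
  function itself, each order of differentiability yields the next.\<close>

lemma times_differentiable_on_SucI:
  assumes "open S" "\<And>x. x \<in> S \<Longrightarrow> (f has_derivative f' x) (at x)"
    "\<And>v. times_differentiable_on k (\<lambda>x. f' x v) S"
  shows "times_differentiable_on (Suc k) f S"
proof -
  have "f differentiable (at x)" if "x \<in> S" for x
    using assms(2)[OF that] differentiable_def by blast
  moreover have "times_differentiable_on k (\<lambda>x. frechet_derivative f (at x) v) S" for v
    using assms(3)[of v] frechet_derivative_eqI[OF assms(2)]
    by (subst times_differentiable_on_cong[OF assms(1), of _ "\<lambda>x. f' x v"]) auto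
  ultimately show ?thesis by simp
qed

lemma times_differentiable_on_Suc_has_derivative:
  "times_differentiable_on (Suc k) f S \<Longrightarrow> x \<in> S \<Longrightarrow>
    (f has_derivative frechet_derivative f (at x)) (at x)"
  by (simp add: frechet_derivative_works)

lemma times_differentiable_on_const: "open S \<Longrightarrow> times_differentiable_on k (\<lambda>x. c) S"
  by (induction k arbitrary: c) (auto)

lemma times_differentiable_on_linear:
  assumes "open S" "bounded_linear f"
  shows "times_differentiable_on k f S"
proof (cases k)
  case 0
  then show ?thesis using assms(2) by (simp add: linear_continuous_on)
next
  case (Suc n)
  then show ?thesis
    using times_differentiable_on_SucI[OF assms(1), of f "\<lambda>_. f"] bounded_linear_imp_has_derivative[OF assms(2)]
      times_differentiable_on_const[OF assms(1)] by auto
qed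

lemma times_differentiable_on_add:
  assumes "open S" "times_differentiable_on k f S" "times_differentiable_on k g S"
  shows "times_differentiable_on k (\<lambda>x. f x + g x) S"
  using assms(2,3)
proof (induction k arbitrary: f g)
  case (Suc k)
  show ?case
    by (rule times_differentiable_on_SucI[OF assms(1), of _
          "\<lambda>x v. frechet_derivative f (at x) v + frechet_derivative g (at x) v"])
      (use Suc in \<open>auto intro!: has_derivative_add simp: frechet_derivative_works[symmetric]\<close>)
qed (auto intro: continuous_on_add)

text \<open>The product rule returns two products of the same kind with one factor differentiated,
  so the induction closes. Scalar, inner and matrix products are all instances.\<close>

lemma times_differentiable_on_bilinear:
  assumes "bounded_bilinear pr" "open S"
    "times_differentiable_on k f S" "times_differentiable_on k g S"
  shows "times_differentiable_on k (\<lambda>x. pr (f x) (g x)) S"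
  using assms(3,4)
proof (induction k arbitrary: f g)
  case 0
  then show ?case using bounded_bilinear.continuous_on[OF assms(1)] by auto
next
  case (Suc k)
  show ?case
  proof (rule times_differentiable_on_SucI[OF assms(2), of _
          "\<lambda>x v. pr (f x) (frechet_derivative g (at x) v) + pr (frechet_derivative f (at x) v) (g x)"])
    show "((\<lambda>x. pr (f x) (g x)) has_derivative
       (\<lambda>v. pr (f x) (frechet_derivative g (at x) v) + pr (frechet_derivative f (at x) v) (g x))) (at x)"
      if "x \<in> S" for x
      using Suc.prems that
      by (intro bounded_bilinear.FDERIV[OF assms(1)] times_differentiable_on_Suc_has_derivative) auto
    show "times_differentiable_on k (\<lambda>x. pr (f x) (frechet_derivative g (at x) v)
        + pr (frechet_derivative f (at x) v) (g x)) S" for v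
      using Suc.prems times_differentiable_on_SucD[OF Suc.prems(1)] times_differentiable_on_SucD[OF Suc.prems(2)]
      by (intro times_differentiable_on_add assms(2) Suc.IH) auto
  qed
qed

lemma times_differentiable_on_sum:
  assumes "open S" "\<And>i. i \<in> I \<Longrightarrow> times_differentiable_on k (f i) S"
  shows "times_differentiable_on k (\<lambda>x. \<Sum>i\<in>I. f i x) S"
  using assms(2)
  by (induction I rule: infinite_finite_induct)
    (auto intro!: times_differentiable_on_const times_differentiable_on_add assms(1))

text \<open>The recursion only sees derivatives in a fixed direction, whereas the chain rule feeds
  the varying direction f'(x) v into g'. Expanding it in \<open>Basis\<close> leaves fixed
  directions with varying coefficients; this is why the middle space is Euclidean.\<close>

lemma times_differentiable_on_compose:
  fixes f :: "'a::real_normed_vector \<Rightarrow> 'b::euclidean_space" and g :: "'b \<Rightarrow> 'c::real_normed_vector"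
  assumes "open S" "open T" "times_differentiable_on k f S" "times_differentiable_on k g T"
    "\<And>x. x \<in> S \<Longrightarrow> f x \<in> T"
  shows "times_differentiable_on k (\<lambda>x. g (f x)) S"
  using assms(3,4)
proof (induction k arbitrary: g)
  case 0
  then show ?case using assms(5) by (auto intro: continuous_on_compose2)
next
  case (Suc k)
  let ?D = "\<lambda>x v. \<Sum>i\<in>Basis. (frechet_derivative f (at x) v \<bullet> i) *\<^sub>R frechet_derivative g (at (f x)) i"
  show ?case
  proof (rule times_differentiable_on_SucI[OF assms(1), of _ ?D])
    fix x assume x: "x \<in> S"
    have g: "(g has_derivative frechet_derivative g (at (f x))) (at (f x))"
      using Suc.prems assms(5)[OF x] by (intro times_differentiable_on_Suc_has_derivative)
    then have lin: "linear (frechet_derivative g (at (f x)))"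
      using has_derivative_linear by blast
    have "frechet_derivative g (at (f x)) (frechet_derivative f (at x) v) = ?D x v" for v
      by (subst euclidean_representation[of "frechet_derivative f (at x) v", symmetric])
        (simp add: linear_sum[OF lin] linear_cmul[OF lin])
    moreover have "((\<lambda>x. g (f x)) has_derivative
        (\<lambda>v. frechet_derivative g (at (f x)) (frechet_derivative f (at x) v))) (at x)"
      using diff_chain_at[OF times_differentiable_on_Suc_has_derivative[OF Suc.prems(1) x] g]
      by (simp add: comp_def)
    ultimately show "((\<lambda>x. g (f x)) has_derivative ?D x) (at x)" by simp
  next
    fix v
    have 1: "times_differentiable_on k (\<lambda>x. frechet_derivative f (at x) v \<bullet> i) S" for i
      by (rule times_differentiable_on_bilinear[OF bounded_bilinear_inner assms(1) _
          times_differentiable_on_const[OF assms(1)]]) (use Suc.prems(1) in simp)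
    have 2: "times_differentiable_on k (\<lambda>x. frechet_derivative g (at (f x)) i) S" for i
      using Suc.IH[of "\<lambda>y. frechet_derivative g (at y) i"] Suc.prems
        times_differentiable_on_SucD[OF Suc.prems(1)]
      by auto
    show "times_differentiable_on k (\<lambda>x. ?D x v) S"
      by (intro times_differentiable_on_sum assms(1) 
          times_differentiable_on_bilinear[OF bounded_bilinear_scaleR] 1 2)
  qed
qed

lemma smooth_on_cong:
  "open S \<Longrightarrow> (\<And>x. x \<in> S \<Longrightarrow> f x = g x) \<Longrightarrow> smooth_on S f \<longleftrightarrow> smooth_on S g"
  unfolding smooth_on_def using times_differentiable_on_cong by metis

lemma smooth_on_subset: "smooth_on S f \<Longrightarrow> T \<subseteq> S \<Longrightarrow> smooth_on T f"
  unfolding smooth_on_def using times_differentiable_on_subset by blast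

lemma smooth_on_continuous: "smooth_on S f \<Longrightarrow> continuous_on S f"
  unfolding smooth_on_def using times_differentiable_on.simps(1) by blast

lemma smooth_on_differentiable: "smooth_on S f \<Longrightarrow> x \<in> S \<Longrightarrow> f differentiable (at x)"
  unfolding smooth_on_def using times_differentiable_on.simps(2)[of 0] by blast

lemma smooth_on_has_derivative:
  "smooth_on S f \<Longrightarrow> x \<in> S \<Longrightarrow> (f has_derivative frechet_derivative f (at x)) (at x)"
  using smooth_on_differentiable frechet_derivative_works by blast

lemma smooth_on_derivative: "smooth_on S f \<Longrightarrow> smooth_on S (\<lambda>x. frechet_derivative f (at x) v)"
  unfolding smooth_on_def using times_differentiable_on.simps(2) by blast

lemma smooth_on_const: "open S \<Longrightarrow> smooth_on S (\<lambda>x. c)"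
  by (simp add: smooth_on_def times_differentiable_on_const)

lemma smooth_on_linear: "bounded_linear f \<Longrightarrow> open S \<Longrightarrow> smooth_on S f"
  by (simp add: smooth_on_def times_differentiable_on_linear)

lemma smooth_on_ident: "open S \<Longrightarrow> smooth_on S (\<lambda>x. x)"
  by (simp add: smooth_on_linear)

lemma smooth_on_bilinear:
  assumes "bounded_bilinear pr"
  shows "open S \<Longrightarrow> smooth_on S f \<Longrightarrow> smooth_on S g \<Longrightarrow> smooth_on S (\<lambda>x. pr (f x) (g x))"
  by (simp add: smooth_on_def times_differentiable_on_bilinear[OF assms])

lemmas smooth_on_scaleR = smooth_on_bilinear[OF bounded_bilinear_scaleR]
lemmas smooth_on_inner = smooth_on_bilinear[OF bounded_bilinear_inner]

lemma smooth_on_mult: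
  fixes f g :: "_ \<Rightarrow> real"
  shows "open S \<Longrightarrow> smooth_on S f \<Longrightarrow> smooth_on S g \<Longrightarrow> smooth_on S (\<lambda>x. f x * g x)"
  by (rule smooth_on_bilinear[OF bounded_bilinear_mult])

lemma smooth_on_add:
  "open S \<Longrightarrow> smooth_on S f \<Longrightarrow> smooth_on S g \<Longrightarrow> smooth_on S (\<lambda>x. f x + g x)"
  by (simp add: smooth_on_def times_differentiable_on_add)

lemma smooth_on_sum:
  "open S \<Longrightarrow> (\<And>i. i \<in> I \<Longrightarrow> smooth_on S (f i)) \<Longrightarrow> smooth_on S (\<lambda>x. \<Sum>i\<in>I. f i x)"
  by (simp add: smooth_on_def times_differentiable_on_sum)

lemma smooth_on_compose:
  fixes f :: "'a::real_normed_vector \<Rightarrow> 'b::euclidean_space"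
  assumes "open S" "open T" "smooth_on S f" "smooth_on T g" "\<And>x. x \<in> S \<Longrightarrow> f x \<in> T"
  shows "smooth_on S (\<lambda>x. g (f x))"
  unfolding smooth_on_def
proof
  fix k
  show "times_differentiable_on k (\<lambda>x. g (f x)) S"
    by (rule times_differentiable_on_compose[OF assms(1,2)]) (use assms in \<open>auto simp: smooth_on_def\<close>)
qed

lemma smooth_on_linear_compose:
  fixes g :: "'b::euclidean_space \<Rightarrow> 'c::real_normed_vector"
  shows "bounded_linear g \<Longrightarrow> open S \<Longrightarrow> smooth_on S f \<Longrightarrow> smooth_on S (\<lambda>x. g (f x))"
  by (rule smooth_on_compose[OF _ open_UNIV]) (auto intro: smooth_on_linear)

lemma smooth_on_uminus:
  fixes f :: "_ \<Rightarrow> 'b::real_normed_vector"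
  assumes "open S" "smooth_on S f"
  shows "smooth_on S (\<lambda>x. - f x)"
  using smooth_on_scaleR[OF assms(1) smooth_on_const[OF assms(1), of "-1"] assms(2)] by simp

lemma smooth_on_diff:
  assumes "open S" "smooth_on S f" "smooth_on S g"
  shows "smooth_on S (\<lambda>x. f x - g x)"
  using smooth_on_add[OF assms(1,2) smooth_on_uminus[OF assms(1,3)]] by simp

lemma smooth_on_prod:
  fixes f :: "'i \<Rightarrow> _ \<Rightarrow> real"
  shows "open S \<Longrightarrow> (\<And>i. i \<in> I \<Longrightarrow> smooth_on S (f i)) \<Longrightarrow> smooth_on S (\<lambda>x. \<Prod>i\<in>I. f i x)"
  by (induction I rule: infinite_finite_induct) (auto intro: smooth_on_const smooth_on_mult)

lemma smooth_on_vec_nth: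
  fixes f :: "_ \<Rightarrow> 'b::euclidean_space^'n"
  shows "open S \<Longrightarrow> smooth_on S f \<Longrightarrow> smooth_on S (\<lambda>x. f x $ i)"
  by (rule smooth_on_linear_compose[OF bounded_linear_vec_nth])

lemma smooth_on_vec_lambda:
  fixes f :: "'n::finite \<Rightarrow> _ \<Rightarrow> 'b::euclidean_space"
  assumes "open S" "\<And>i. smooth_on S (f i)"
  shows "smooth_on S (\<lambda>x. \<chi> i. f i x)"
proof -
  have eq: "(\<chi> i. f i x) = (\<Sum>i\<in>UNIV. axis i (f i x))" for x
    by (simp add: vec_eq_iff axis_def if_distrib cong: if_cong)
  have "bounded_linear (axis i :: 'b \<Rightarrow> 'b^'n)" for i
    unfolding linear_conv_bounded_linear[symmetric]
    by (intro linearI) (auto simp: axis_def vec_eq_iff)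
  then show ?thesis unfolding eq
    by (intro smooth_on_sum assms(1) smooth_on_linear_compose[of "axis _"] assms(2))
qed

section \<open>Elementary real functions\<close>

lemma smooth_on_inverse_real: "smooth_on {x::real. x \<noteq> 0} inverse"
proof -
  let ?S = "{x::real. x \<noteq> 0}"
  have op: "open ?S" by (simp add: open_Collect_neq continuous_on_id)
  \<comment> \<open>The derivative is a polynomial in \<open>inverse\<close> itself.\<close>
  have "times_differentiable_on k inverse ?S" for k
  proof (induction k)
    case 0
    then show ?case by (auto intro!: continuous_intros)
  next
    case (Suc k)
    show ?case
    proof (rule times_differentiable_on_SucI[OF op, of _ "\<lambda>x v. (-v) * (inverse x * inverse x)"])
      show "(inverse has_derivative (\<lambda>v. (-v) * (inverse x * inverse x))) (at x)"
        if "x \<in> ?S" for x :: real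
        using that by (auto intro!: derivative_eq_intros simp: fun_eq_iff)
      show "times_differentiable_on k (\<lambda>x. (-v) * (inverse x * inverse x)) ?S" for v :: real
        by (intro times_differentiable_on_bilinear[OF bounded_bilinear_mult] op
            times_differentiable_on_const Suc)
    qed
  qed
  then show ?thesis by (simp add: smooth_on_def)
qed

lemma smooth_on_inverse:
  fixes f :: "_ \<Rightarrow> real"
  assumes "open S" "smooth_on S f" "\<And>x. x \<in> S \<Longrightarrow> f x \<noteq> 0"
  shows "smooth_on S (\<lambda>x. inverse (f x))"
  by (rule smooth_on_compose[OF assms(1) _ assms(2) smooth_on_inverse_real])
    (use assms(3) in \<open>auto simp: open_Collect_neq continuous_on_id\<close>)

lemma smooth_on_divide:
  fixes f g :: "_ \<Rightarrow> real"
  assumes "open S" "smooth_on S f" "smooth_on S g" "\<And>x. x \<in> S \<Longrightarrow> g x \<noteq> 0"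
  shows "smooth_on S (\<lambda>x. f x / g x)"
  unfolding divide_inverse by (intro smooth_on_mult smooth_on_inverse assms)

lemma smooth_on_sqrt_real: "smooth_on {0::real<..} sqrt"
proof -
  let ?S = "{0::real<..}"
  have "times_differentiable_on k sqrt ?S" for k
  proof (induction k)
    case 0
    then show ?case by (auto intro!: continuous_intros)
  next
    case (Suc k)
    show ?case
    proof (rule times_differentiable_on_SucI[of _ _ "\<lambda>x v. (v / 2) * inverse (sqrt x)"])
      show "(sqrt has_derivative (\<lambda>v. (v / 2) * inverse (sqrt x))) (at x)" if "x \<in> ?S" for x
        using that by (auto intro!: derivative_eq_intros simp: fun_eq_iff field_simps)
      have "times_differentiable_on k (\<lambda>x. inverse (sqrt x)) ?S"
        by (rule times_differentiable_on_compose[of _ "{x. x \<noteq> 0}"])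
          (use Suc smooth_on_inverse_real in \<open>auto simp: open_Collect_neq continuous_on_id smooth_on_def\<close>)
      then show "times_differentiable_on k (\<lambda>x. (v / 2) * inverse (sqrt x)) ?S" for v :: real
        by (intro times_differentiable_on_bilinear[OF bounded_bilinear_mult]
            times_differentiable_on_const) auto
    qed auto
  qed
  then show ?thesis by (simp add: smooth_on_def)
qed

lemma smooth_on_sqrt:
  assumes "open S" "smooth_on S f" "\<And>x. x \<in> S \<Longrightarrow> f x > 0"
  shows "smooth_on S (\<lambda>x. sqrt (f x))"
  by (rule smooth_on_compose[OF assms(1) _ assms(2) smooth_on_sqrt_real]) (use assms(3) in auto)

lemma smooth_on_sin_cos_real: "smooth_on UNIV (sin :: real \<Rightarrow> real)" "smooth_on UNIV (cos :: real \<Rightarrow> real)"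
proof -
  have "times_differentiable_on k (sin :: real \<Rightarrow> real) UNIV \<and>
    times_differentiable_on k (cos :: real \<Rightarrow> real) UNIV" for k
  proof (induction k)
    case 0
    then show ?case by (auto intro!: continuous_intros)
  next
    case (Suc k)
    have "times_differentiable_on (Suc k) (sin :: real \<Rightarrow> real) UNIV"
      by (rule times_differentiable_on_SucI[of _ _ "\<lambda>x v. v * cos x"])
        (auto intro!: derivative_eq_intros times_differentiable_on_bilinear[OF bounded_bilinear_mult]
            times_differentiable_on_const conjunct2[OF Suc])
    moreover have "times_differentiable_on k (\<lambda>x. (-v) * sin x) UNIV" for v :: real
      by (intro times_differentiable_on_bilinear[OF bounded_bilinear_mult]
            times_differentiable_on_const conjunct1[OF Suc]) auto
    then have "times_differentiable_on (Suc k) (cos :: real \<Rightarrow> real) UNIV"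
      by (intro times_differentiable_on_SucI[of _ _ "\<lambda>x v. (-v) * sin x"])
        (auto intro!: derivative_eq_intros)
    ultimately show ?case by blast
  qed
  then show "smooth_on UNIV (sin :: real \<Rightarrow> real)" "smooth_on UNIV (cos :: real \<Rightarrow> real)"
    by (simp_all add: smooth_on_def)
qed

lemma smooth_on_sin: "open S \<Longrightarrow> smooth_on S f \<Longrightarrow> smooth_on S (\<lambda>x. sin (f x :: real))"
  by (rule smooth_on_compose[OF _ open_UNIV _ smooth_on_sin_cos_real(1)]) auto

lemma smooth_on_cos: "open S \<Longrightarrow> smooth_on S f \<Longrightarrow> smooth_on S (\<lambda>x. cos (f x :: real))"
  by (rule smooth_on_compose[OF _ open_UNIV _ smooth_on_sin_cos_real(2)]) auto


section \<open>Partial derivatives\<close>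

text \<open>Vector-valued counterpart of \<open>partial_deriv\<close>, so that covector and matrix
  fields can be differentiated without splitting them into components.\<close>

definition pd :: "4 \<Rightarrow> (real^4 \<Rightarrow> 'b::real_normed_vector) \<Rightarrow> real^4 \<Rightarrow> 'b" where
  "pd i f x = frechet_derivative f (at x) (axis i 1)"

lemma partial_deriv_eq_pd: "partial_deriv i f x = pd i f x"
  by (simp add: partial_deriv_def pd_def)

lemma pd_eqI: "(f has_derivative D) (at x) \<Longrightarrow> pd i f x = D (axis i 1)"
  by (simp add: pd_def frechet_derivative_eqI)

lemma pd_const [simp]: "pd i (\<lambda>x. c) x = 0"
  by (simp add: pd_def)

lemma pd_bilinear:
  assumes "bounded_bilinear pr" "f differentiable (at x)" "g differentiable (at x)"
  shows "pd i (\<lambda>x. pr (f x) (g x)) x = pr (f x) (pd i g x) + pr (pd i f x) (g x)"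
  using bounded_bilinear.FDERIV[OF assms(1)] assms(2,3)
  by (subst pd_eqI) (auto simp: pd_def frechet_derivative_works)

lemma pd_linear:
  assumes "bounded_linear L" "f differentiable (at x)"
  shows "pd i (\<lambda>x. L (f x)) x = L (pd i f x)"
  using bounded_linear.has_derivative[OF assms(1)] assms(2)
  by (subst pd_eqI) (auto simp: pd_def frechet_derivative_works)

lemma pd_add:
  assumes "f differentiable (at x)" "g differentiable (at x)"
  shows "pd i (\<lambda>x. f x + g x) x = pd i f x + pd i g x"
  using has_derivative_add assms by (subst pd_eqI) (auto simp: pd_def frechet_derivative_works)

lemma pd_diff:
  assumes "f differentiable (at x)" "g differentiable (at x)"
  shows "pd i (\<lambda>x. f x - g x) x = pd i f x - pd i g x"
  using has_derivative_diff assms by (subst pd_eqI) (auto simp: pd_def frechet_derivative_works)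

lemma pd_coord: "pd i (\<lambda>x. x $ j) x = (if i = j then 1 else 0)"
  by (subst pd_eqI[OF bounded_linear_imp_has_derivative[OF bounded_linear_vec_nth]]) (auto simp: axis_def)

lemma pd_cong:
  assumes "open S" "x \<in> S" "\<And>y. y \<in> S \<Longrightarrow> f y = g y" "f differentiable (at x)"
  shows "pd i f x = pd i g x"
  unfolding pd_def using frechet_derivative_transform_within_open[OF assms(4,1,2,3)] by simp

lemma pd_nth: "f differentiable (at x) \<Longrightarrow> pd i f x $ j = pd i (\<lambda>z. f z $ j) x"
  by (rule pd_linear[OF bounded_linear_vec_nth, symmetric])

lemma differentiable_nth: "f differentiable (at x) \<Longrightarrow> (\<lambda>z. f z $ j) differentiable (at x)"
  unfolding differentiable_def using bounded_linear.has_derivative[OF bounded_linear_vec_nth] by blast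

lemma pd_nth_nth:
  fixes f :: "real^4 \<Rightarrow> real^'n^'m"
  shows "f differentiable (at x) \<Longrightarrow> pd i f x $ j $ k = pd i (\<lambda>z. f z $ j $ k) x"
  using pd_nth[of f x i j] pd_nth[of "\<lambda>z. f z $ j" x i k] differentiable_nth[of f x j] by simp

lemma smooth_on_pd: "smooth_on S f \<Longrightarrow> smooth_on S (pd i f)"
  unfolding pd_def by (rule smooth_on_derivative)

lemma frechet_eq_sum_pd:
  assumes "f differentiable (at x)"
  shows "frechet_derivative f (at x) v = (\<Sum>i\<in>UNIV. v $ i *\<^sub>R pd i f x)"
proof -
  have lin: "linear (frechet_derivative f (at x))"
    by (rule linear_frechet_derivative[OF assms])
  have "v = (\<Sum>i\<in>UNIV. v $ i *\<^sub>R axis i 1)"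
    by (simp add: vec_eq_iff axis_def if_distrib cong: if_cong)
  then have "frechet_derivative f (at x) v = frechet_derivative f (at x) (\<Sum>i\<in>UNIV. v $ i *\<^sub>R axis i 1)"
    by simp
  then show ?thesis by (simp add: linear_sum[OF lin] linear_cmul[OF lin] pd_def)
qed

lemma has_derivative_pd:
  "f differentiable (at x) \<Longrightarrow> (f has_derivative (\<lambda>v. \<Sum>i\<in>UNIV. v $ i *\<^sub>R pd i f x)) (at x)"
  using frechet_derivative_works frechet_eq_sum_pd by (metis (no_types, lifting) ext)

lemma has_vector_derivative_along:
  assumes "f differentiable (at (\<gamma> t))" "(\<gamma> has_vector_derivative v) (at t within T)"
  shows "((\<lambda>s. f (\<gamma> s)) has_vector_derivative (\<Sum>i\<in>UNIV. v $ i *\<^sub>R pd i f (\<gamma> t))) (at t within T)"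
proof -
  have "((f \<circ> \<gamma>) has_derivative (\<lambda>v. \<Sum>i\<in>UNIV. v $ i *\<^sub>R pd i f (\<gamma> t)) \<circ> (\<lambda>h. h *\<^sub>R v)) (at t within T)"
    by (rule diff_chain_within)
      (use assms(2) has_derivative_at_withinI[OF has_derivative_pd[OF assms(1)]]
        in \<open>auto simp: has_vector_derivative_def\<close>)
  then show ?thesis
    by (simp add: has_vector_derivative_def comp_def scaleR_sum_right)
qed

lemma has_vector_derivative_pd:
  assumes "f differentiable (at (x + t *\<^sub>R axis i 1))"
  shows "((\<lambda>s. f (x + s *\<^sub>R axis i 1)) has_vector_derivative pd i f (x + t *\<^sub>R axis i 1)) (at t within T)"
proof -
  have "((\<lambda>s. x + s *\<^sub>R axis i 1) has_vector_derivative axis i 1) (at t within T)"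
    by (auto intro!: derivative_eq_intros)
  from has_vector_derivative_along[OF assms this] show ?thesis
    by (simp add: axis_def if_distrib[of "\<lambda>c. c *\<^sub>R _"] cong: if_cong)
qed

text \<open>Both mixed partial derivatives are obtained by differentiating
  \<open>f (x + t e\<^sub>j) - f x = \<integral> \<partial>\<^sub>j f\<close> under the integral sign.\<close>

lemma pd_commute:
  fixes f :: "real^4 \<Rightarrow> 'b::banach"
  assumes S: "open S" "x \<in> S" and f: "smooth_on S f"
  shows "pd i (pd j f) x = pd j (pd i f) x"
proof -
  define e where "e k = axis k (1::real)" for k :: 4
  obtain R where R: "R > 0" "ball x R \<subseteq> S" using S open_contains_ball by blast
  \<comment> \<open>Two displacements of length at most \<open>d\<close> then stay inside the
    ball.\<close>
  define d where "d = R / 3"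
  have d: "d > 0" using R by (simp add: d_def)
  define P where "P s t = x + s *\<^sub>R e i + t *\<^sub>R e j" for s t
  have P: "P s t \<in> S" if "\<bar>s\<bar> \<le> d" "\<bar>t\<bar> \<le> d" for s t
  proof -
    have "dist x (P s t) \<le> norm (s *\<^sub>R e i) + norm (t *\<^sub>R e j)"
      unfolding P_def dist_norm
      by (metis add.assoc add_diff_cancel_left' norm_minus_commute norm_triangle_ineq)
    also have "\<dots> \<le> d + d" using that by (simp add: e_def)
    also have "\<dots> < R" using R by (simp add: d_def)
    finally show ?thesis using R by auto
  qed
  have sj: "smooth_on S (pd j f)" and si: "smooth_on S (pd i f)"
    and sij: "smooth_on S (pd i (pd j f))"
    using f by (auto intro: smooth_on_pd)
  have di: "((\<lambda>s. g (P s t)) has_vector_derivative pd i g (P s t)) (at s within T)"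
    if "smooth_on S g" "\<bar>s\<bar> \<le> d" "\<bar>t\<bar> \<le> d" for g :: "real^4 \<Rightarrow> 'b" and s t T
    using has_vector_derivative_pd[of g "x + t *\<^sub>R e j" s i T]
      smooth_on_differentiable[OF that(1) P[OF that(2,3)]]
    by (simp add: P_def e_def algebra_simps)
  have dj: "((\<lambda>t. g (P s t)) has_vector_derivative pd j g (P s t)) (at t within T)"
    if "smooth_on S g" "\<bar>s\<bar> \<le> d" "\<bar>t\<bar> \<le> d" for g :: "real^4 \<Rightarrow> 'b" and s t T
    using has_vector_derivative_pd[of g "x + s *\<^sub>R e i" t j T]
      smooth_on_differentiable[OF that(1) P[OF that(2,3)]]
    by (simp add: P_def e_def algebra_simps)
  have cont: "continuous_on ({-d..d} \<times> {0..d}) (\<lambda>(s, t). g (P s t))"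
    if "smooth_on S g" for g :: "real^4 \<Rightarrow> 'b"
    unfolding split_def
    by (rule continuous_on_compose2[OF smooth_on_continuous[OF that]])
      (auto simp: P_def intro!: continuous_intros P[unfolded P_def])
  have cont2: "continuous_on {0..t} (\<lambda>t. g (P s t))" if "smooth_on S g" "\<bar>s\<bar> \<le> d" "t \<le> d"
    for g :: "real^4 \<Rightarrow> 'b" and s t
    by (rule continuous_on_compose2[OF smooth_on_continuous[OF that(1)]])
      (use that in \<open>auto simp: P_def intro!: continuous_intros P[unfolded P_def]\<close>)
  have eq: "pd i f (P 0 t) - pd i f (P 0 0) = integral {0..t} (\<lambda>\<tau>. pd i (pd j f) (P 0 \<tau>))"
    if t: "t \<in> {0..d}" for t
  proof -
    have "((\<lambda>s. integral (cbox 0 t) (\<lambda>\<tau>. pd j f (P s \<tau>))) has_vector_derivative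
        integral (cbox 0 t) (\<lambda>\<tau>. pd i (pd j f) (P 0 \<tau>))) (at 0 within {-d..d})"
    proof (rule leibniz_rule_vector_derivative[where U = "{-d..d}" and fx = "\<lambda>s \<tau>. pd i (pd j f) (P s \<tau>)"])
      show "continuous_on ({-d..d} \<times> cbox 0 t) (\<lambda>(s, \<tau>). pd i (pd j f) (P s \<tau>))"
        by (rule continuous_on_subset[OF cont[OF sij]]) (use t in auto)
      show "(\<lambda>\<tau>. pd j f (P s \<tau>)) integrable_on cbox 0 t" if "s \<in> {-d..d}" for s
        using cont2[OF sj, of s t] that t by (auto intro!: integrable_continuous_real)
    qed (use d t in \<open>auto intro!: di[OF sj]\<close>)
    moreover have "integral (cbox 0 t) (\<lambda>\<tau>. pd j f (P s \<tau>)) = f (P s t) - f (P s 0)"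
      if "s \<in> {-d..d}" for s
      using t that by (auto intro!: integral_unique fundamental_theorem_of_calculus dj[OF f])
    ultimately have "((\<lambda>s. f (P s t) - f (P s 0)) has_vector_derivative
        integral {0..t} (\<lambda>\<tau>. pd i (pd j f) (P 0 \<tau>))) (at 0 within {-d..d})"
      using d by (auto intro: has_vector_derivative_transform[rotated 2])
    moreover have "((\<lambda>s. f (P s t) - f (P s 0)) has_vector_derivative
        pd i f (P 0 t) - pd i f (P 0 0)) (at 0 within {-d..d})"
      using t d by (intro has_vector_derivative_diff di[OF f]) auto
    ultimately show ?thesis
      using d vector_derivative_unique_within_closed_interval[of "-d" d 0] by (auto simp: )
  qed
  \<comment> \<open>The integral is only available for t \<ge> 0, so the derivative at 0 is
    one-sided; on a nondegenerate interval it is still unique.\<close>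
  have "((\<lambda>t. integral {0..t} (\<lambda>\<tau>. pd i (pd j f) (P 0 \<tau>))) has_vector_derivative
      pd i (pd j f) (P 0 0)) (at 0 within {0..d})"
    using d by (intro integral_has_vector_derivative cont2[OF sij]) auto
  moreover have "((\<lambda>t. integral {0..t} (\<lambda>\<tau>. pd i (pd j f) (P 0 \<tau>))) has_vector_derivative
      pd j (pd i f) (P 0 0) - 0) (at 0 within {0..d})"
  proof (rule has_vector_derivative_transform[of 0 _ _ "\<lambda>t. pd i f (P 0 t) - pd i f (P 0 0)"])
    show "((\<lambda>t. pd i f (P 0 t) - pd i f (P 0 0)) has_vector_derivative
      pd j (pd i f) (P 0 0) - 0) (at 0 within {0..d})"
      by (intro has_vector_derivative_diff has_vector_derivative_const dj[OF si]) (use d in auto)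
  qed (use d eq in auto)
  ultimately have "pd i (pd j f) (P 0 0) = pd j (pd i f) (P 0 0)"
    using d vector_derivative_unique_within_closed_interval[of 0 d 0] by auto
  then show ?thesis by (simp add: P_def)
qed

text \<open>Leibniz rule. Differentiability refers to derivatives in the ambient space, so the
  integrand has to live on an open \<open>W\<close> around the product with the closed
  interval.\<close>

lemma integral_param_has_derivative:
  fixes f :: "'a::euclidean_space \<times> real \<Rightarrow> 'b::euclidean_space"
  assumes S: "open S" "open W" "S \<times> {0..1} \<subseteq> W" and f: "times_differentiable_on (Suc 0) f W"
    and x: "x \<in> S"
  shows "((\<lambda>x. integral {0..1} (\<lambda>t. f (x, t))) has_derivative
    (\<lambda>v. integral {0..1} (\<lambda>t. frechet_derivative f (at (x, t)) (v, 0)))) (at x)"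
proof -
  \<comment> \<open>The Leibniz rule asks for an operator-valued derivative; its continuity is
    checked on one basis vector at a time.\<close>
  define D where "D x t = Blinfun (\<lambda>v. frechet_derivative f (at (x, t)) (v, 0))" for x t
  obtain r where r: "r > 0" "ball x r \<subseteq> S" using S x open_contains_ball by blast
  have der: "((\<lambda>x. f (x, t)) has_derivative (\<lambda>v. frechet_derivative f (at (y, t)) (v, 0))) (at y)"
    if "y \<in> S" "t \<in> {0..1}" for y t
  proof -
    have "(f has_derivative frechet_derivative f (at (y, t))) (at (y, t))"
      by (rule times_differentiable_on_Suc_has_derivative[OF f]) (use S that in auto)
    moreover have "((\<lambda>x. (x, t)) has_derivative (\<lambda>v. (v, 0))) (at y)"
      by (auto intro!: derivative_eq_intros)
    ultimately show ?thesis using diff_chain_at[of "\<lambda>x. (x, t)" _ y f] by (simp add: comp_def)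
  qed
  have app: "blinfun_apply (D y t) = (\<lambda>v. frechet_derivative f (at (y, t)) (v, 0))"
    if "y \<in> S" "t \<in> {0..1}" for y t
    unfolding D_def using bounded_linear_Blinfun_apply has_derivative_bounded_linear[OF der[OF that]] by blast
  have contv: "continuous_on (S \<times> {0..1}) (\<lambda>p. frechet_derivative f (at p) v)" for v
    by (rule continuous_on_subset[OF _ S(3)]) (use f in \<open>cases v, auto\<close>)
  have contD: "continuous_on (S \<times> {0..1}) (\<lambda>(x, t). D x t)"
    unfolding split_def
  proof (rule continuous_on_blinfun_componentwise)
    fix i :: 'a
    show "continuous_on (S \<times> {0..1}) (\<lambda>p. blinfun_apply (D (fst p) (snd p)) i)"
      by (rule continuous_on_eq[OF contv[of "(i, 0)"]]) (use app in auto)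
  qed
  have contDx: "continuous_on (cbox 0 1) (D x)"
    by (rule continuous_on_compose2[OF contD[unfolded split_def], of _ "\<lambda>t. (x, t)", simplified])
      (use x in \<open>auto intro!: continuous_intros\<close>)
  have "((\<lambda>x. integral (cbox 0 1) (\<lambda>t. f (x, t))) has_derivative integral (cbox 0 1) (D x)) (at x within ball x r)"
  proof (rule leibniz_rule[where fx = D])
    show "((\<lambda>x. f (x, t)) has_derivative blinfun_apply (D y t)) (at y within ball x r)"
      if "y \<in> ball x r" "t \<in> cbox 0 1" for y t
    proof -
      have "y \<in> S" "t \<in> {0..1}" using that r by auto
      from has_derivative_at_withinI[OF der[OF this]] app[OF this] show ?thesis by simp
    qed
    have fW: "continuous_on W f" using times_differentiable_on_SucD[OF f] by simp
    show "(\<lambda>t. f (y, t)) integrable_on cbox 0 1" if "y \<in> ball x r" for y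
    proof (intro integrable_continuous continuous_on_compose2[of W f "cbox 0 1" "\<lambda>t. (y, t)"])
      have "y \<in> S" using that r by auto
      then show "Pair y ` cbox 0 1 \<subseteq> W" using S by auto
    qed (auto intro!: continuous_intros fW)
    show "continuous_on (ball x r \<times> cbox 0 1) (\<lambda>(x, t). D x t)"
      by (rule continuous_on_subset[OF contD]) (use r in auto)
  qed (use r in auto)
  then have "((\<lambda>x. integral (cbox 0 1) (\<lambda>t. f (x, t))) has_derivative integral (cbox 0 1) (D x)) (at x)"
    using r at_within_open[of x "ball x r"] by auto
  moreover have "blinfun_apply (integral (cbox 0 1) (D x))
      = (\<lambda>v. integral {0..1} (\<lambda>t. frechet_derivative f (at (x, t)) (v, 0)))"
  proof
    fix v
    have "integral (cbox 0 1) ((\<lambda>L. blinfun_apply L v) \<circ> D x) = blinfun_apply (integral (cbox 0 1) (D x)) v"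
      by (rule integral_linear[OF integrable_continuous[OF contDx]]) (rule blinfun.bounded_linear_left)
    moreover have "integral {0..1} (\<lambda>t. blinfun_apply (D x t) v)
        = integral {0..1} (\<lambda>t. frechet_derivative f (at (x, t)) (v, 0))"
      by (rule integral_cong) (simp add: app[OF x])
    ultimately show "blinfun_apply (integral (cbox 0 1) (D x)) v
        = integral {0..1} (\<lambda>t. frechet_derivative f (at (x, t)) (v, 0))"
      by (simp add: comp_def)
  qed
  ultimately show ?thesis by simp
qed

lemma times_differentiable_on_integral_param:
  fixes f :: "'a::euclidean_space \<times> real \<Rightarrow> 'b::euclidean_space"
  assumes S: "open S" "open W" "S \<times> {0..1} \<subseteq> W" and f: "times_differentiable_on k f W"
  shows "times_differentiable_on k (\<lambda>x. integral {0..1} (\<lambda>t. f (x, t))) S"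
  using f
proof (induction k arbitrary: f)
  case 0
  then have "continuous_on (S \<times> cbox 0 1) (\<lambda>(x, t). f (x, t))"
    using S(3) by (auto intro: continuous_on_subset)
  from integral_continuous_on_param[OF this] show ?case by simp
next
  case (Suc k)
  have "times_differentiable_on (Suc 0) f W"
  proof -
    have "times_differentiable_on (Suc j) f W \<Longrightarrow> times_differentiable_on (Suc 0) f W" for j
      by (induction j) (simp_all only: times_differentiable_on_SucD)
    then show ?thesis using Suc.prems by blast
  qed
  note der = integral_param_has_derivative[OF S this]
  show ?case
  proof (rule times_differentiable_on_SucI[OF S(1) der])
    fix v :: 'a
    have "times_differentiable_on k (\<lambda>p. frechet_derivative f (at p) (v, 0)) W"
      using Suc.prems by simp
    from Suc.IH[OF this]
    show "times_differentiable_on k (\<lambda>x. integral {0..1} (\<lambda>t. frechet_derivative f (at (x, t)) (v, 0))) S" .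
  qed
qed

lemma smooth_on_integral_param:
  fixes f :: "'a::euclidean_space \<times> real \<Rightarrow> 'b::euclidean_space"
  assumes "open S" "open W" "S \<times> {0..1} \<subseteq> W" "smooth_on W f"
  shows "smooth_on S (\<lambda>x. integral {0..1} (\<lambda>t. f (x, t)))"
  unfolding smooth_on_def
proof
  fix k
  show "times_differentiable_on k (\<lambda>x. integral {0..1} (\<lambda>t. f (x, t))) S"
    by (rule times_differentiable_on_integral_param[OF assms(1-3)]) (use assms(4) in \<open>simp add: smooth_on_def\<close>)
qed


section \<open>Integration along cones\<close>

text \<open>At t = 0 this is the projection of \<open>x\<close> to the slice through
  \<open>c\<close>, at t = 1 it is \<open>x\<close>; the paths of one slice form a cone with that
  projection as apex.\<close>

definition slide :: "4 set \<Rightarrow> real^4 \<Rightarrow> real^4 \<Rightarrow> real \<Rightarrow> real^4" where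
  "slide I c x t = (\<chi> i. if i \<in> I then c $ i + t * (x $ i - c $ i) else x $ i)"

text \<open>The homotopy operator of the Poincare lemma for the form \<eta>_j dx^j on slices. It is
  vector-valued because it also serves as the integral operator of Picard iteration.\<close>

definition cone_integral ::
    "4 set \<Rightarrow> real^4 \<Rightarrow> (4 \<Rightarrow> real^4 \<Rightarrow> 'b::euclidean_space) \<Rightarrow> real^4 \<Rightarrow> 'b" where
  "cone_integral I c \<eta> x = integral {0..1} (\<lambda>t. \<Sum>j\<in>I. (x $ j - c $ j) *\<^sub>R \<eta> j (slide I c x t))"

lemma axis_one_nth: "axis i (1::real) $ j = (if j = i then 1 else 0)"
  by (simp add: axis_def)

lemma slide_1 [simp]: "slide I c x 1 = x"
  by (simp add: slide_def vec_eq_iff)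

text \<open>Moving some coordinates towards those of the centre never increases the distance to
  it.\<close>

lemma slide_in_ball:
  assumes "x \<in> ball c r" "t \<in> {0..1}"
  shows "slide I c x t \<in> ball c r"
proof -
  have "\<bar>t\<bar> \<le> 1" using assms(2) by auto
  then have "norm (slide I c x t - c) \<le> norm (x - c)"
    by (intro norm_le_componentwise_cart)
      (auto simp: slide_def abs_mult mult_left_le_one_le)
  then show ?thesis using assms(1) by (simp add: dist_norm norm_minus_commute)
qed

lemma bounded_linear_coord_fst: "bounded_linear (\<lambda>p :: (real^4) \<times> real. fst p $ j)"
  by (rule bounded_linear_compose[OF bounded_linear_vec_nth bounded_linear_fst])

lemma smooth_on_slide:
  assumes "open W"
  shows "smooth_on W (\<lambda>p. slide I c (fst p) (snd p))"
  unfolding slide_def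
proof (rule smooth_on_vec_lambda[OF assms])
  fix i
  show "smooth_on W (\<lambda>p. if i \<in> I then c $ i + snd p * (fst p $ i - c $ i) else fst p $ i)"
    using smooth_on_linear[OF bounded_linear_coord_fst assms] smooth_on_linear[OF bounded_linear_snd assms] assms
    by (cases "i \<in> I") (auto intro!: smooth_on_add smooth_on_mult smooth_on_diff smooth_on_const)
qed

context
  fixes I :: "4 set" and c :: "real^4" and r :: real and \<eta> :: "4 \<Rightarrow> real^4 \<Rightarrow> 'b::euclidean_space"
  assumes sm: "\<And>j. smooth_on (ball c r) (\<eta> j)"
begin

text \<open>An open set around the ball times {0..1} on which the integrand is smooth, as
  differentiation under the integral requires.\<close>

definition "cone_dom = {p. slide I c (fst p) (snd p) \<in> ball c r}"
definition "cone_integrand = (\<lambda>p. \<Sum>j\<in>I. (fst p $ j - c $ j) *\<^sub>R \<eta> j (slide I c (fst p) (snd p)))"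

lemma open_cone_dom: "open cone_dom"
proof -
  have "cone_dom = (\<lambda>p. slide I c (fst p) (snd p)) -` ball c r" by (auto simp: cone_dom_def)
  then show ?thesis
    using open_vimage[OF open_ball smooth_on_continuous[OF smooth_on_slide[OF open_UNIV]]] by simp
qed

lemma cone_dom_sub: "ball c r \<times> {0..1} \<subseteq> cone_dom"
  unfolding cone_dom_def using slide_in_ball by fastforce

lemma smooth_cone_integrand: "smooth_on cone_dom cone_integrand"
  unfolding cone_integrand_def
  by (intro smooth_on_sum smooth_on_scaleR open_cone_dom smooth_on_diff smooth_on_const
      smooth_on_linear bounded_linear_coord_fst
      smooth_on_compose[OF open_cone_dom open_ball smooth_on_slide[OF open_cone_dom] sm])
    (auto simp: cone_dom_def)

lemma smooth_cone_integral: "smooth_on (ball c r) (cone_integral I c \<eta>)"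
  using smooth_on_integral_param[OF open_ball open_cone_dom cone_dom_sub smooth_cone_integrand]
  by (simp add: cone_integral_def[abs_def] cone_integrand_def)

text \<open>The homotopy formula dK + Kd = id in components. Differentiating under the integral
  gives \<eta>_i plus t times derivatives pd i of the \<eta>_j; subtracting the derivative of t
  \<eta>_i along the cone, whose integral is \<eta>_i at \<open>x\<close>, turns this into the curl.
  The curl is kept, since Picard iterates give forms that are only approximately closed.\<close>

lemma pd_cone_integral:
  assumes x: "x \<in> ball c r" and i: "i \<in> I"
  shows "((\<lambda>t. \<Sum>j\<in>I. (t * (x $ j - c $ j)) *\<^sub>R
            (pd i (\<eta> j) (slide I c x t) - pd j (\<eta> i) (slide I c x t)))
          has_integral (pd i (cone_integral I c \<eta>) x - \<eta> i x)) {0..1}"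
proof -
  let ?s = "slide I c x"
  have sl: "?s t \<in> ball c r" if "t \<in> {0..1}" for t using slide_in_ball[OF x that] .
  have diff: "\<eta> j differentiable (at (?s t))" if "t \<in> {0..1}" for j t
    using smooth_on_differentiable[OF sm sl[OF that]] .
  let ?D = "\<lambda>t. frechet_derivative cone_integrand (at (x, t)) (axis i 1, 0)"
  have D: "?D t = \<eta> i (?s t) + (\<Sum>j\<in>I. (t * (x $ j - c $ j)) *\<^sub>R pd i (\<eta> j) (?s t))"
    if t: "t \<in> {0..1}" for t
  proof -
    have 1: "(cone_integrand has_derivative frechet_derivative cone_integrand (at (x, t))) (at (x, t))"
      by (rule smooth_on_has_derivative[OF smooth_cone_integrand]) (use cone_dom_sub x t in auto)
    have "((\<lambda>s. (x + s *\<^sub>R axis i 1, t)) has_derivative (\<lambda>s. (s *\<^sub>R axis i 1, 0))) (at 0)"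
      by (auto intro!: derivative_eq_intros)
    from diff_chain_at[OF this, of cone_integrand "frechet_derivative cone_integrand (at (x, t))"] 1
    have "((\<lambda>s. cone_integrand (x + s *\<^sub>R axis i 1, t)) has_vector_derivative ?D t) (at 0)"
      using linear_cmul[OF has_derivative_linear[OF 1], of _ "(axis i 1, 0)"]
      by (simp add: comp_def has_vector_derivative_def)
    moreover have "((\<lambda>s. cone_integrand (x + s *\<^sub>R axis i 1, t)) has_vector_derivative
        (\<Sum>j\<in>I. (x $ j - c $ j) *\<^sub>R (t *\<^sub>R pd i (\<eta> j) (?s t)) + (if j = i then 1 else 0) *\<^sub>R \<eta> j (?s t))) (at 0)"
      unfolding cone_integrand_def fst_conv snd_conv
    proof (rule has_vector_derivative_sum)
      fix j assume "j \<in> I"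
      \<comment> \<open>As \<open>i\<close> is in \<open>I\<close>, moving \<open>x\<close> by s
        moves the point on the cone by t s only; this is the source of the weight t.\<close>
      have sl_eq: "slide I c (x + s *\<^sub>R axis i 1) t = ?s t + (t * s) *\<^sub>R axis i 1" for s
        using i by (auto simp: slide_def vec_eq_iff axis_def algebra_simps)
      have "((\<lambda>s. ?s t + (t * s) *\<^sub>R axis i 1) has_vector_derivative t *\<^sub>R axis i 1) (at 0)"
        by (auto intro!: derivative_eq_intros)
      from has_vector_derivative_along[OF _ this, of "\<eta> j"] diff[OF t, of j]
      have "((\<lambda>s. \<eta> j (slide I c (x + s *\<^sub>R axis i 1) t)) has_vector_derivative t *\<^sub>R pd i (\<eta> j) (?s t)) (at 0)"
        by (simp add: sl_eq axis_one_nth if_distrib[of "\<lambda>c. c *\<^sub>R _"] if_distrib[of "\<lambda>c. t * c"] cong: if_cong)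
      moreover have "((\<lambda>s. (x + s *\<^sub>R axis i 1) $ j - c $ j) has_vector_derivative (if j = i then 1 else 0)) (at 0)"
        by (auto intro!: derivative_eq_intros simp: axis_def has_real_derivative_iff_has_vector_derivative[symmetric])
      ultimately show "((\<lambda>s. ((x + s *\<^sub>R axis i 1) $ j - c $ j) *\<^sub>R \<eta> j (slide I c (x + s *\<^sub>R axis i 1) t))
        has_vector_derivative (x $ j - c $ j) *\<^sub>R (t *\<^sub>R pd i (\<eta> j) (?s t)) + (if j = i then 1 else 0) *\<^sub>R \<eta> j (?s t)) (at 0)"
        using has_vector_derivative_scaleR[of "\<lambda>s. (x + s *\<^sub>R axis i 1) $ j - c $ j"]
        by (fastforce simp: has_real_derivative_iff_has_vector_derivative)
    qed
    ultimately have "?D t = (\<Sum>j\<in>I. (x $ j - c $ j) *\<^sub>R (t *\<^sub>R pd i (\<eta> j) (?s t)) + (if j = i then 1 else 0) *\<^sub>R \<eta> j (?s t))"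
      by (rule vector_derivative_unique_at)
    then show ?thesis using i
      by (simp add: sum.distrib if_distrib[of "\<lambda>c. c *\<^sub>R _"] mult.commute cong: if_cong)
  qed
  have td: "times_differentiable_on (Suc 0) cone_integrand cone_dom"
    using smooth_cone_integrand by (auto simp: smooth_on_def simp del: times_differentiable_on.simps)
  have "pd i (cone_integral I c \<eta>) x = integral {0..1} ?D"
    using pd_eqI[OF integral_param_has_derivative[OF open_ball open_cone_dom cone_dom_sub td x], of i]
    by (simp add: cone_integral_def[abs_def] cone_integrand_def)
  moreover have "?D integrable_on {0..1}"
  proof (rule integrable_continuous_real)
    show "continuous_on {0..1} ?D"
      by (rule continuous_on_compose2[OF smooth_on_continuous[OF smooth_on_derivative[OF smooth_cone_integrand]]])
        (use cone_dom_sub x in \<open>auto intro!: continuous_intros\<close>)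
  qed
  ultimately have "(?D has_integral pd i (cone_integral I c \<eta>) x) {0..1}"
    by (simp add: has_integral_integral)
  moreover have "((\<lambda>t. \<eta> i (?s t) + t *\<^sub>R (\<Sum>j\<in>I. (x $ j - c $ j) *\<^sub>R pd j (\<eta> i) (?s t))) has_integral
      1 *\<^sub>R \<eta> i (?s 1) - 0 *\<^sub>R \<eta> i (?s 0)) {0..1}"
  proof (rule fundamental_theorem_of_calculus)
    fix t :: real assume t: "t \<in> {0..1}"
    have "(?s has_vector_derivative (\<chi> i. if i \<in> I then x $ i - c $ i else 0)) (at t within {0..1})"
    proof -
      have eq: "?s = (\<lambda>t. ?s 0 + t *\<^sub>R (\<chi> i. if i \<in> I then x $ i - c $ i else 0))"
        by (auto simp: slide_def vec_eq_iff fun_eq_iff algebra_simps)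
      show ?thesis by (subst eq) (auto intro!: derivative_eq_intros)
    qed
    from has_vector_derivative_along[OF diff[OF t, of i] this]
    have "((\<lambda>t. \<eta> i (?s t)) has_vector_derivative (\<Sum>j\<in>I. (x $ j - c $ j) *\<^sub>R pd j (\<eta> i) (?s t))) (at t within {0..1})"
      by (simp add: if_distrib[of "\<lambda>c. c *\<^sub>R _"] sum.If_cases cong: if_cong)
    then show "((\<lambda>t. t *\<^sub>R \<eta> i (?s t)) has_vector_derivative
        \<eta> i (?s t) + t *\<^sub>R (\<Sum>j\<in>I. (x $ j - c $ j) *\<^sub>R pd j (\<eta> i) (?s t))) (at t within {0..1})"
      by (auto intro!: derivative_eq_intros)
  qed auto
  then have "((\<lambda>t. \<eta> i (?s t) + t *\<^sub>R (\<Sum>j\<in>I. (x $ j - c $ j) *\<^sub>R pd j (\<eta> i) (?s t))) has_integral \<eta> i x) {0..1}"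
    by simp
  ultimately have "((\<lambda>t. ?D t - (\<eta> i (?s t) + t *\<^sub>R (\<Sum>j\<in>I. (x $ j - c $ j) *\<^sub>R pd j (\<eta> i) (?s t))))
      has_integral pd i (cone_integral I c \<eta>) x - \<eta> i x) {0..1}"
    by (rule has_integral_diff)
  then show ?thesis
    by (rule has_integral_eq[rotated])
      (simp add: D scaleR_sum_right sum_subtractf[symmetric] scaleR_diff_right)
qed

end

text \<open>For \<open>I \<noteq> UNIV\<close> the coordinates outside \<open>I\<close> are parameters.\<close>

lemma poincare_slice:
  fixes \<psi> :: "4 \<Rightarrow> real^4 \<Rightarrow> real"
  assumes "\<And>j. smooth_on (ball c r) (\<psi> j)"
    and "\<And>i j x. i \<in> I \<Longrightarrow> j \<in> I \<Longrightarrow> x \<in> ball c r \<Longrightarrow> pd i (\<psi> j) x = pd j (\<psi> i) x"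
  obtains f where "smooth_on (ball c r) f" "\<And>i x. i \<in> I \<Longrightarrow> x \<in> ball c r \<Longrightarrow> pd i f x = \<psi> i x"
proof
  show "smooth_on (ball c r) (cone_integral I c \<psi>)"
    by (rule smooth_cone_integral[OF assms(1)])
  fix i x assume i: "i \<in> I" and x: "x \<in> ball c r"
  have "((\<lambda>t::real. 0) has_integral (pd i (cone_integral I c \<psi>) x - \<psi> i x)) {0..1}"
    by (rule has_integral_eq[OF _ pd_cone_integral[OF assms(1) x i]])
      (use assms(2)[OF i] slide_in_ball[OF x] in auto)
  then show "pd i (cone_integral I c \<psi>) x = \<psi> i x"
    using has_integral_unique has_integral_0 by (metis eq_iff_diff_eq_0)
qed


section \<open>Flat linear systems and smooth local inverses\<close>

lemma bounded_bilinear_matrix_vector: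
  "bounded_bilinear ((*v) :: real^'n^'m \<Rightarrow> real^'n \<Rightarrow> real^'m)"
proof -
  have "bilinear ((*v) :: real^'n^'m \<Rightarrow> real^'n \<Rightarrow> real^'m)"
    unfolding bilinear_def
    by (auto intro!: linearI simp: matrix_vector_mult_add_rdistrib matrix_vector_right_distrib
        matrix_vector_mult_def vec_eq_iff sum_distrib_left algebra_simps sum.distrib)
  then show ?thesis by (simp add: bilinear_conv_bounded_bilinear)
qed

lemma bounded_bilinear_matrix_matrix:
  "bounded_bilinear ((**) :: real^'n^'m \<Rightarrow> real^'k^'n \<Rightarrow> real^'k^'m)"
proof -
  have "bilinear ((**) :: real^'n^'m \<Rightarrow> real^'k^'n \<Rightarrow> real^'k^'m)"
    unfolding bilinear_def
    by (auto intro!: linearI simp: vec_eq_iff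
        matrix_matrix_mult_def sum_distrib_left algebra_simps sum.distrib)
  then show ?thesis by (simp add: bilinear_conv_bounded_bilinear)
qed

lemmas smooth_on_matrix_vector = smooth_on_bilinear[OF bounded_bilinear_matrix_vector]
lemmas smooth_on_matrix_matrix = smooth_on_bilinear[OF bounded_bilinear_matrix_matrix]
lemmas pd_matrix_vector = pd_bilinear[OF bounded_bilinear_matrix_vector]
lemmas pd_matrix_matrix = pd_bilinear[OF bounded_bilinear_matrix_matrix]

lemma has_integral_cone_integral:
  assumes "\<And>j. smooth_on (ball c r) (\<eta> j)" "x \<in> ball c r"
  shows "((\<lambda>t. \<Sum>j\<in>I. (x $ j - c $ j) *\<^sub>R \<eta> j (slide I c x t)) has_integral cone_integral I c \<eta> x) {0..1}"
proof -
  have "continuous_on {0..1} (\<lambda>t. slide I c x t)"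
    using continuous_on_compose2[OF smooth_on_continuous[OF smooth_on_slide[OF open_UNIV]],
        of "{0..1}" "\<lambda>t. (x, t)" I c] by (simp add: continuous_on_Pair)
  then have "continuous_on {0..1} (\<lambda>t. \<Sum>j\<in>I. (x $ j - c $ j) *\<^sub>R \<eta> j (slide I c x t))"
    by (intro continuous_intros continuous_on_compose2[OF smooth_on_continuous[OF assms(1)]])
      (use slide_in_ball[OF assms(2)] in auto)
  then show ?thesis
    unfolding cone_integral_def by (intro integrable_integral integrable_continuous_real)
qed

lemma matrix_fields_bounded:
  fixes C :: "'i::finite \<Rightarrow> 'a::topological_space \<Rightarrow> real^'n^'m"
  assumes "compact S" "\<And>i. continuous_on S (C i)"
  obtains M where "M > 0" "\<And>i x y. x \<in> S \<Longrightarrow> norm (C i x *v y) \<le> M * norm y"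
proof -
  obtain K where K: "K > 0" "\<And>(A::real^'n^'m) y. norm (A *v y) \<le> norm A * norm y * K"
    using bounded_bilinear.pos_bounded[OF bounded_bilinear_matrix_vector] by blast
  have "\<exists>M. \<forall>x\<in>S. norm (C i x) \<le> M" for i
    using compact_imp_bounded[OF compact_continuous_image[OF assms(2,1)]] bounded_iff by (metis imageI)
  then obtain M0 where M0: "\<And>i x. x \<in> S \<Longrightarrow> norm (C i x) \<le> M0 i" by metis
  define M where "M = (\<Sum>i\<in>UNIV. \<bar>M0 i\<bar>) * K + 1"
  show ?thesis
  proof (rule that)
    show "M > 0" using K(1) by (auto simp: M_def intro!: add_nonneg_pos sum_nonneg)
    fix i x and y :: "real^'n" assume x: "x \<in> S"
    have "norm (C i x) \<le> (\<Sum>i\<in>UNIV. \<bar>M0 i\<bar>)"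
      using M0[OF x, of i] member_le_sum[of i UNIV "\<lambda>i. \<bar>M0 i\<bar>"] by auto
    then have "norm (C i x) * K \<le> M" using K(1) by (simp add: M_def mult_right_mono add_increasing2)
    then have "norm (C i x) * K * norm y \<le> M * norm y" by (simp add: mult_right_mono)
    then show "norm (C i x *v y) \<le> M * norm y" using K(2)[of "C i x" y] by (simp add: mult_ac)
  qed
qed

lemma norm_diff_le_add:
  fixes a b :: "'b::real_normed_vector"
  assumes "norm a \<le> A" "norm b \<le> B"
  shows "norm (a - b) \<le> A + B"
  using norm_triangle_ineq4[of a b] assms by linarith

lemma norm_diff_le_twice:
  fixes a b :: "'b::real_normed_vector"
  assumes "norm a \<le> M * K" "norm b \<le> M * K"
  shows "norm (a - b) \<le> 2 * M * K"
  using norm_diff_le_add[OF assms] by linarith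

text \<open>The bound on the error is the tail of the geometric series, hence uniform wherever
  \<open>D\<close> is.\<close>

lemma geometric_limit:
  fixes y :: "nat \<Rightarrow> 'b::banach"
  assumes "\<And>n. norm (y (Suc n) - y n) \<le> D * (1/2)^n"
  shows "\<exists>l. \<forall>n. norm (y n - l) \<le> 2 * D * (1/2)^n"
proof -
  define d where "d n = y (Suc n) - y n" for n
  have sg: "summable (\<lambda>n. D * (1/2)^(n + k) :: real)" for k
    unfolding power_add by (intro summable_mult summable_mult2 summable_geometric) simp
  have sd: "summable d"
    by (rule summable_comparison_test'[OF sg[of 0], of 0]) (use assms in \<open>auto simp: d_def\<close>)
  have tele: "(\<Sum>k<n. d k) = y n - y 0" for n
    unfolding d_def by (rule sum_lessThan_telescope)
  have "norm (y n - (y 0 + suminf d)) \<le> 2 * D * (1/2)^n" for n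
  proof -
    have "y 0 + suminf d - y n = (\<Sum>k. d (k + n))"
      using suminf_minus_initial_segment[OF sd, of n] tele[of n] by simp
    moreover have "norm (\<Sum>k. d (k + n)) \<le> (\<Sum>k. D * (1/2)^(k + n))"
      by (rule norm_suminf_le[OF _ sg]) (use assms in \<open>auto simp: d_def\<close>)
    moreover have "(\<Sum>k. D * (1/2)^(k + n)) = 2 * D * (1/2)^n"
    proof -
      have "(\<lambda>k. (D * (1/2)^n) * (1/2)^k) sums ((D * (1/2)^n) * (1 / (1 - 1/2)))"
        by (intro sums_mult geometric_sums) simp
      then show ?thesis by (simp add: sums_iff power_add mult_ac)
    qed
    ultimately show ?thesis by (metis norm_minus_commute)
  qed
  then show ?thesis by blast
qed

text \<open>Picard iteration. Under the integrability condition the error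
  \<open>\<partial>\<^sub>i Y\<^sub>n - C\<^sub>i Y\<^sub>n\<close> of the \<open>n\<close>-th iterate is itself contracted, so it tends to \<open>0\<close>
  together with \<open>Y\<^sub>n\<^sub>+\<^sub>1 - Y\<^sub>n\<close>.\<close>

lemma flat_linear_system:
  fixes C :: "4 \<Rightarrow> real^4 \<Rightarrow> real^'n^'n"
  assumes R: "0 < R" and smC: "\<And>i. smooth_on (ball c R) (C i)"
    and flat: "\<And>x i j. x \<in> ball c R \<Longrightarrow> pd i (C j) x + C j x ** C i x = pd j (C i) x + C i x ** C j x"
  obtains r where "0 < r" "r \<le> R"
    "\<And>y0. \<exists>Y. smooth_on (ball c r) Y \<and> Y c = y0 \<and> (\<forall>x\<in>ball c r. \<forall>i. pd i Y x = C i x *v Y x)"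
proof -
  have "continuous_on (cball c (R/2)) (C i)" for i
    by (rule continuous_on_subset[OF smooth_on_continuous[OF smC]]) (use R in auto)
  then obtain M where M: "M > 0" and CM: "\<And>i x y. x \<in> cball c (R/2) \<Longrightarrow> norm (C i x *v y) \<le> M * norm y"
    by (rule matrix_fields_bounded[of "cball c (R/2)" C, OF compact_cball]) blast
  \<comment> \<open>The bound R/2 keeps to the compact ball on which \<open>M\<close> was found. The
    error estimate below picks up the factor 8 M r, from four coordinates of size at most r and two
    terms bounded through M; 16 in the denominator makes it at most 1/2.\<close>
  define r where "r = min (R/2) (1 / (16 * M))"
  have r: "0 < r" "r \<le> R" "r \<le> R/2" using R M by (auto simp: r_def)
  have rM: "16 * (M * r) \<le> 1"
  proof -
    have "r \<le> 1 / (16 * M)" by (simp add: r_def)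
    then show ?thesis using M by (simp add: field_simps)
  qed
  have sub: "ball c r \<subseteq> ball c R" "ball c r \<subseteq> cball c (R/2)" using r by auto
  have coord: "\<bar>x $ j - c $ j\<bar> \<le> r" if "x \<in> ball c r" for x j
  proof -
    have "\<bar>(x - c) $ j\<bar> \<le> norm (x - c)" by (rule component_le_norm_cart)
    then show ?thesis using that by (simp add: dist_norm norm_minus_commute)
  qed
  have CMr: "norm (C i x *v y) \<le> M * norm y" if "x \<in> ball c r" for i x y
    by (rule CM[OF subsetD[OF sub(2) that]])
  have smC': "smooth_on (ball c r) (C i)" for i by (rule smooth_on_subset[OF smC sub(1)])
  \<comment> \<open>The radius is fixed before the initial value: the four members of a parallel
    coframe will have to share one ball.\<close>
  have "\<exists>Y. smooth_on (ball c r) Y \<and> Y c = y0 \<and> (\<forall>x\<in>ball c r. \<forall>i. pd i Y x = C i x *v Y x)" for y0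
  proof -
    define Y where "Y = rec_nat (\<lambda>x. y0) (\<lambda>_ f x. y0 + cone_integral UNIV c (\<lambda>j x. C j x *v f x) x)"
    define \<eta> where "\<eta> n j x = C j x *v Y n x" for n j x
    have Y0: "Y 0 = (\<lambda>x. y0)" by (simp add: Y_def)
    have YS: "Y (Suc n) = (\<lambda>x. y0 + cone_integral UNIV c (\<eta> n) x)" for n
      by (simp add: Y_def \<eta>_def[abs_def])
    have smY: "smooth_on (ball c r) (Y n)" for n
    proof (induction n)
      case (Suc n)
      then show ?case unfolding YS \<eta>_def
        by (intro smooth_on_add smooth_on_const smooth_cone_integral smooth_on_matrix_vector smC') auto
    qed (simp add: Y0 smooth_on_const)
    have sm\<eta>: "smooth_on (ball c r) (\<eta> n j)" for n j
      unfolding \<eta>_def by (intro smooth_on_matrix_vector smC' smY) auto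
    define D where "D = norm y0"
    have D: "D \<ge> 0" by (simp add: D_def)
    have cone_bound: "norm i \<le> 4 * r * B"
      if "((\<lambda>t. \<Sum>j\<in>UNIV. (x $ j - c $ j) *\<^sub>R h j t) has_integral i) {0..1}" "x \<in> ball c r" "0 \<le> B"
        "\<And>j t. t \<in> {0..1} \<Longrightarrow> norm (h j t) \<le> B" for i x B and h :: "4 \<Rightarrow> real \<Rightarrow> real^'n"
    proof -
      have "norm i \<le> (4 * r * B) * measure lborel {0..1::real}"
      proof (rule has_integral_bound_real[OF _ finite.emptyI that(1)])
        fix t :: real assume "t \<in> {0..1} - {}"
        then have "norm ((x $ j - c $ j) *\<^sub>R h j t) \<le> r * B" for j
          using that(4) coord[OF that(2)] r(1) by (auto intro!: mult_mono)
        then have "norm (\<Sum>j\<in>UNIV. (x $ j - c $ j) *\<^sub>R h j t) \<le> of_nat (card (UNIV :: 4 set)) * (r * B)"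
          by (intro sum_norm_bound) auto
        then show "norm (\<Sum>j\<in>UNIV. (x $ j - c $ j) *\<^sub>R h j t) \<le> 4 * r * B" by simp
      qed (use that r in auto)
      then show ?thesis by simp
    qed
    have \<Delta>: "norm (Y (Suc n) x - Y n x) \<le> D * (1/2)^n" if "x \<in> ball c r" for n x
      using that
    proof (induction n arbitrary: x)
      case 0
      have "norm (cone_integral UNIV c (\<eta> 0) x) \<le> 4 * r * (M * D)"
      proof (rule cone_bound[OF has_integral_cone_integral[OF sm\<eta> 0] 0])
        show "norm (\<eta> 0 j (slide UNIV c x t)) \<le> M * D" if "t \<in> {0..1}" for j t
          unfolding \<eta>_def Y0 D_def by (rule CMr[OF slide_in_ball[OF 0 that]])
      qed (use M D in auto)
      also have "\<dots> = (4 * (M * r)) * D" by simp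
      also have "\<dots> \<le> 1 * D" using rM D by (intro mult_right_mono) auto
      finally show ?case by (simp add: YS Y0)
    next
      case (Suc n)
      have "((\<lambda>t. \<Sum>j\<in>UNIV. (x $ j - c $ j) *\<^sub>R (\<eta> (Suc n) j (slide UNIV c x t) - \<eta> n j (slide UNIV c x t)))
        has_integral (cone_integral UNIV c (\<eta> (Suc n)) x - cone_integral UNIV c (\<eta> n) x)) {0..1}"
        using has_integral_diff[OF has_integral_cone_integral[OF sm\<eta> Suc.prems] has_integral_cone_integral[OF sm\<eta> Suc.prems]]
        by (simp add: sum_subtractf scaleR_diff_right)
      then have "norm (cone_integral UNIV c (\<eta> (Suc n)) x - cone_integral UNIV c (\<eta> n) x)
          \<le> 4 * r * (M * (D * (1/2)^n))"
      proof (rule cone_bound[OF _ Suc.prems])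
        fix j and t :: real assume "t \<in> {0..1}"
        then have s: "slide UNIV c x t \<in> ball c r" using slide_in_ball Suc.prems by blast
        have "norm (C j (slide UNIV c x t) *v (Y (Suc n) (slide UNIV c x t) - Y n (slide UNIV c x t)))
           \<le> M * norm (Y (Suc n) (slide UNIV c x t) - Y n (slide UNIV c x t))"
          by (rule CMr[OF s])
        also have "\<dots> \<le> M * (D * (1/2)^n)" using Suc.IH[OF s] M by (intro mult_left_mono) auto
        finally show "norm (\<eta> (Suc n) j (slide UNIV c x t) - \<eta> n j (slide UNIV c x t)) \<le> M * (D * (1/2)^n)"
          by (simp add: \<eta>_def matrix_vector_mult_diff_distrib)
      qed (use M D in auto)
      also have "\<dots> = (4 * (M * r)) * (D * (1/2)^n)" by simp
      also have "\<dots> \<le> (1/2) * (D * (1/2)^n)" using rM D by (intro mult_right_mono) auto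
      finally show ?case by (simp add: YS)
    qed
    define E where "E n i x = pd i (Y n) x - C i x *v Y n x" for n i x
    \<comment> \<open>With this \<open>K\<close> the increment of the iterates contributes at most a
      quarter of the bound. The curl contributes at most one half, and 1/2 + 1/4 is the ratio 3/4 of
      the induction.\<close>
    define K where "K = 4 * (M * D)"
    have K: "K \<ge> 0" using M D by (simp add: K_def)
    have EK: "norm (E n i x) \<le> K * (3/4)^n" if "x \<in> ball c r" for n i x
      using that
    proof (induction n arbitrary: i x)
      case 0
      have "norm (C i x *v y0) \<le> M * D" unfolding D_def by (rule CMr[OF 0])
      also have "\<dots> \<le> K" using M D by (simp add: K_def)
      finally show ?case by (simp add: E_def Y0)
    next
      case (Suc n)
      \<comment> \<open>By the integrability condition the terms containing the iterate itself
        cancel, so the curl is linear in the errors.\<close>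
      have \<eta>E: "pd i (\<eta> n j) z - pd j (\<eta> n i) z = C j z *v E n i z - C i z *v E n j z"
        if z: "z \<in> ball c r" for z j
      proof -
        have p: "pd i (\<eta> n j) z = C j z *v pd i (Y n) z + pd i (C j) z *v Y n z" for i j
          unfolding \<eta>_def using smooth_on_differentiable[OF smC' z] smooth_on_differentiable[OF smY z]
          by (intro pd_matrix_vector)
        have z': "z \<in> ball c R" using z sub by auto
        have "(pd i (C j) z + C j z ** C i z) *v Y n z = (pd j (C i) z + C i z ** C j z) *v Y n z"
          by (simp only: flat[OF z', of i j])
        then show ?thesis
          by (simp add: p E_def matrix_vector_mult_diff_distrib matrix_vector_mult_add_rdistrib
              matrix_vector_mul_assoc algebra_simps)
      qed
      have "((\<lambda>t. \<Sum>j\<in>UNIV. (x $ j - c $ j) *\<^sub>R (t *\<^sub>R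
            (pd i (\<eta> n j) (slide UNIV c x t) - pd j (\<eta> n i) (slide UNIV c x t))))
          has_integral (pd i (cone_integral UNIV c (\<eta> n)) x - \<eta> n i x)) {0..1}"
        using pd_cone_integral[where \<eta> = "\<eta> n" and i = i, OF sm\<eta> Suc.prems UNIV_I] by (simp add: mult.commute)
      then have "norm (pd i (cone_integral UNIV c (\<eta> n)) x - \<eta> n i x) \<le> 4 * r * (2 * M * (K * (3/4)^n))"
      proof (rule cone_bound[OF _ Suc.prems])
        fix j and t :: real assume t: "t \<in> {0..1}"
        let ?z = "slide UNIV c x t"
        have z: "?z \<in> ball c r" using slide_in_ball Suc.prems t by blast
        have CE: "norm (C j ?z *v E n i ?z) \<le> M * (K * (3/4)^n)" for i j
        proof -
          have "norm (C j ?z *v E n i ?z) \<le> M * norm (E n i ?z)" by (rule CMr[OF z])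
          also have "\<dots> \<le> M * (K * (3/4)^n)" using Suc.IH[OF z] M by (intro mult_left_mono) auto
          finally show ?thesis .
        qed
        have "norm (t *\<^sub>R (pd i (\<eta> n j) ?z - pd j (\<eta> n i) ?z)) \<le> norm (pd i (\<eta> n j) ?z - pd j (\<eta> n i) ?z)"
          using t by (simp add: mult_left_le_one_le)
        also have "\<dots> \<le> 2 * M * (K * (3/4)^n)"
          unfolding \<eta>E[OF z] by (rule norm_diff_le_twice[OF CE CE])
        finally show "norm (t *\<^sub>R (pd i (\<eta> n j) ?z - pd j (\<eta> n i) ?z)) \<le> 2 * M * (K * (3/4)^n)" .
      qed (use M K in auto)
      also have "\<dots> = (8 * (M * r)) * (K * (3/4)^n)" by simp
      also have "\<dots> \<le> (1/2) * (K * (3/4)^n)" using rM K by (intro mult_right_mono) auto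
      finally have 1: "norm (pd i (cone_integral UNIV c (\<eta> n)) x - \<eta> n i x) \<le> (1/2) * (K * (3/4)^n)" .
      have "norm (C i x *v (Y (Suc n) x - Y n x)) \<le> M * norm (Y (Suc n) x - Y n x)"
        by (rule CMr[OF Suc.prems])
      also have "\<dots> \<le> M * (D * (1/2)^n)" using \<Delta>[OF Suc.prems] M by (intro mult_left_mono) auto
      also have "\<dots> \<le> M * (D * (3/4)^n)" using M D by (intro mult_left_mono power_mono) auto
      finally have 2: "norm (C i x *v (Y (Suc n) x - Y n x)) \<le> (1/4) * (K * (3/4)^n)" by (simp add: K_def)
      have "pd i (Y (Suc n)) x = pd i (cone_integral UNIV c (\<eta> n)) x"
        unfolding YS using smooth_on_differentiable[OF smooth_cone_integral[OF sm\<eta>] Suc.prems]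
        by (subst pd_add) auto
      then have "E (Suc n) i x = (pd i (cone_integral UNIV c (\<eta> n)) x - \<eta> n i x) - C i x *v (Y (Suc n) x - Y n x)"
        by (simp add: E_def \<eta>_def matrix_vector_mult_diff_distrib)
      then have "norm (E (Suc n) i x) \<le> (1/2) * (K * (3/4)^n) + (1/4) * (K * (3/4)^n)"
        by (simp only: norm_diff_le_add[OF 1 2])
      then show ?case by simp
    qed
    have "\<exists>l. \<forall>n. norm (Y n x - l) \<le> 2 * D * (1/2)^n" if "x \<in> ball c r" for x
      by (rule geometric_limit[OF \<Delta>[OF that]])
    then obtain Z where Z: "\<And>x n. x \<in> ball c r \<Longrightarrow> norm (Y n x - Z x) \<le> 2 * D * (1/2)^n" by metis
    have YZ: "(\<lambda>n. Y n x) \<longlonglongrightarrow> Z x" if "x \<in> ball c r" for x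
    proof (rule LIM_zero_cancel, rule Lim_null_comparison[of _ "\<lambda>n. 2 * D * (1/2)^n"])
      show "(\<lambda>n. 2 * D * (1/2)^n) \<longlonglongrightarrow> 0"
        by (intro tendsto_mult_right_zero LIMSEQ_power_zero) simp
    qed (use Z[OF that] in auto)
    define L where "L = 4 * (K + 2 * (M * D))"
    have L: "L \<ge> 0" using K M D by (simp add: L_def)
    \<comment> \<open>Limit and derivative may be interchanged because the derivatives converge
      uniformly: their distance from C i Z is the error E plus C i applied to Y n - Z, and both
      decay geometrically.\<close>
    have "\<exists>g. \<forall>x\<in>ball c r. (\<lambda>n. Y n x) \<longlonglongrightarrow> g x \<and>
        (g has_derivative (\<lambda>h. \<Sum>i\<in>UNIV. h $ i *\<^sub>R (C i x *v Z x))) (at x within ball c r)"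
    proof (rule has_derivative_sequence[where f = Y
          and f' = "\<lambda>n x h. \<Sum>i\<in>UNIV. h $ i *\<^sub>R pd i (Y n) x"
          and g' = "\<lambda>x h. \<Sum>i\<in>UNIV. h $ i *\<^sub>R (C i x *v Z x)"])
      show "(Y n has_derivative (\<lambda>h. \<Sum>i\<in>UNIV. h $ i *\<^sub>R pd i (Y n) x)) (at x within ball c r)"
        if "x \<in> ball c r" for n x
        by (rule has_derivative_at_withinI[OF has_derivative_pd[OF smooth_on_differentiable[OF smY that]]])
      show "(\<lambda>n. Y n c) \<longlonglongrightarrow> Z c" using YZ r by simp
      have bound: "norm ((\<Sum>i\<in>UNIV. h $ i *\<^sub>R pd i (Y n) x) - (\<Sum>i\<in>UNIV. h $ i *\<^sub>R (C i x *v Z x)))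
          \<le> (L * (3/4)^n) * norm h" if x: "x \<in> ball c r" for n x h
      proof -
        have "norm (pd i (Y n) x - C i x *v Z x) \<le> (K + 2 * (M * D)) * (3/4)^n" for i
        proof -
          have "norm (C i x *v (Y n x - Z x)) \<le> M * norm (Y n x - Z x)"
            by (rule CMr[OF x])
          also have "\<dots> \<le> M * (2 * D * (1/2)^n)" using Z[OF x] M by (intro mult_left_mono) auto
          also have "\<dots> \<le> M * (2 * D * (3/4)^n)" using M D by (intro mult_left_mono power_mono) auto
          finally have "norm (C i x *v (Y n x - Z x)) \<le> 2 * (M * D) * (3/4)^n" by simp
          moreover have "pd i (Y n) x - C i x *v Z x = E n i x + C i x *v (Y n x - Z x)"
            by (simp add: E_def matrix_vector_mult_diff_distrib)
          ultimately show ?thesis using EK[OF x, of n i] norm_triangle_ineq[of "E n i x" "C i x *v (Y n x - Z x)"]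
            by (simp add: distrib_right)
        qed
        then have "norm (h $ i *\<^sub>R (pd i (Y n) x - C i x *v Z x)) \<le> norm h * ((K + 2 * (M * D)) * (3/4)^n)" for i
          using component_le_norm_cart[of h i] by (auto intro!: mult_mono)
        then have "norm (\<Sum>i\<in>UNIV. h $ i *\<^sub>R (pd i (Y n) x - C i x *v Z x))
            \<le> of_nat (card (UNIV :: 4 set)) * (norm h * ((K + 2 * (M * D)) * (3/4)^n))"
          by (intro sum_norm_bound) auto
        then show ?thesis by (simp add: L_def sum_subtractf scaleR_diff_right algebra_simps)
      qed
      fix e :: real assume e: "e > 0"
      have "(\<lambda>n. L * (3/4)^n) \<longlonglongrightarrow> 0"
        by (intro tendsto_mult_right_zero LIMSEQ_power_zero) simp
      then have "\<forall>\<^sub>F n in sequentially. L * (3/4)^n < e" using e by (rule order_tendstoD)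
      then show "\<forall>\<^sub>F n in sequentially. \<forall>x\<in>ball c r. \<forall>h. norm ((\<Sum>i\<in>UNIV. h $ i *\<^sub>R pd i (Y n) x)
          - (\<Sum>i\<in>UNIV. h $ i *\<^sub>R (C i x *v Z x))) \<le> e * norm h"
      proof (eventually_elim, intro ballI allI)
        fix n and x h :: "real^4" assume n: "L * (3/4)^n < e" and x: "x \<in> ball c r"
        have "(L * (3/4)^n) * norm h \<le> e * norm h" using n by (intro mult_right_mono) auto
        then show "norm ((\<Sum>i\<in>UNIV. h $ i *\<^sub>R pd i (Y n) x)
          - (\<Sum>i\<in>UNIV. h $ i *\<^sub>R (C i x *v Z x))) \<le> e * norm h"
          using bound[OF x, of h n] by linarith
      qed
    qed (use r in auto)
    then obtain g where g: "\<And>x. x \<in> ball c r \<Longrightarrow> (\<lambda>n. Y n x) \<longlonglongrightarrow> g x"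
      "\<And>x. x \<in> ball c r \<Longrightarrow> (g has_derivative (\<lambda>h. \<Sum>i\<in>UNIV. h $ i *\<^sub>R (C i x *v Z x))) (at x within ball c r)"
      by blast
    have gZ: "g x = Z x" if "x \<in> ball c r" for x
      using LIMSEQ_unique g(1) YZ that by blast
    have gd: "(g has_derivative (\<lambda>h. \<Sum>i\<in>UNIV. h $ i *\<^sub>R (C i x *v g x))) (at x)" if "x \<in> ball c r" for x
      using g(2)[OF that] gZ[OF that] at_within_open[OF that open_ball] by simp
    \<comment> \<open>The differential equation expresses the derivative of \<open>g\<close> through
      \<open>g\<close> and smooth coefficients.\<close>
    have "times_differentiable_on k g (ball c r)" for k
    proof (induction k)
      case 0
      then show ?case
        using has_derivative_continuous[OF gd] by (auto intro!: continuous_at_imp_continuous_on)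
    next
      case (Suc k)
      have "times_differentiable_on k (C i) (ball c r)" for i
        using smC' by (simp add: smooth_on_def)
      with Suc show ?case
        by (intro times_differentiable_on_SucI[OF open_ball gd] times_differentiable_on_sum
            times_differentiable_on_bilinear[OF bounded_bilinear_scaleR]
            times_differentiable_on_bilinear[OF bounded_bilinear_matrix_vector]
            times_differentiable_on_const open_ball)
    qed
    moreover have "g c = y0"
    proof -
      have "Y n c = y0" for n by (cases n) (simp_all add: Y0 YS cone_integral_def)
      then show ?thesis using g(1)[of c] r LIMSEQ_unique[of "\<lambda>n. y0"] by auto
    qed
    moreover have "pd i g x = C i x *v g x" if "x \<in> ball c r" for x i
      using pd_eqI[OF gd[OF that], of i] by (simp add: axis_one_nth if_distrib[of "\<lambda>c. c *\<^sub>R _"] cong: if_cong)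
    ultimately show ?thesis unfolding smooth_on_def by blast
  qed
  then show ?thesis using that r by blast
qed

section \<open>Inverse matrices and inverse maps\<close>

lemma matrix_inv_right: "invertible A \<Longrightarrow> A ** matrix_inv (A :: real^'n^'n) = mat 1"
  and matrix_inv_left: "invertible A \<Longrightarrow> matrix_inv A ** A = mat 1"
proof -
  assume "invertible A"
  then have "A ** matrix_inv A = mat 1 \<and> matrix_inv A ** A = mat 1"
    unfolding invertible_def matrix_inv_def by (rule someI_ex)
  then show "A ** matrix_inv A = mat 1" "matrix_inv A ** A = mat 1" by auto
qed

lemma matrix_inv_eqI:
  fixes A :: "real^'n^'n"
  assumes "A ** B = mat 1"
  shows "matrix_inv A = B"
proof -
  have "invertible A" using assms invertible_right_inverse by blast
  then have "B = matrix_inv A ** (A ** B)"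
    by (simp add: matrix_mul_assoc matrix_inv_left)
  then show ?thesis using assms by simp
qed

lemma smooth_on_det:
  fixes A :: "'a::real_normed_vector \<Rightarrow> real^'n^'n"
  assumes "open S" "\<And>i j. smooth_on S (\<lambda>x. A x $ i $ j)"
  shows "smooth_on S (\<lambda>x. det (A x))"
  unfolding det_def by (intro smooth_on_sum smooth_on_mult smooth_on_prod smooth_on_const assms)

text \<open>By Cramer's rule every entry of the inverse is a quotient of determinants, which are
  polynomials in the entries.\<close>

lemma smooth_on_matrix_inv:
  fixes A :: "'a::real_normed_vector \<Rightarrow> real^'n^'n"
  assumes S: "open S" and A: "smooth_on S A" and inv: "\<And>x. x \<in> S \<Longrightarrow> invertible (A x)"
  shows "smooth_on S (\<lambda>x. matrix_inv (A x))"
proof -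
  have Aij: "smooth_on S (\<lambda>x. A x $ i $ j)" for i j
    by (intro smooth_on_vec_nth S A)
  have d: "det (A x) \<noteq> 0" if "x \<in> S" for x
    using inv[OF that] by (simp add: invertible_det_nz)
  have eq: "matrix_inv (A x) = (\<chi> k l. det (\<chi> i j. if j = k then axis l 1 $ i else A x $ i $ j) / det (A x))"
    if "x \<in> S" for x
  proof -
    have "A x *v (matrix_inv (A x) *v axis l 1) = axis l 1" for l
      by (simp add: matrix_vector_mul_assoc matrix_inv_right[OF inv[OF that]])
    then have "matrix_inv (A x) *v axis l 1 =
        (\<chi> k. det (\<chi> i j. if j = k then axis l 1 $ i else A x $ i $ j) / det (A x))" for l
      using cramer[OF d[OF that]] by blast
    then have "(matrix_inv (A x) *v axis l 1) $ k =
        det (\<chi> i j. if j = k then axis l 1 $ i else A x $ i $ j) / det (A x)" for l k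
      by simp
    then show ?thesis
      by (simp add: vec_eq_iff matrix_vector_mul_component inner_axis)
  qed
  have "smooth_on S (\<lambda>x. \<chi> k l. det (\<chi> i j. if j = k then axis l 1 $ i else A x $ i $ j) / det (A x))"
  proof (intro smooth_on_vec_lambda smooth_on_divide smooth_on_det S d)
    fix k l i j :: 'n
    show "smooth_on S (\<lambda>x. (\<chi> i j. if j = k then axis l 1 $ i else A x $ i $ j) $ i $ j)"
      using Aij by (cases "j = k") (auto intro: smooth_on_const S)
  qed (auto intro: Aij)
  then show ?thesis using smooth_on_cong[OF S eq] by simp
qed

definition jacobian_matrix :: "(real^4 \<Rightarrow> real^4) \<Rightarrow> real^4 \<Rightarrow> real^4^4" where
  "jacobian_matrix f x = (\<chi> i j. pd j (\<lambda>z. f z $ i) x)"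

lemma frechet_eq_jacobian_matrix:
  assumes "f differentiable (at x)"
  shows "frechet_derivative f (at x) v = jacobian_matrix f x *v v"
  unfolding frechet_eq_sum_pd[OF assms] jacobian_matrix_def
  by (simp add: vec_eq_iff matrix_vector_mult_def pd_linear[OF bounded_linear_vec_nth assms] mult.commute)

lemma smooth_on_jacobian_matrix:
  assumes "open S" "smooth_on S f"
  shows "smooth_on S (jacobian_matrix f)"
  unfolding jacobian_matrix_def[abs_def]
  by (intro smooth_on_vec_lambda smooth_on_pd smooth_on_vec_nth assms)

text \<open>The inverse function theorem gives one derivative of \<open>g\<close>, namely the
  inverse Jacobian evaluated at \<open>g\<close>. This formula raises the order of differentiability
  step by step.\<close>

lemma smooth_local_inverse:
  fixes \<Phi> :: "real^4 \<Rightarrow> real^4"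
  assumes U: "open U" "x0 \<in> U" and sm: "smooth_on U \<Phi>" and inv: "invertible (jacobian_matrix \<Phi> x0)"
  obtains U' V g where "open U'" "U' \<subseteq> U" "x0 \<in> U'" "open V" "homeomorphism U' V \<Phi> g"
    "smooth_on V g" "\<And>x. x \<in> U' \<Longrightarrow> invertible (jacobian_matrix \<Phi> x)"
proof -
  define f' where "f' x = Blinfun ((*v) (jacobian_matrix \<Phi> x))" for x
  have f': "blinfun_apply (f' x) = (*v) (jacobian_matrix \<Phi> x)" for x
    unfolding f'_def using bounded_linear_Blinfun_apply[OF matrix_vector_mul_bounded_linear] .
  have der: "(\<Phi> has_derivative blinfun_apply (f' x)) (at x)" if "x \<in> U" for x
  proof -
    have "frechet_derivative \<Phi> (at x) = blinfun_apply (f' x)"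
      using frechet_eq_jacobian_matrix[OF smooth_on_differentiable[OF sm that]] by (auto simp: f')
    then show ?thesis using smooth_on_has_derivative[OF sm that] by simp
  qed
  have "continuous_on U (\<lambda>x. jacobian_matrix \<Phi> x *v v)" for v
    by (intro smooth_on_continuous smooth_on_matrix_vector smooth_on_jacobian_matrix smooth_on_const U sm)
  then have cont: "continuous_on U f'"
    by (intro continuous_on_blinfun_componentwise) (simp add: f')
  define invf where "invf = Blinfun ((*v) (matrix_inv (jacobian_matrix \<Phi> x0)))"
  have "blinfun_apply invf = (*v) (matrix_inv (jacobian_matrix \<Phi> x0))"
    unfolding invf_def using bounded_linear_Blinfun_apply[OF matrix_vector_mul_bounded_linear] .
  then have "invf o\<^sub>L f' x0 = id_blinfun"
    by (intro blinfun_eqI) (simp add: f' matrix_vector_mul_assoc matrix_inv_left[OF inv])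
  then obtain U' V g g' where *: "open U'" "U' \<subseteq> U" "x0 \<in> U'" "open V" "\<Phi> x0 \<in> V" "homeomorphism U' V \<Phi> g"
    "\<And>y. y \<in> V \<Longrightarrow> (g has_derivative (g' y)) (at y)"
    "\<And>y. y \<in> V \<Longrightarrow> g' y = inv (blinfun_apply (f' (g y)))"
    "\<And>y. y \<in> V \<Longrightarrow> bij (blinfun_apply (f' (g y)))"
    using inverse_function_theorem[OF U(1) der cont U(2)] by blast
  have gV: "g y \<in> U'" if "y \<in> V" for y
    using *(6) that by (auto simp: homeomorphism_def)
  have invJ': "invertible (jacobian_matrix \<Phi> (g y))" if "y \<in> V" for y
    using *(9)[OF that] by (simp add: f' invertible_eq_bij)
  have invJ: "invertible (jacobian_matrix \<Phi> x)" if "x \<in> U'" for x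
    using invJ'[of "\<Phi> x"] *(6) that by (auto simp: homeomorphism_def)
  have g': "g' y = (*v) (matrix_inv (jacobian_matrix \<Phi> (g y)))" if "y \<in> V" for y
    unfolding *(8)[OF that] f'
  proof (rule inv_unique_comp)
    show "(*v) (jacobian_matrix \<Phi> (g y)) \<circ> (*v) (matrix_inv (jacobian_matrix \<Phi> (g y))) = id"
      "(*v) (matrix_inv (jacobian_matrix \<Phi> (g y))) \<circ> (*v) (jacobian_matrix \<Phi> (g y)) = id"
      by (auto simp: fun_eq_iff matrix_vector_mul_assoc matrix_inv_left matrix_inv_right invJ'[OF that])
  qed
  have smi: "smooth_on U' (\<lambda>x. matrix_inv (jacobian_matrix \<Phi> x))"
    by (intro smooth_on_matrix_inv *(1) smooth_on_jacobian_matrix smooth_on_subset[OF sm *(2)] invJ)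
  have "times_differentiable_on k g V" for k
  proof (induction k)
    case 0
    then show ?case using *(6) by (simp add: homeomorphism_def)
  next
    case (Suc k)
    show ?case
    proof (rule times_differentiable_on_SucI[OF *(4) *(7)])
      fix v
      have "times_differentiable_on k (\<lambda>y. matrix_inv (jacobian_matrix \<Phi> (g y))) V"
        by (rule times_differentiable_on_compose[OF *(4,1) Suc])
          (use smi gV in \<open>auto simp: smooth_on_def\<close>)
      then have "times_differentiable_on k (\<lambda>y. matrix_inv (jacobian_matrix \<Phi> (g y)) *v v) V"
        by (intro times_differentiable_on_bilinear[OF bounded_bilinear_matrix_vector]
            times_differentiable_on_const *(4))
      then show "times_differentiable_on k (\<lambda>y. g' y v) V"
        by (subst times_differentiable_on_cong[OF *(4)]) (auto simp: g')
    qed auto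
  qed
  then have "smooth_on V g" by (simp add: smooth_on_def)
  then show ?thesis using that * invJ by blast
qed


section \<open>Linear algebra of Lorentzian forms\<close>

lemma inner_matrix_vector_transpose:
  fixes A :: "real^'n^'m"
  shows "(A *v x) \<bullet> y = x \<bullet> (transpose A *v y)"
  by (metis dot_lmul_matrix inner_commute transpose_matrix_vector transpose_transpose)

lemma vector_4_nth [simp]:
  "(vector [a, b, c, d] :: 'a::zero^4) $ 1 = a" "(vector [a, b, c, d] :: 'a^4) $ 2 = b"
  "(vector [a, b, c, d] :: 'a^4) $ 3 = c" "(vector [a, b, c, d] :: 'a^4) $ 4 = d"
  by (simp_all add: vector_def)

text \<open>Gram matrix of a coframe whose last two members are orthonormal and orthogonal to the
  first two. With b as first member, p is the squared length of b, so one shape covers the null and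
  the non-null case.\<close>

definition block_gram :: "real \<Rightarrow> real \<Rightarrow> real \<Rightarrow> real^4^4" where
  "block_gram p q s = vector [vector [p, q, 0, 0], vector [q, s, 0, 0],
                              vector [0, 0, 1, 0], vector [0, 0, 0, 1]]"

lemma pp_wave_matrix_eq: "pp_wave_matrix f = block_gram f (-1) 0"
  by (simp add: pp_wave_matrix_def block_gram_def)

lemma minkowski_eq: "minkowski = block_gram (-1) 0 1"
  by (simp add: minkowski_def block_gram_def)

lemma block_gram_inverse:
  assumes "p * s - q\<^sup>2 \<noteq> 0"
  shows "block_gram p q s ** block_gram (s / (p * s - q\<^sup>2)) (- q / (p * s - q\<^sup>2)) (p / (p * s - q\<^sup>2)) = mat 1"
  using assms
  by (simp add: matrix_matrix_mult_def vec_eq_iff forall_4 sum_4 block_gram_def mat_def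
      diff_divide_distrib[symmetric] power2_eq_square)

lemma block_gram_pp_square: "block_gram 0 (-1) 0 ** block_gram 0 (-1) 0 = mat 1"
  using block_gram_inverse[of 0 0 "-1"] by simp

lemma minkowski_square: "minkowski ** minkowski = mat 1"
  using block_gram_inverse[of "-1" 1 0] by (simp add: minkowski_eq)

lemma orthonormal_complement_3:
  fixes x y z :: real
  assumes "x \<noteq> 0 \<or> y \<noteq> 0 \<or> z \<noteq> 0"
  obtains u1 u2 u3 v1 v2 v3 where "u1 * x + u2 * y + u3 * z = 0" "v1 * x + v2 * y + v3 * z = 0"
    "u1 * u1 + u2 * u2 + u3 * u3 = 1" "v1 * v1 + v2 * v2 + v3 * v3 = (1::real)" "u1 * v1 + u2 * v2 + u3 * v3 = 0"
proof (cases "x = 0 \<and> y = 0")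
  case True
  then show ?thesis using that[of 1 0 0 0 1 0] by simp
next
  case False
  define s t where "s = 1 / sqrt (x * x + y * y)" and "t = 1 / sqrt (x * x + y * y + z * z)"
  have pos: "x * x + y * y > 0" using False by (auto simp: sum_squares_gt_zero_iff)
  have sq: "1 / sqrt A * (1 / sqrt A) * A = 1" if "A > 0" for A :: real
    using that by simp
  from sq[OF pos] have s: "s * s * (x * x + y * y) = 1" unfolding s_def .
  have pos': "x * x + y * y + z * z > 0" by (rule add_pos_nonneg[OF pos]) simp
  from sq[OF this] have t: "t * t * (x * x + y * y + z * z) = 1" unfolding t_def .
  show ?thesis
  \<comment> \<open>The vector (y, -x, 0) and the cross product of (x, y, z) with it, both
    normalised.\<close>
  proof (rule that[of "y * s" "- x * s" 0 "x * z * s * t" "y * z * s * t" "- (x * x + y * y) * s * t"])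
    show "y * s * (y * s) + - x * s * (- x * s) + 0 * 0 = 1"
      using s by (simp add: algebra_simps)
    have "x * z * s * t * (x * z * s * t) + y * z * s * t * (y * z * s * t) +
      - (x * x + y * y) * s * t * (- (x * x + y * y) * s * t)
      = (s * s * (x * x + y * y)) * (t * t * (x * x + y * y + z * z))"
      by (simp add: algebra_simps)
    then show "x * z * s * t * (x * z * s * t) + y * z * s * t * (y * z * s * t) +
      - (x * x + y * y) * s * t * (- (x * x + y * y) * s * t) = 1"
      by (simp only: s t mult_1)
  qed (simp_all add: algebra_simps)
qed

definition lorentz_product :: "real^4 \<Rightarrow> real^4 \<Rightarrow> real" where
  "lorentz_product v w = - (v$1 * w$1) + v$2 * w$2 + v$3 * w$3 + v$4 * w$4"

lemma lorentz_product_commute: "lorentz_product v w = lorentz_product w v"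
  by (simp add: lorentz_product_def mult.commute)

lemma lorentz_gram: "(P ** minkowski ** transpose P) $ i $ j = lorentz_product (P $ i) (P $ j)"
  by (simp add: matrix_matrix_mult_def sum_4 minkowski_def transpose_def lorentz_product_def)

lemma lorentz_gram_eq_block:
  assumes "lorentz_product w w = p" "lorentz_product w v = q" "lorentz_product v v = s"
    "lorentz_product w e = 0" "lorentz_product w f = 0" "lorentz_product v e = 0" "lorentz_product v f = 0"
    "lorentz_product e e = 1" "lorentz_product f f = 1" "lorentz_product e f = 0"
  shows "vector [w, v, e, f] ** minkowski ** transpose (vector [w, v, e, f]) = block_gram p q s"
  unfolding vec_eq_iff forall_4 lorentz_gram
  using assms lorentz_product_commute[of v w] lorentz_product_commute[of e w] lorentz_product_commute[of f w]
    lorentz_product_commute[of e v] lorentz_product_commute[of f v] lorentz_product_commute[of f e]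
  by (simp add: block_gram_def)

text \<open>The last two rows are purely spatial and orthogonal to the spatial part of
  \<open>w\<close>. The second row only has to make the block nondegenerate; if \<open>w\<close> is
  null it is taken along the opposite null direction, which is the normal form behind Class
  2.\<close>

lemma minkowski_adapted_frame:
  fixes w :: "real^4"
  assumes "w \<noteq> 0"
  obtains P :: "real^4^4" and p q s where "P $ 1 = w" "P ** minkowski ** transpose P = block_gram p q s"
    "p * s - q\<^sup>2 \<noteq> 0" "p = 0 \<Longrightarrow> q = -1 \<and> s = 0"
proof (cases "w$2 = 0 \<and> w$3 = 0 \<and> w$4 = 0")
  case True
  then have w1: "w $ 1 \<noteq> 0" using assms by (auto simp: vec_eq_iff forall_4)
  show ?thesis
    by (rule that[OF _ lorentz_gram_eq_block, of w "axis 2 1" "axis 3 1" "axis 4 1" "- (w$1)\<^sup>2" 0 1])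
      (use True w1 in \<open>auto simp: lorentz_product_def axis_def power2_eq_square\<close>)
next
  case False
  then have nz: "w$2 \<noteq> 0 \<or> w$3 \<noteq> 0 \<or> w$4 \<noteq> 0" by auto
  obtain u1 u2 u3 v1 v2 v3 where uv: "u1 * w$2 + u2 * w$3 + u3 * w$4 = 0" "v1 * w$2 + v2 * w$3 + v3 * w$4 = 0"
    "u1 * u1 + u2 * u2 + u3 * u3 = 1" "v1 * v1 + v2 * v2 + v3 * v3 = 1" "u1 * v1 + u2 * v2 + u3 * v3 = 0"
    by (rule orthonormal_complement_3[OF nz])
  define n where "n = w$2 * w$2 + w$3 * w$3 + w$4 * w$4"
  have n: "n > 0"
  proof -
    have "w$2 * w$2 \<ge> 0" "w$3 * w$3 \<ge> 0" "w$4 * w$4 \<ge> 0" by auto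
    moreover have "w$2 * w$2 > 0 \<or> w$3 * w$3 > 0 \<or> w$4 * w$4 > 0" using False
      by (metis not_real_square_gt_zero)
    ultimately show ?thesis unfolding n_def by linarith
  qed
  define p where "p = n - w$1 * w$1"
  have lo: "lorentz_product w (vector [0, u1, u2, u3]) = 0" "lorentz_product w (vector [0, v1, v2, v3]) = 0"
    "lorentz_product (vector [0, u1, u2, u3]) (vector [0, u1, u2, u3]) = 1"
    "lorentz_product (vector [0, v1, v2, v3]) (vector [0, v1, v2, v3]) = 1"
    "lorentz_product (vector [0, u1, u2, u3]) (vector [0, v1, v2, v3]) = 0"
    "lorentz_product w w = p"
    unfolding lorentz_product_def vector_4_nth p_def n_def
    using uv by (simp_all only: mult.commute)
  show ?thesis
  proof (cases "p = 0")
    case False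
    \<comment> \<open>With the time axis as second row the determinant of the block is -n.\<close>
    have pn: "p * (-1) - (- w$1)\<^sup>2 \<noteq> 0"
      using n by (simp add: p_def power2_eq_square)
    have lax: "lorentz_product w (axis 1 1) = - w$1" "lorentz_product (axis 1 1) (axis 1 1) = -1"
      "lorentz_product (axis 1 1) (vector [0, u1, u2, u3]) = 0" "lorentz_product (axis 1 1) (vector [0, v1, v2, v3]) = 0"
      unfolding lorentz_product_def vector_4_nth axis_one_nth by simp_all
    show ?thesis
      by (rule that[OF _ lorentz_gram_eq_block, of w "axis 1 1"
            "vector [0, u1, u2, u3]" "vector [0, v1, v2, v3]" p "- w$1" "-1"])
       (use False pn lo lax in auto)
  next
    case True
    then have w1: "w$1 \<noteq> 0" and nw: "n = w$1 * w$1" using n by (auto simp: p_def)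
    \<comment> \<open>With these \<open>k\<close> and \<open>l\<close> the vector \<psi> below is
      the spatial reflection of \<open>w\<close>, which is again null, divided by twice the square
      of \<open>w$1\<close> so that its product with \<open>w\<close> is -1.\<close>
    define k where "k = 1 / (2 * w$1)"
    define l where "l = - k / w$1"
    have kl: "w$1 * k = 1/2" "l * w$1 = - k" using w1 by (auto simp: k_def l_def)
    have 1: "- (w$1 * k) + l * n = -1"
    proof -
      have "l * n = (l * w$1) * w$1" using nw by simp
      also have "\<dots> = (- k) * w$1" by (simp only: kl(2))
      also have "\<dots> = - (w$1 * k)" by (simp only: mult.commute mult_minus_left)
      finally show ?thesis using kl(1) by linarith
    qed
    have "l * l * n = (l * w$1) * (l * w$1)" by (simp only: nw mult_ac)
    then have "l * l * n = (- k) * (- k)" by (simp only: kl(2))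
    then have 2: "- (k * k) + l * l * n = 0" by simp
    define \<psi> :: "real^4" where "\<psi> = vector [k, l * w$2, l * w$3, l * w$4]"
    have ww: "- (w$1 * w$1) + (w$2 * w$2 + w$3 * w$3 + w$4 * w$4) = 0"
      using nw by (simp add: n_def)
    have w\<psi>: "- (w$1 * k) + (w$2 * (l * w$2) + w$3 * (l * w$3) + w$4 * (l * w$4)) = -1"
      using 1 unfolding n_def distrib_left by (simp only: mult_ac add_ac)
    have \<psi>\<psi>: "- (k * k) + ((l * w$2) * (l * w$2) + (l * w$3) * (l * w$3) + (l * w$4) * (l * w$4)) = 0"
      using 2 unfolding n_def distrib_left by (simp only: mult_ac add_ac)
    have l\<psi>: "u1 * (l * w$2) + u2 * (l * w$3) + u3 * (l * w$4) = 0" "v1 * (l * w$2) + v2 * (l * w$3) + v3 * (l * w$4) = 0"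
      using arg_cong[OF uv(1), of "\<lambda>a. l * a"] arg_cong[OF uv(2), of "\<lambda>a. l * a"]
      unfolding distrib_left by (simp_all only: mult_ac mult_zero_right)
    have lop: "lorentz_product w \<psi> = -1" "lorentz_product \<psi> \<psi> = 0"
      "lorentz_product \<psi> (vector [0, u1, u2, u3]) = 0" "lorentz_product \<psi> (vector [0, v1, v2, v3]) = 0"
      unfolding lorentz_product_def vector_4_nth \<psi>_def
      using w\<psi> \<psi>\<psi> l\<psi> by (simp_all only: mult.commute add.assoc)
    show ?thesis
      by (rule that[OF _ lorentz_gram_eq_block, of w \<psi>
            "vector [0, u1, u2, u3]" "vector [0, v1, v2, v3]" 0 "-1" 0])
       (use True lo lop in auto)
  qed
qed

section \<open>Algebraic curvature tensors\<close>

lemma curvature_like_pair_symmetry: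
  fixes Q :: "'i \<Rightarrow> 'i \<Rightarrow> 'i \<Rightarrow> 'i \<Rightarrow> real"
  assumes as1: "\<And>a b c d. Q a b c d = - Q b a c d"
    and as2: "\<And>a b c d. Q a b c d = - Q a b d c"
    and bi: "\<And>a b c d. Q a b c d + Q a c d b + Q a d b c = 0"
  shows "Q a b c d = Q c d a b"
proof -
  have "Q b a c d = - Q a b c d" "Q d c a b = - Q c d a b" "Q d a b c = - Q a d b c" "Q c b d a = - Q b c d a"
    by (rule as1)+
  moreover have "Q a c d b = Q c a b d" "Q d b c a = Q b d a c"
    using as1[of a c d b] as2[of c a d b] as1[of d b c a] as2[of b d c a] by auto
  \<comment> \<open>The four Bianchi identities belong to the cyclic shifts of a b c d; after the
    antisymmetries everything but the two wanted components cancels.\<close>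
  ultimately show ?thesis
    using bi[of a b c d] bi[of b c d a] bi[of c d a b] bi[of d a b c] by linarith
qed

text \<open>\<open>Q\<close> lives on the quotient by the direction \<open>1\<close>, where the inverse metric is \<open>diag (\<kappa>, 1, 1)\<close>;
  \<open>\<kappa> = 0\<close> is the null case.\<close>

lemma curvature_like_vanishing:
  fixes Q :: "4 \<Rightarrow> 4 \<Rightarrow> 4 \<Rightarrow> 4 \<Rightarrow> real"
  assumes as1: "\<And>a b c d. Q a b c d = - Q b a c d"
    and as2: "\<And>a b c d. Q a b c d = - Q a b d c"
    and bi: "\<And>a b c d. Q a b c d + Q a c d b + Q a d b c = 0"
    and Q1: "\<And>b c d. Q 1 b c d = 0"
    and ric: "\<And>b d. \<kappa> * Q 2 b 2 d + Q 3 b 3 d + Q 4 b 4 d = 0"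
  shows "Q 3 4 c d = 0" and "\<kappa> \<noteq> 0 \<Longrightarrow> Q a b c d = 0"
proof -
  note pair = curvature_like_pair_symmetry[of Q, OF as1 as2 bi]
  have aa: "Q a a c d = 0" "Q a b c c = 0" for a b c d
    using as1[of a a c d] as2[of a b c c] by auto
  have z: "Q a 1 c d = 0" "Q a b 1 d = 0" "Q a b c 1 = 0" for a b c d
    using Q1 as1[of a 1 c d] pair[of a b 1 d] pair[of a b c 1] as1[of c 1 a b] by auto
  have e: "Q 3 2 4 2 = 0" if "\<kappa> \<noteq> 0"
    using ric[of 3 4] that aa as1[of 2 3 2 4] as2[of 3 2 2 4] by auto
  \<comment> \<open>Adding the (3, 3) and (4, 4) traces and subtracting \<kappa> times the (2, 2)
    trace leaves 2 Q 3 4 3 4. This also works for \<kappa> = 0.\<close>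
  have p: "Q 3 4 3 4 = 0"
    using ric[of 3 3] ric[of 4 4] ric[of 2 2] aa
      as1[of 4 3 4 3] as2[of 3 4 4 3] as1[of 3 2 3 2] as2[of 2 3 3 2] as1[of 4 2 4 2] as2[of 2 4 4 2]
      distrib_left[of \<kappa> "Q 2 3 2 3" "Q 2 4 2 4"]
    by auto
  \<comment> \<open>The (3, 3) and (4, 4) traces see these components through the factor \<kappa>.
    In the null case they may survive, opposite to each other by the (2, 2) trace, and belong to the
    wave.\<close>
  have q: "Q 2 3 2 3 = 0" "Q 2 4 2 4 = 0" if "\<kappa> \<noteq> 0"
    using ric[of 3 3] ric[of 4 4] p that aa as1[of 4 3 4 3] as2[of 3 4 4 3] by auto
  have r: "Q 4 2 4 3 = 0" "Q 3 2 3 4 = 0"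
    using ric[of 2 3] ric[of 2 4] aa by auto
  have a4: "Q 3 4 2 3 = 0" "Q 3 4 2 4 = 0"
    using r pair[of 4 2 4 3] pair[of 3 2 3 4] as1[of 4 3 4 2] as2[of 3 4 4 2] as2[of 3 4 3 2] by auto
  have Q34: "Q 3 4 c d = 0" for c d
    using exhaust_4[of c] exhaust_4[of d] z aa p a4 as2[of 3 4 3 2] as2[of 3 4 4 2] as2[of 3 4 4 3]
    by (elim disjE) auto
  show "Q 3 4 c d = 0" by (rule Q34)
  show "Q a b c d = 0" if k: "\<kappa> \<noteq> 0"
  proof -
    have 34: "Q a b 3 4 = 0" "Q a b 4 3 = 0" "Q 4 3 a b = 0" for a b
      using Q34 pair[of a b 3 4] as1[of 4 3 a b] as2[of a b 4 3] by auto
    have f: "Q 2 3 4 2 = 0" "Q 2 3 2 4 = 0" "Q 2 4 2 3 = 0" "Q 2 4 3 2 = 0" "Q 2 3 3 2 = 0" "Q 2 4 4 2 = 0"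
      using e[OF k] q[OF k] as1[of 3 2 4 2] as2[of 2 3 4 2] pair[of 2 3 2 4] as2[of 2 4 2 3]
        as2[of 2 3 3 2] as2[of 2 4 4 2] by - linarith+
    have 23: "Q 2 3 c d = 0" for c d
      using exhaust_4[of c] exhaust_4[of d] by (elim disjE) (simp_all add: z aa 34 q[OF k] f)
    have 24: "Q 2 4 c d = 0" for c d
      using exhaust_4[of c] exhaust_4[of d] by (elim disjE) (simp_all add: z aa 34 q[OF k] f)
    note 2 = 23 24
    have 3: "Q 3 2 c d = 0" "Q 4 2 c d = 0" for c d
      using 2 as1[of 3 2 c d] as1[of 4 2 c d] by auto
    show ?thesis
      using exhaust_4[of a] exhaust_4[of b] by (elim disjE) (simp_all add: z Q1 aa 34 2 3 Q34)
  qed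
qed


section \<open>Levi-Civita connection in a chart\<close>

lemmas matrix_ring_simps =
  bounded_bilinear.add_left[OF bounded_bilinear_matrix_matrix]
  bounded_bilinear.add_right[OF bounded_bilinear_matrix_matrix]
  bounded_bilinear.diff_left[OF bounded_bilinear_matrix_matrix]
  bounded_bilinear.diff_right[OF bounded_bilinear_matrix_matrix]
  bounded_bilinear.minus_left[OF bounded_bilinear_matrix_matrix]
  bounded_bilinear.minus_right[OF bounded_bilinear_matrix_matrix]
  bounded_bilinear.add_left[OF bounded_bilinear_matrix_vector]
  bounded_bilinear.add_right[OF bounded_bilinear_matrix_vector]
  bounded_bilinear.diff_left[OF bounded_bilinear_matrix_vector]
  bounded_bilinear.diff_right[OF bounded_bilinear_matrix_vector]
  bounded_bilinear.minus_left[OF bounded_bilinear_matrix_vector]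
  bounded_bilinear.minus_right[OF bounded_bilinear_matrix_vector]

text \<open>The situation in a single chart, expressed by component functions on an open set, so
  that the geometry can be done before any manifold appears.\<close>

locale lorentz_chart =
  fixes W :: "(real^4) set" and g :: "real^4 \<Rightarrow> real^4^4" and \<beta> :: "real^4 \<Rightarrow> real^4"
  assumes open_W: "open W" and smooth_g: "smooth_on W g" and smooth_\<beta>: "smooth_on W \<beta>"
    and sym_g: "x \<in> W \<Longrightarrow> transpose (g x) = g x"
    and lorentz: "x \<in> W \<Longrightarrow> \<exists>E. transpose E ** g x ** E = minkowski"
    and ricci_flat: "x \<in> W \<Longrightarrow> ricci g i j x = 0"
    and parallel: "x \<in> W \<Longrightarrow>
      partial_deriv i (\<lambda>z. \<beta> z $ j) x - (\<Sum>k\<in>UNIV. christoffel g k i j x * \<beta> x $ k) = 0"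
begin

definition h :: "real^4 \<Rightarrow> real^4^4" where "h x = matrix_inv (g x)"

text \<open>The upper Christoffel index labels the columns, so that \<open>C i\<close> acts on
  covectors and parallel covectors solve the linear system pd i Y = C i Y.\<close>

definition C :: "4 \<Rightarrow> real^4 \<Rightarrow> real^4^4" where "C i x = (\<chi> j k. christoffel g k i j x)"

definition cov :: "4 \<Rightarrow> (real^4 \<Rightarrow> real^4) \<Rightarrow> real^4 \<Rightarrow> real^4" where
  "cov i Y x = pd i Y x - C i x *v Y x"

definition ip :: "real^4 \<Rightarrow> real^4 \<Rightarrow> real^4 \<Rightarrow> real" where
  "ip x Y Z = Y \<bullet> (h x *v Z)"

text \<open>The curvature as an endomorphism of covectors. Its vanishing is literally the
  integrability condition of \<open>flat_linear_system\<close>.\<close>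

definition curv :: "4 \<Rightarrow> 4 \<Rightarrow> real^4 \<Rightarrow> real^4^4" where
  "curv m n x = pd m (C n) x - pd n (C m) x + C n x ** C m x - C m x ** C n x"

lemma invertible_g:
  assumes "x \<in> W" shows "invertible (g x)"
proof -
  obtain E where "transpose E ** g x ** E = minkowski" using lorentz[OF assms] by blast
  then have "det (transpose E) * det (g x) * det E = det minkowski"
    by (metis det_mul)
  moreover have "det minkowski * det minkowski = 1"
    by (metis det_mul det_I minkowski_square)
  ultimately show ?thesis by (auto simp: invertible_det_nz)
qed

lemma h_g: "x \<in> W \<Longrightarrow> h x ** g x = mat 1" and g_h: "x \<in> W \<Longrightarrow> g x ** h x = mat 1"
  unfolding h_def using matrix_inv_left matrix_inv_right invertible_g by auto

lemma sym_h:
  assumes "x \<in> W" shows "transpose (h x) = h x"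
proof -
  have "transpose (h x ** g x) = mat 1" by (simp add: h_g[OF assms] transpose_mat)
  then have "g x ** transpose (h x) = mat 1" by (simp add: matrix_transpose_mul sym_g[OF assms])
  from matrix_inv_eqI[OF this] show ?thesis by (simp add: h_def)
qed

lemma sym_g_nth: "x \<in> W \<Longrightarrow> g x $ i $ j = g x $ j $ i"
  using arg_cong[OF sym_g, of x "\<lambda>M. M $ j $ i"] by (simp add: transpose_def)

lemma sym_h_nth: "x \<in> W \<Longrightarrow> h x $ i $ j = h x $ j $ i"
  using arg_cong[OF sym_h, of x "\<lambda>M. M $ j $ i"] by (simp add: transpose_def)

lemma smooth_h: "smooth_on W h"
  unfolding h_def[abs_def] by (intro smooth_on_matrix_inv open_W smooth_g invertible_g)

lemma smooth_g_nth: "smooth_on W (\<lambda>z. g z $ i $ j)"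
  by (intro smooth_on_vec_nth open_W smooth_g)

lemma christoffel_eq:
  "christoffel g k i j x = (\<Sum>l\<in>UNIV. h x $ k $ l *
    (pd i (\<lambda>z. g z $ j $ l) x + pd j (\<lambda>z. g z $ i $ l) x - pd l (\<lambda>z. g z $ i $ j) x)) / 2"
  by (simp add: christoffel_def h_def partial_deriv_eq_pd)

lemma smooth_C: "smooth_on W (C i)"
  unfolding C_def[abs_def] christoffel_eq
  by (intro smooth_on_vec_lambda smooth_on_divide smooth_on_sum smooth_on_mult smooth_on_diff smooth_on_add
      smooth_on_vec_nth smooth_on_pd smooth_h smooth_g open_W smooth_on_const) simp

lemma pd_g_sym:
  assumes "x \<in> W"
  shows "pd l (\<lambda>z. g z $ i $ j) x = pd l (\<lambda>z. g z $ j $ i) x"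
  by (rule pd_cong[OF open_W assms sym_g_nth smooth_on_differentiable[OF smooth_g_nth assms]])

lemma C_sym:
  assumes "x \<in> W" shows "C i x $ j $ k = C j x $ i $ k"
  unfolding C_def christoffel_eq by (simp add: pd_g_sym[OF assms, of _ i j] add.commute)

lemma christoffel_lower:
  assumes "x \<in> W"
  shows "(\<Sum>k\<in>UNIV. christoffel g k i j x * g x $ k $ l)
    = (pd i (\<lambda>z. g z $ j $ l) x + pd j (\<lambda>z. g z $ i $ l) x - pd l (\<lambda>z. g z $ i $ j) x) / 2"
proof -
  define T where "T m = pd i (\<lambda>z. g z $ j $ m) x + pd j (\<lambda>z. g z $ i $ m) x - pd m (\<lambda>z. g z $ i $ j) x" for m
  have gh: "(\<Sum>k\<in>UNIV. h x $ k $ m * g x $ k $ l) = (if m = l then 1 else 0)" for m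
  proof -
    have "(h x ** g x) $ m $ l = (if m = l then 1 else 0)" by (simp add: h_g[OF assms] mat_def)
    then show ?thesis by (simp add: matrix_matrix_mult_def sym_h_nth[OF assms, of _ m])
  qed
  have "(\<Sum>k\<in>UNIV. christoffel g k i j x * g x $ k $ l)
      = (\<Sum>k\<in>UNIV. \<Sum>m\<in>UNIV. T m * (h x $ k $ m * g x $ k $ l)) / 2"
    unfolding christoffel_eq T_def[symmetric]
    by (simp add: sum_divide_distrib sum_distrib_right sum_distrib_left mult_ac)
  also have "\<dots> = (\<Sum>m\<in>UNIV. T m * (\<Sum>k\<in>UNIV. h x $ k $ m * g x $ k $ l)) / 2"
    by (subst sum.swap) (simp add: sum_distrib_left)
  also have "\<dots> = T l / 2" by (simp add: gh if_distrib[of "\<lambda>c. _ * c"] cong: if_cong)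
  finally show ?thesis by (simp add: T_def)
qed

lemma diff_g: "x \<in> W \<Longrightarrow> g differentiable (at x)"
  and diff_h: "x \<in> W \<Longrightarrow> h differentiable (at x)"
  and diff_C: "x \<in> W \<Longrightarrow> C i differentiable (at x)"
  using smooth_on_differentiable smooth_g smooth_h smooth_C by blast+

text \<open>Metric compatibility: in the sum of two lowered Christoffel symbols all derivatives but
  one cancel.\<close>

lemma pd_g:
  assumes "x \<in> W"
  shows "pd i g x = C i x ** g x + g x ** transpose (C i x)"
proof -
  have "(C i x ** g x) $ j $ l + (g x ** transpose (C i x)) $ j $ l = pd i (\<lambda>z. g z $ j $ l) x" for j l
  proof -
    have "(g x ** transpose (C i x)) $ j $ l = (\<Sum>k\<in>UNIV. christoffel g k i l x * g x $ k $ j)"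
      by (simp add: matrix_matrix_mult_def transpose_def C_def sym_g_nth[OF assms, of j] mult.commute)
    then show ?thesis
      using christoffel_lower[OF assms, of i j l] christoffel_lower[OF assms, of i l j]
        pd_g_sym[OF assms, of i j l] pd_g_sym[OF assms, of j i l] pd_g_sym[OF assms, of l i j]
      by (simp add: matrix_matrix_mult_def C_def)
  qed
  then show ?thesis by (simp add: vec_eq_iff pd_nth_nth[OF diff_g[OF assms]])
qed

text \<open>The same compatibility for the inverse metric, from differentiating h g = 1.\<close>

lemma pd_h:
  assumes "x \<in> W"
  shows "pd i h x = - (h x ** C i x + transpose (C i x) ** h x)"
proof -
  have 1: "pd i (\<lambda>z. h z ** g z) x = h x ** pd i g x + pd i h x ** g x"
    by (rule pd_matrix_matrix[OF diff_h[OF assms] diff_g[OF assms]])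
  have 2: "pd i (\<lambda>z. h z ** g z) x = 0"
  proof -
    have "pd i (\<lambda>z. h z ** g z) x = pd i (\<lambda>z. mat 1 :: real^4^4) x"
      by (rule pd_cong[OF open_W assms h_g], assumption)
        (rule smooth_on_differentiable[OF smooth_on_matrix_matrix[OF open_W smooth_h smooth_g] assms])
    then show ?thesis by simp
  qed
  have 3: "pd i h x ** g x = - (h x ** pd i g x)"
    using 1 2 by (simp add: eq_neg_iff_add_eq_0 add.commute)
  have "pd i h x ** (g x ** h x) = - (h x ** pd i g x) ** h x"
    by (simp only: matrix_mul_assoc 3)
  also have "\<dots> = - (h x ** C i x ** (g x ** h x) + (h x ** g x) ** transpose (C i x) ** h x)"
    unfolding pd_g[OF assms]
    by (simp add: matrix_ring_simps matrix_mul_assoc)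
  finally show ?thesis by (simp add: g_h[OF assms] h_g[OF assms])
qed

lemma ip_commute: "x \<in> W \<Longrightarrow> ip x Y Z = ip x Z Y"
  unfolding ip_def by (metis inner_commute inner_matrix_vector_transpose sym_h)

lemma ip_simps:
  "ip x (Y + Y') Z = ip x Y Z + ip x Y' Z" "ip x Y (Z + Z') = ip x Y Z + ip x Y Z'"
  "ip x (Y - Y') Z = ip x Y Z - ip x Y' Z" "ip x Y (Z - Z') = ip x Y Z - ip x Y Z'"
  "ip x (r *\<^sub>R Y) Z = r * ip x Y Z" "ip x Y (r *\<^sub>R Z) = r * ip x Y Z"
  "ip x (- Y) Z = - ip x Y Z" "ip x Y (- Z) = - ip x Y Z" "ip x 0 Z = 0" "ip x Y 0 = 0"
  unfolding ip_def
  by (simp_all add: inner_add_left inner_add_right inner_diff_left inner_diff_right matrix_vector_right_distrib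
      matrix_vector_mult_diff_distrib matrix_vector_mult_scaleR
      linear_neg[OF matrix_vector_mul_linear])

lemma smooth_ip:
  assumes "open S" "S \<subseteq> W" "smooth_on S Y" "smooth_on S Z"
  shows "smooth_on S (\<lambda>x. ip x (Y x) (Z x))"
  unfolding ip_def
  by (intro smooth_on_inner smooth_on_matrix_vector smooth_on_subset[OF smooth_h] assms)

lemma smooth_cov:
  assumes "open S" "S \<subseteq> W" "smooth_on S Y"
  shows "smooth_on S (cov i Y)"
  unfolding cov_def[abs_def]
  by (intro smooth_on_diff smooth_on_matrix_vector smooth_on_pd smooth_on_subset[OF smooth_C] assms)

lemma pd_ip:
  assumes "x \<in> W" "Y differentiable (at x)" "Z differentiable (at x)"
  shows "pd i (\<lambda>z. ip z (Y z) (Z z)) x = ip x (cov i Y x) (Z x) + ip x (Y x) (cov i Z x)"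
proof -
  have "pd i (\<lambda>z. h z *v Z z) x = h x *v pd i Z x + pd i h x *v Z x"
    by (rule pd_matrix_vector[OF diff_h[OF assms(1)] assms(3)])
  moreover have "(\<lambda>z. h z *v Z z) differentiable (at x)"
    using bounded_bilinear.FDERIV[OF bounded_bilinear_matrix_vector] diff_h[OF assms(1)] assms(3)
    unfolding differentiable_def by blast
  ultimately have "pd i (\<lambda>z. ip z (Y z) (Z z)) x
      = Y x \<bullet> (h x *v pd i Z x + pd i h x *v Z x) + pd i Y x \<bullet> (h x *v Z x)"
    unfolding ip_def using pd_bilinear[OF bounded_bilinear_inner assms(2)] by simp
  moreover have "pd i h x *v Z x = - (h x *v (C i x *v Z x)) - transpose (C i x) *v (h x *v Z x)"
    unfolding pd_h[OF assms(1)]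
    by (simp add: matrix_vector_mul_assoc matrix_ring_simps)
  moreover have "Y x \<bullet> (transpose (C i x) *v (h x *v Z x)) = (C i x *v Y x) \<bullet> (h x *v Z x)"
    by (simp add: inner_matrix_vector_transpose)
  ultimately show ?thesis
    by (simp add: ip_def cov_def inner_add_right inner_diff_right inner_diff_left matrix_vector_mult_diff_distrib)
qed

lemma cov_simps:
  assumes "Y differentiable (at x)" "Z differentiable (at x)"
  shows "cov i (\<lambda>z. Y z + Z z) x = cov i Y x + cov i Z x"
    "cov i (\<lambda>z. Y z - Z z) x = cov i Y x - cov i Z x"
  using assms by (simp_all add: cov_def pd_add pd_diff matrix_vector_right_distrib matrix_vector_mult_diff_distrib)

lemma cov_scaleR:
  assumes "f differentiable (at x)" "Y differentiable (at x)"
  shows "cov i (\<lambda>z. f z *\<^sub>R Y z) x = f x *\<^sub>R cov i Y x + pd i f x *\<^sub>R Y x"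
  using pd_bilinear[OF bounded_bilinear_scaleR assms]
  by (simp add: cov_def matrix_vector_mult_scaleR scaleR_diff_right)

text \<open>Absence of torsion. It turns statements about covariant derivatives into closedness and
  thus produces coordinate functions.\<close>

lemma cov_antisym:
  assumes "x \<in> W" "Y differentiable (at x)"
  shows "cov i Y x $ j - cov j Y x $ i = pd i (\<lambda>z. Y z $ j) x - pd j (\<lambda>z. Y z $ i) x"
  by (simp add: cov_def pd_nth[OF assms(2)] matrix_vector_mult_def C_sym[OF assms(1), of i j])

text \<open>The index of the inner derivative is a mere label and receives no connection term. The
  commutator is nevertheless the curvature, because coordinate vector fields commute.\<close>

lemma cov_cov:
  assumes "open S" "S \<subseteq> W" "x \<in> S" "smooth_on S Y"
  shows "cov m (cov n Y) x - cov n (cov m Y) x = - (curv m n x *v Y x)"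
proof -
  have d: "Y differentiable (at x)" "pd n Y differentiable (at x)" "pd m Y differentiable (at x)"
    by (rule smooth_on_differentiable[OF _ assms(3)], intro smooth_on_pd assms(4))+
  have xW: "x \<in> W" using assms by blast
  have p: "pd m (cov n Y) x = pd m (pd n Y) x - (C n x *v pd m Y x + pd m (C n) x *v Y x)" for m n
  proof -
    have "(\<lambda>z. C n z *v Y z) differentiable (at x)"
      using bounded_bilinear.FDERIV[OF bounded_bilinear_matrix_vector] diff_C[OF xW] d(1)
      unfolding differentiable_def by blast
    moreover have "pd n Y differentiable (at x)"
      by (rule smooth_on_differentiable[OF smooth_on_pd[OF assms(4)] assms(3)])
    ultimately show ?thesis
      unfolding cov_def[abs_def] by (simp add: pd_diff pd_matrix_vector[OF diff_C[OF xW] d(1)])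
  qed
  show ?thesis
    unfolding cov_def[of m "cov n Y"] cov_def[of n "cov m Y"] p
    using pd_commute[OF assms(1,3,4), of m n]
    by (simp add: cov_def curv_def matrix_ring_simps matrix_vector_mul_assoc)
qed

text \<open>The product of two covector fields with constant components is differentiated twice.
  Interchanging the derivatives cancels the mixed terms and leaves the commutators on either
  factor.\<close>

lemma curv_skew:
  assumes "x \<in> W"
  shows "ip x (curv m n x *v Y) Z = - ip x Y (curv m n x *v Z)"
proof -
  let ?Y = "\<lambda>x::real^4. Y" and ?Z = "\<lambda>x::real^4. Z"
  have sm: "smooth_on W ?Y" "smooth_on W ?Z" by (auto intro: smooth_on_const open_W)
  have smc: "smooth_on W (cov i ?Y)" "smooth_on W (cov i ?Z)" for i
    using smooth_cov[OF open_W _ sm(1)] smooth_cov[OF open_W _ sm(2)] by auto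
  note df = smooth_on_differentiable[OF sm(1)] smooth_on_differentiable[OF sm(2)]
    smooth_on_differentiable[OF smc(1)] smooth_on_differentiable[OF smc(2)]
  have "pd m (pd n (\<lambda>z. ip z Y Z)) x = ip x (cov m (cov n ?Y) x) Z + ip x (cov n ?Y x) (cov m ?Z x)
      + (ip x (cov m ?Y x) (cov n ?Z x) + ip x Y (cov m (cov n ?Z) x))" for m n
  proof -
    have "smooth_on W (\<lambda>z. ip z (cov n ?Y z) Z)" "smooth_on W (\<lambda>z. ip z Y (cov n ?Z z))"
      by (auto intro!: smooth_ip open_W sm smc)
    note d2 = smooth_on_differentiable[OF this(1) assms] smooth_on_differentiable[OF this(2) assms]
    have "pd m (pd n (\<lambda>z. ip z Y Z)) x = pd m (\<lambda>z. ip z (cov n ?Y z) Z + ip z Y (cov n ?Z z)) x"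
    proof (rule pd_cong[OF open_W assms])
      show "pd n (\<lambda>z. ip z Y Z) y = ip y (cov n ?Y y) Z + ip y Y (cov n ?Z y)" if "y \<in> W" for y
        using pd_ip[OF that, of ?Y ?Z n] by simp
      show "pd n (\<lambda>z. ip z Y Z) differentiable (at x)"
        by (rule smooth_on_differentiable[OF smooth_on_pd[OF smooth_ip[OF open_W _ sm]] assms]) auto
    qed
    also have "\<dots> = pd m (\<lambda>z. ip z (cov n ?Y z) Z) x + pd m (\<lambda>z. ip z Y (cov n ?Z z)) x"
      by (rule pd_add[OF d2])
    finally show ?thesis
      using pd_ip[OF assms df(3)[OF assms] df(2)[OF assms], of m n] pd_ip[OF assms df(1)[OF assms] df(4)[OF assms], of m n]
      by simp
  qed
  from this[of m n] this[of n m] pd_commute[OF open_W assms smooth_ip[OF open_W _ sm], of m n]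
  have "ip x (cov m (cov n ?Y) x - cov n (cov m ?Y) x) Z + ip x Y (cov m (cov n ?Z) x - cov n (cov m ?Z) x) = 0"
    by (simp add: ip_simps)
  then show ?thesis
    unfolding cov_cov[OF open_W order_refl assms sm(1)] cov_cov[OF open_W order_refl assms sm(2)]
    by (simp add: ip_simps)
qed

lemma curv_antisym: "curv m n x = - curv n m x"
  by (simp add: curv_def)

lemma curv_nth:
  assumes "x \<in> W"
  shows "curv m n x $ s $ r = pd m (\<lambda>z. C n z $ s $ r) x - pd n (\<lambda>z. C m z $ s $ r) x
    + (\<Sum>l\<in>UNIV. C n x $ s $ l * C m x $ l $ r) - (\<Sum>l\<in>UNIV. C m x $ s $ l * C n x $ l $ r)"
  by (simp add: curv_def pd_nth_nth[OF diff_C[OF assms]] matrix_matrix_mult_def)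

lemma curv_riemann:
  assumes "x \<in> W" shows "curv m n x $ s $ r = riemann g r s m n x"
  by (simp add: curv_nth[OF assms] riemann_def partial_deriv_eq_pd C_def mult.commute)

lemma curv_ricci:
  assumes "x \<in> W" shows "(\<Sum>r\<in>UNIV. curv r n x $ s $ r) = 0"
  using ricci_flat[OF assms, of s n] by (simp add: curv_riemann[OF assms] ricci_def)

text \<open>Both the derivatives and the products cancel in pairs under the cyclic sum, as
  Christoffel symbols are symmetric in the lower indices.\<close>

lemma curv_bianchi:
  assumes "x \<in> W"
  shows "curv m n x $ s $ r + curv n s x $ m $ r + curv s m x $ n $ r = 0"
proof -
  have p: "pd m (\<lambda>z. C n z $ s $ r) x = pd m (\<lambda>z. C s z $ n $ r) x" for m n s
    by (rule pd_cong[OF open_W assms C_sym])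
      (auto intro!: smooth_on_differentiable[OF _ assms] smooth_on_vec_nth smooth_C open_W)
  show ?thesis
    unfolding curv_nth[OF assms]
    using p[of m n s] p[of n s m] p[of s m n]
    by (simp add: C_sym[OF assms, of n s] C_sym[OF assms, of m s] C_sym[OF assms, of m n])
qed

lemma cov_\<beta>:
  assumes "x \<in> W" shows "cov i \<beta> x = 0"
  using parallel[OF assms, of i]
  by (simp add: cov_def vec_eq_iff pd_nth[OF smooth_on_differentiable[OF smooth_\<beta> assms]]
      matrix_vector_mult_def C_def partial_deriv_eq_pd)

lemma curv_\<beta>:
  assumes "x \<in> W" shows "curv m n x *v \<beta> x = 0"
proof -
  have "cov m (cov n \<beta>) x = 0" for m n
  proof -
    have "pd m (cov n \<beta>) x = pd m (\<lambda>z. 0) x"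
      by (rule pd_cong[OF open_W assms cov_\<beta>], assumption)
        (rule smooth_on_differentiable[OF smooth_cov[OF open_W order_refl smooth_\<beta>] assms])
    then show ?thesis using cov_\<beta>[OF assms] by (simp add: cov_def[of m "cov n \<beta>"])
  qed
  then show ?thesis using cov_cov[OF open_W order_refl assms smooth_\<beta>, of m n] by simp
qed

text \<open>The dual of an orthonormal frame \<open>E\<close> is given by the inverse matrix: the
  Gram relation of the frame amounts to h = E ** minkowski ** transpose E.\<close>

lemma orthonormal_coframe:
  assumes x: "x \<in> W"
  obtains \<Theta> where "\<Theta> ** h x ** transpose \<Theta> = minkowski"
proof -
  obtain E where E: "transpose E ** g x ** E = minkowski" using lorentz[OF x] by blast
  have "(minkowski ** transpose E ** g x) ** E = mat 1"
    by (metis E matrix_mul_assoc minkowski_square)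
  then have "E ** (minkowski ** transpose E ** g x) = mat 1"
    by (simp add: matrix_left_right_inverse)
  then have "(E ** minkowski ** transpose E) ** g x = mat 1"
    by (simp add: matrix_mul_assoc)
  then have "g x ** (E ** minkowski ** transpose E) = mat 1"
    by (simp add: matrix_left_right_inverse)
  then have hE: "h x = E ** minkowski ** transpose E" unfolding h_def by (rule matrix_inv_eqI)
  have "(minkowski ** transpose E ** g x) ** E = mat 1"
    by (metis E matrix_mul_assoc minkowski_square)
  then have "invertible E" using invertible_left_inverse by blast
  then have EE: "matrix_inv E ** E = mat 1" by (rule matrix_inv_left)
  have "matrix_inv E ** h x ** transpose (matrix_inv E)
      = (matrix_inv E ** E) ** minkowski ** transpose (matrix_inv E ** E)"
    unfolding hE matrix_transpose_mul by (simp only: matrix_mul_assoc)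
  then show ?thesis using that by (simp add: EE transpose_mat)
qed

text \<open>The vector \<open>w\<close> collects the components of \<open>b\<close> in an
  orthonormal coframe; the frame adapted to \<open>w\<close> in Minkowski space is carried back by
  that coframe.\<close>

lemma adapted_coframe:
  assumes x: "x \<in> W" and "b \<noteq> 0"
  obtains \<Theta> p q s where "\<Theta> $ 1 = b" "\<Theta> ** h x ** transpose \<Theta> = block_gram p q s"
    "p * s - q\<^sup>2 \<noteq> 0" "p = 0 \<Longrightarrow> q = -1 \<and> s = 0"
proof -
  obtain \<Theta> where \<Theta>: "\<Theta> ** h x ** transpose \<Theta> = minkowski" by (rule orthonormal_coframe[OF x])
  define K where "K = h x ** transpose \<Theta> ** minkowski"
  have "\<Theta> ** K = mat 1" by (simp add: K_def matrix_mul_assoc \<Theta> minkowski_square)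
  then have "K ** \<Theta> = mat 1" by (rule iffD1[OF matrix_left_right_inverse])
  then have tK: "transpose \<Theta> ** transpose K = mat 1" by (simp add: matrix_transpose_mul[symmetric] transpose_mat)
  define w where "w = transpose K *v b"
  have bw: "transpose \<Theta> *v w = b"
    by (simp only: w_def matrix_vector_mul_assoc tK matrix_vector_mul_lid)
  have "w \<noteq> 0" using bw assms(2) by (metis matrix_vector_mult_0_right)
  then obtain P p q s where P: "P $ 1 = w" "P ** minkowski ** transpose P = block_gram p q s"
    "p * s - q\<^sup>2 \<noteq> 0" "p = 0 \<Longrightarrow> q = -1 \<and> s = 0"
    by (rule minkowski_adapted_frame) blast
  show ?thesis
  proof (rule that[of "P ** \<Theta>" p q s])
    have "(P ** \<Theta>) $ 1 = transpose \<Theta> *v (P $ 1)"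
      by (simp add: vec_eq_iff matrix_matrix_mult_def matrix_vector_mult_def transpose_def mult.commute)
    then show "(P ** \<Theta>) $ 1 = b" by (simp only: P(1) bw)
    have "P ** \<Theta> ** h x ** transpose (P ** \<Theta>) = P ** (\<Theta> ** h x ** transpose \<Theta>) ** transpose P"
      unfolding matrix_transpose_mul by (simp only: matrix_mul_assoc)
    then show "P ** \<Theta> ** h x ** transpose (P ** \<Theta>) = block_gram p q s" by (simp only: \<Theta> P(2))
  qed (use P in auto)
qed

lemma gram_nth: "(M ** h x ** transpose \<Theta>) $ a $ b = ip x (M $ a) (\<Theta> $ b)"
  unfolding ip_def inner_vec_def matrix_matrix_mult_def matrix_vector_mult_def transpose_def
  by (simp add: sum_distrib_left sum_distrib_right mult_ac) (subst sum.swap, simp)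

text \<open>All four slots of the curvature are moved to the coframe, where the three-dimensional
  algebra applies, and the result is moved back by inverting the coframe.\<close>

lemma curvature_in_coframe:
  assumes x: "x \<in> W" and T: "\<Theta> $ 1 = \<beta> x" "\<Theta> ** h x ** transpose \<Theta> = block_gram p q s" "p * s - q\<^sup>2 \<noteq> 0"
  shows "ip x (curv m n x *v \<Theta> $ 3) (\<Theta> $ 4) = 0" and "p \<noteq> 0 \<Longrightarrow> curv m n x = 0"
proof -
  define d where "d = p * s - q\<^sup>2"
  define G where "G = block_gram (s / d) (- q / d) (p / d)"
  \<comment> \<open>The vector \<open>e a\<close> is the coframe member with its index raised; it
    fills the two form slots of the curvature in \<open>Q\<close>.\<close>
  define e where "e a = h x *v \<Theta> $ a" for a
  define Q where "Q a b c d = (\<Sum>m\<in>UNIV. \<Sum>n\<in>UNIV. e c $ m * e d $ n * ip x (curv m n x *v \<Theta> $ a) (\<Theta> $ b))"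
    for a b c d
  have "\<Theta> ** h x ** (transpose \<Theta> ** G) = mat 1"
    unfolding matrix_mul_assoc T(2) G_def d_def using block_gram_inverse[OF T(3)] by simp
  then have TGTh: "transpose \<Theta> ** G ** (\<Theta> ** h x) = mat 1"
    using matrix_left_right_inverse by (metis matrix_mul_assoc)
  have Th: "(\<Theta> ** h x) $ a $ m = e a $ m" for a m
    by (simp add: e_def matrix_matrix_mult_def matrix_vector_mult_def sym_h_nth[OF x, of _ m] mult.commute)
  \<comment> \<open>\<open>G\<close> inverts the Gram matrix, so this contraction resolves the
    identity; hence tracing \<open>Q\<close> with \<open>G\<close> amounts to the Ricci
    contraction.\<close>
  have delta: "(\<Sum>a\<in>UNIV. \<Sum>c\<in>UNIV. \<Theta> $ a $ r * G $ a $ c * e c $ m) = (if r = m then 1 else 0)" for r m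
  proof -
    have "(transpose \<Theta> ** G ** (\<Theta> ** h x)) $ r $ m = (\<Sum>c\<in>UNIV. (\<Sum>a\<in>UNIV. \<Theta> $ a $ r * G $ a $ c) * e c $ m)"
      by (subst matrix_matrix_mult_def) (simp add: Th, simp add: matrix_matrix_mult_def transpose_def)
    also have "\<dots> = (\<Sum>a\<in>UNIV. \<Sum>c\<in>UNIV. \<Theta> $ a $ r * G $ a $ c * e c $ m)"
      by (subst sum.swap) (simp add: sum_distrib_right)
    finally show ?thesis using TGTh by (simp add: mat_def)
  qed
  have ip_e: "ip x (curv m n x *v \<Theta> $ a) (\<Theta> $ b) = (\<Sum>s\<in>UNIV. \<Sum>r\<in>UNIV. curv m n x $ s $ r * \<Theta> $ a $ r * e b $ s)"
    for m n a b
    by (simp add: ip_def e_def[symmetric] inner_vec_def matrix_vector_mult_def[of "curv m n x"] sum_distrib_right)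
  have Q_antisym1: "Q a b c d = - Q b a c d" for a b c d
    unfolding Q_def sum_negf[symmetric]
    using curv_skew[OF x] ip_commute[OF x] by (intro sum.cong refl) (metis mult_minus_right)
  have Q_antisym2: "Q a b c d = - Q a b d c" for a b c d
  proof -
    have "Q a b c d = (\<Sum>n\<in>UNIV. \<Sum>m\<in>UNIV. e c $ m * e d $ n * ip x (curv m n x *v \<Theta> $ a) (\<Theta> $ b))"
      unfolding Q_def by (rule sum.swap)
    also have "\<dots> = - Q a b d c"
      unfolding Q_def sum_negf[symmetric]
    proof (intro sum.cong refl)
      fix n m
      have "curv m n x *v \<Theta> $ a = - (curv n m x *v \<Theta> $ a)"
        by (subst curv_antisym) (rule bounded_bilinear.minus_left[OF bounded_bilinear_matrix_vector])
      then show "e c $ m * e d $ n * ip x (curv m n x *v \<Theta> $ a) (\<Theta> $ b)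
          = - (e d $ n * e c $ m * ip x (curv n m x *v \<Theta> $ a) (\<Theta> $ b))"
        by (simp add: ip_simps mult.commute)
    qed
    finally show ?thesis .
  qed
  have rot3: "(\<Sum>n\<in>UNIV. \<Sum>s\<in>UNIV. \<Sum>r\<in>UNIV. f n s r) = (\<Sum>r\<in>UNIV. \<Sum>n\<in>UNIV. \<Sum>s\<in>UNIV. f n s r)"
    for f :: "4 \<Rightarrow> 4 \<Rightarrow> 4 \<Rightarrow> real"
  proof -
    have "(\<Sum>n\<in>UNIV. \<Sum>s\<in>UNIV. \<Sum>r\<in>UNIV. f n s r) = (\<Sum>n\<in>UNIV. \<Sum>r\<in>UNIV. \<Sum>s\<in>UNIV. f n s r)"
      by (rule sum.cong[OF refl], rule sum.swap)
    also have "\<dots> = (\<Sum>r\<in>UNIV. \<Sum>n\<in>UNIV. \<Sum>s\<in>UNIV. f n s r)" by (rule sum.swap)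
    finally show ?thesis .
  qed
  have Q_exp: "Q a b c d = (\<Sum>r\<in>UNIV. \<Theta> $ a $ r * (\<Sum>s\<in>UNIV. \<Sum>m\<in>UNIV. \<Sum>n\<in>UNIV. curv m n x $ s $ r * (e b $ s * e c $ m * e d $ n)))"
    for a b c d
  proof -
    let ?f = "\<lambda>m n s r. \<Theta> $ a $ r * (curv m n x $ s $ r * (e b $ s * e c $ m * e d $ n))"
    have "Q a b c d = (\<Sum>m\<in>UNIV. \<Sum>n\<in>UNIV. \<Sum>s\<in>UNIV. \<Sum>r\<in>UNIV. ?f m n s r)"
      unfolding Q_def ip_e by (simp add: sum_distrib_left mult_ac)
    also have "\<dots> = (\<Sum>m\<in>UNIV. \<Sum>r\<in>UNIV. \<Sum>n\<in>UNIV. \<Sum>s\<in>UNIV. ?f m n s r)"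
      by (rule sum.cong[OF refl], rule rot3)
    also have "\<dots> = (\<Sum>r\<in>UNIV. \<Sum>m\<in>UNIV. \<Sum>n\<in>UNIV. \<Sum>s\<in>UNIV. ?f m n s r)"
      by (rule sum.swap)
    also have "\<dots> = (\<Sum>r\<in>UNIV. \<Sum>s\<in>UNIV. \<Sum>m\<in>UNIV. \<Sum>n\<in>UNIV. ?f m n s r)"
      by (rule sum.cong[OF refl], rule rot3)
    finally show ?thesis by (simp add: sum_distrib_left)
  qed
  have Q_bianchi: "Q a b c d + Q a c d b + Q a d b c = 0" for a b c d
  proof -
    have "(\<Sum>s\<in>UNIV. \<Sum>m\<in>UNIV. \<Sum>n\<in>UNIV. curv m n x $ s $ r * (e b $ s * e c $ m * e d $ n))
      + (\<Sum>s\<in>UNIV. \<Sum>m\<in>UNIV. \<Sum>n\<in>UNIV. curv m n x $ s $ r * (e c $ s * e d $ m * e b $ n))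
      + (\<Sum>s\<in>UNIV. \<Sum>m\<in>UNIV. \<Sum>n\<in>UNIV. curv m n x $ s $ r * (e d $ s * e b $ m * e c $ n)) = 0" (is "?A + ?B + ?D = 0") for r
    proof -
      \<comment> \<open>The bound indices are renamed and the sums reordered until all three sums
        carry the same weight.\<close>
      have B: "?B = (\<Sum>s\<in>UNIV. \<Sum>m\<in>UNIV. \<Sum>n\<in>UNIV. curv n s x $ m $ r * (e b $ s * e c $ m * e d $ n))"
      proof -
        have "?B = (\<Sum>m\<in>UNIV. \<Sum>n\<in>UNIV. \<Sum>s\<in>UNIV. curv n s x $ m $ r * (e b $ s * e c $ m * e d $ n))"
          by (simp only: mult_ac)
        also have "\<dots> = (\<Sum>m\<in>UNIV. \<Sum>s\<in>UNIV. \<Sum>n\<in>UNIV. curv n s x $ m $ r * (e b $ s * e c $ m * e d $ n))"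
          by (rule sum.cong[OF refl], rule sum.swap)
        also have "\<dots> = (\<Sum>s\<in>UNIV. \<Sum>m\<in>UNIV. \<Sum>n\<in>UNIV. curv n s x $ m $ r * (e b $ s * e c $ m * e d $ n))"
          by (rule sum.swap)
        finally show ?thesis .
      qed
      have D: "?D = (\<Sum>s\<in>UNIV. \<Sum>m\<in>UNIV. \<Sum>n\<in>UNIV. curv s m x $ n $ r * (e b $ s * e c $ m * e d $ n))"
      proof -
        have "?D = (\<Sum>n\<in>UNIV. \<Sum>s\<in>UNIV. \<Sum>m\<in>UNIV. curv s m x $ n $ r * (e b $ s * e c $ m * e d $ n))"
          by (simp only: mult_ac)
        also have "\<dots> = (\<Sum>s\<in>UNIV. \<Sum>n\<in>UNIV. \<Sum>m\<in>UNIV. curv s m x $ n $ r * (e b $ s * e c $ m * e d $ n))"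
          by (rule sum.swap)
        also have "\<dots> = (\<Sum>s\<in>UNIV. \<Sum>m\<in>UNIV. \<Sum>n\<in>UNIV. curv s m x $ n $ r * (e b $ s * e c $ m * e d $ n))"
          by (rule sum.cong[OF refl], rule sum.swap)
        finally show ?thesis .
      qed
      have "?A + ?B + ?D = (\<Sum>s\<in>UNIV. \<Sum>m\<in>UNIV. \<Sum>n\<in>UNIV.
          (curv m n x $ s $ r + curv n s x $ m $ r + curv s m x $ n $ r) * (e b $ s * e c $ m * e d $ n))"
        unfolding B D sum.distrib[symmetric] by (simp only: distrib_right)
      then show ?thesis by (simp add: curv_bianchi[OF x])
    qed
    then show ?thesis
      unfolding Q_exp sum.distrib[symmetric] distrib_left[symmetric] by simp
  qed
  have Q_1: "Q 1 b c d = 0" for b c d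
    unfolding Q_def T(1) curv_\<beta>[OF x] by (simp add: ip_simps)
  have ric_sum: "(\<Sum>a\<in>UNIV. \<Sum>c\<in>UNIV. G $ a $ c * Q a b c d) = 0" for b d
  proof -
    have "(\<Sum>a\<in>UNIV. \<Sum>c\<in>UNIV. G $ a $ c * Q a b c d)
      = (\<Sum>a\<in>UNIV. \<Sum>c\<in>UNIV. \<Sum>m\<in>UNIV. \<Sum>r\<in>UNIV. (\<Theta> $ a $ r * G $ a $ c * e c $ m) *
          (\<Sum>n\<in>UNIV. \<Sum>s\<in>UNIV. curv m n x $ s $ r * (e b $ s * e d $ n)))"
    proof (intro sum.cong refl)
      fix a c
      have "Q a b c d = (\<Sum>m\<in>UNIV. \<Sum>n\<in>UNIV. \<Sum>s\<in>UNIV. \<Sum>r\<in>UNIV. \<Theta> $ a $ r * e c $ m * (curv m n x $ s $ r * (e b $ s * e d $ n)))"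
        unfolding Q_def ip_e by (simp add: sum_distrib_left mult_ac)
      also have "\<dots> = (\<Sum>m\<in>UNIV. \<Sum>r\<in>UNIV. \<Sum>n\<in>UNIV. \<Sum>s\<in>UNIV. \<Theta> $ a $ r * e c $ m * (curv m n x $ s $ r * (e b $ s * e d $ n)))"
        by (rule sum.cong[OF refl], rule rot3)
      finally show "G $ a $ c * Q a b c d = (\<Sum>m\<in>UNIV. \<Sum>r\<in>UNIV. (\<Theta> $ a $ r * G $ a $ c * e c $ m) *
          (\<Sum>n\<in>UNIV. \<Sum>s\<in>UNIV. curv m n x $ s $ r * (e b $ s * e d $ n)))"
        by (simp add: sum_distrib_left mult_ac)
    qed
    also have "\<dots> = (\<Sum>m\<in>UNIV. \<Sum>r\<in>UNIV. (\<Sum>a\<in>UNIV. \<Sum>c\<in>UNIV. \<Theta> $ a $ r * G $ a $ c * e c $ m) *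
          (\<Sum>n\<in>UNIV. \<Sum>s\<in>UNIV. curv m n x $ s $ r * (e b $ s * e d $ n)))"
    proof -
      have sw: "(\<Sum>a\<in>UNIV. \<Sum>c\<in>UNIV. \<Sum>m\<in>UNIV. \<Sum>r\<in>UNIV. f a c m r * v m r)
        = (\<Sum>m\<in>UNIV. \<Sum>r\<in>UNIV. (\<Sum>a\<in>UNIV. \<Sum>c\<in>UNIV. f a c m r) * v m r)"
        for f :: "4 \<Rightarrow> 4 \<Rightarrow> 4 \<Rightarrow> 4 \<Rightarrow> real" and v
      proof -
        have "(\<Sum>a\<in>UNIV. \<Sum>c\<in>UNIV. \<Sum>m\<in>UNIV. \<Sum>r\<in>UNIV. f a c m r * v m r)
          = (\<Sum>a\<in>UNIV. \<Sum>m\<in>UNIV. \<Sum>r\<in>UNIV. \<Sum>c\<in>UNIV. f a c m r * v m r)"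
          by (rule sum.cong[OF refl], rule rot3[symmetric])
        also have "\<dots> = (\<Sum>m\<in>UNIV. \<Sum>r\<in>UNIV. \<Sum>a\<in>UNIV. \<Sum>c\<in>UNIV. f a c m r * v m r)"
          by (rule rot3[symmetric])
        finally show ?thesis by (simp add: sum_distrib_right)
      qed
      show ?thesis by (rule sw)
    qed
    also have "\<dots> = (\<Sum>m\<in>UNIV. \<Sum>r\<in>UNIV. (if r = m then 1 else 0) *
          (\<Sum>n\<in>UNIV. \<Sum>s\<in>UNIV. curv m n x $ s $ r * (e b $ s * e d $ n)))"
      by (simp only: delta)
    also have "\<dots> = (\<Sum>m\<in>UNIV. \<Sum>n\<in>UNIV. \<Sum>s\<in>UNIV. curv m n x $ s $ m * (e b $ s * e d $ n))"
      by (simp add: if_distrib[of "\<lambda>c. c * _"] cong: if_cong)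
    also have "\<dots> = (\<Sum>n\<in>UNIV. \<Sum>s\<in>UNIV. (\<Sum>m\<in>UNIV. curv m n x $ s $ m) * (e b $ s * e d $ n))"
      by (subst rot3[symmetric]) (simp add: sum_distrib_right)
    finally show ?thesis by (simp add: curv_ricci[OF x])
  qed
  \<comment> \<open>The entries of \<open>G\<close> in row or column 1 meet components of
    \<open>Q\<close> with an index 1, which vanish. The remaining coefficient p / d plays the part
    of \<kappa> and is zero exactly for null b.\<close>
  have Q_ric: "(p / d) * Q 2 b 2 d' + Q 3 b 3 d' + Q 4 b 4 d' = 0" for b d'
  proof -
    have "Q 2 b 1 d' = Q 1 d' 2 b"
      by (rule curvature_like_pair_symmetry[of Q, OF Q_antisym1 Q_antisym2 Q_bianchi])
    then show ?thesis
      using ric_sum[of b d'] Q_1 by (simp add: sum_4 G_def block_gram_def)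
  qed
  note Q0 = curvature_like_vanishing[OF Q_antisym1 Q_antisym2 Q_bianchi Q_1 Q_ric]
  \<comment> \<open>The vectors \<open>e c\<close> form a basis, so vanishing on all pairs of them
    gives vanishing in the coordinate slots m, n.\<close>
  have inj: "ip x (curv m n x *v \<Theta> $ a) (\<Theta> $ b) = 0" if "\<And>c d. Q a b c d = 0" for a b m n
  proof -
    define B where "B = (\<chi> m n. ip x (curv m n x *v \<Theta> $ a) (\<Theta> $ b))"
    have "(\<Theta> ** h x ** B ** transpose (\<Theta> ** h x)) $ c $ d = Q a b c d" for c d
    proof -
      have "(\<Theta> ** h x ** B ** transpose (\<Theta> ** h x)) $ c $ d
          = (\<Sum>n\<in>UNIV. (\<Sum>m\<in>UNIV. e c $ m * B $ m $ n) * e d $ n)"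
        by (subst matrix_matrix_mult_def, subst matrix_matrix_mult_def) (simp add: Th transpose_def)
      also have "\<dots> = (\<Sum>m\<in>UNIV. \<Sum>n\<in>UNIV. e c $ m * B $ m $ n * e d $ n)"
        by (subst sum.swap) (simp add: sum_distrib_right)
      finally show ?thesis by (simp add: Q_def B_def mult_ac)
    qed
    then have "\<Theta> ** h x ** B ** transpose (\<Theta> ** h x) = 0"
      using that by (simp add: vec_eq_iff)
    then have "(transpose \<Theta> ** G) ** (\<Theta> ** h x ** B ** transpose (\<Theta> ** h x)) ** transpose (transpose \<Theta> ** G) = 0"
      by simp
    moreover have "(transpose \<Theta> ** G) ** (\<Theta> ** h x ** B ** transpose (\<Theta> ** h x)) ** transpose (transpose \<Theta> ** G)
      = (transpose \<Theta> ** G ** (\<Theta> ** h x)) ** B ** transpose (transpose \<Theta> ** G ** (\<Theta> ** h x))"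
      unfolding matrix_transpose_mul[of "transpose \<Theta> ** G" "\<Theta> ** h x"] by (simp only: matrix_mul_assoc)
    ultimately have "B = 0" by (simp add: TGTh transpose_mat)
    then show ?thesis by (simp add: B_def vec_eq_iff)
  qed
  show "ip x (curv m n x *v \<Theta> $ 3) (\<Theta> $ 4) = 0"
    by (rule inj) (rule Q0(1))
  show "curv m n x = 0" if "p \<noteq> 0"
  proof -
    have z: "ip x (curv m n x *v \<Theta> $ a) (\<Theta> $ b) = 0" for a b
      by (rule inj, rule Q0(2)) (use that T(3) in \<open>simp add: d_def\<close>)
    \<comment> \<open>The rows are the images of the coframe under the curvature. They are
      orthogonal to the whole coframe, hence zero.\<close>
    define M where "M = \<Theta> ** transpose (curv m n x)"
    have "M $ a = curv m n x *v \<Theta> $ a" for a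
      by (simp add: M_def vec_eq_iff matrix_matrix_mult_def matrix_vector_mult_def transpose_def mult.commute)
    then have "(M ** h x ** transpose \<Theta>) $ a $ b = 0" for a b
      using z by (simp add: gram_nth)
    then have 0: "M ** (h x ** transpose \<Theta>) = 0" by (simp add: vec_eq_iff matrix_mul_assoc)
    have "\<Theta> ** (h x ** transpose \<Theta> ** G) = mat 1"
      using T(3) block_gram_inverse[OF T(3)] T(2) by (simp add: matrix_mul_assoc G_def d_def)
    then have 1: "h x ** transpose \<Theta> ** G ** \<Theta> = mat 1"
      using matrix_left_right_inverse by blast
    have "M = M ** (h x ** transpose \<Theta>) ** (G ** \<Theta>)"
      using 1 by (metis matrix_mul_assoc matrix_mul_rid)
    then have M0: "M = 0" using 0 by simp
    have "transpose (curv m n x) = (h x ** transpose \<Theta> ** G) ** M"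
      unfolding M_def using 1 by (simp add: matrix_mul_assoc)
    then have "transpose (curv m n x) = 0" using M0 by simp
    then show ?thesis by (simp add: vec_eq_iff transpose_def)
  qed
qed

end


section \<open>Adapted coordinates\<close>

lemma constant_on_ball:
  fixes f :: "real^4 \<Rightarrow> 'b::real_normed_vector"
  assumes "smooth_on (ball c r) f" "\<And>x i. x \<in> ball c r \<Longrightarrow> pd i f x = 0" "x \<in> ball c r"
  shows "f x = f c"
proof -
  have "(f has_derivative (\<lambda>h. 0)) (at y within ball c r)" if "y \<in> ball c r" for y
    using has_derivative_at_withinI[OF has_derivative_pd[OF smooth_on_differentiable[OF assms(1) that]]]
    by (simp add: assms(2)[OF that])
  then obtain k where "\<And>y. y \<in> ball c r \<Longrightarrow> f y = k"
    using has_derivative_zero_constant[OF convex_ball, of c r f] by blast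
  moreover have "c \<in> ball c r" using assms(3) by (auto intro: le_less_trans[OF zero_le_dist])
  ultimately show ?thesis using assms(3) by simp
qed

context lorentz_chart
begin

lemma ip_constant:
  assumes "ball c r \<subseteq> W" "smooth_on (ball c r) Y" "smooth_on (ball c r) Z"
    "\<And>x i. x \<in> ball c r \<Longrightarrow> cov i Y x = 0" "\<And>x i. x \<in> ball c r \<Longrightarrow> cov i Z x = 0" "x \<in> ball c r"
  shows "ip x (Y x) (Z x) = ip c (Y c) (Z c)"
proof (rule constant_on_ball[of c r "\<lambda>x. ip x (Y x) (Z x)"])
  show "smooth_on (ball c r) (\<lambda>x. ip x (Y x) (Z x))"
    by (rule smooth_ip[OF open_ball assms(1-3)])
  fix y i assume y: "y \<in> ball c r"
  have "y \<in> W" using y assms(1) by blast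
  from pd_ip[OF this smooth_on_differentiable[OF assms(2) y] smooth_on_differentiable[OF assms(3) y], of i]
  show "pd i (\<lambda>x. ip x (Y x) (Z x)) y = 0" by (simp add: assms(4,5)[OF y] ip_simps)
qed (rule assms)

text \<open>At a maximum y of the norm of \<beta> on a small closed ball, the mean value bound from
  the zero x0 gives |\<beta> y| \<le> 4 M r |\<beta> y|, the 4 counting coordinates. The choice of r
  makes the factor at most 1/2, so \<beta> vanishes on the ball.\<close>

lemma parallel_zero_locally:
  assumes x0: "x0 \<in> W" "\<beta> x0 = 0"
  obtains r where "r > 0" "ball x0 r \<subseteq> W" "\<And>x. x \<in> ball x0 r \<Longrightarrow> \<beta> x = 0"
proof -
  obtain R where R: "R > 0" "cball x0 R \<subseteq> W" using open_W x0(1) open_contains_cball by blast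
  have "continuous_on (cball x0 R) (C i)" for i
    by (rule continuous_on_subset[OF smooth_on_continuous[OF smooth_C] R(2)])
  then obtain M where M: "M > 0" and CM: "\<And>i x y. x \<in> cball x0 R \<Longrightarrow> norm (C i x *v y) \<le> M * norm y"
    by (rule matrix_fields_bounded[of "cball x0 R" C, OF compact_cball]) blast
  define r where "r = min R (1 / (8 * M))"
  have r: "r > 0" "r \<le> R" using R M by (auto simp: r_def)
  have rM: "8 * M * r \<le> 1"
  proof -
    have "r \<le> 1 / (8 * M)" by (simp add: r_def)
    then show ?thesis using M by (simp add: field_simps)
  qed
  have sub: "cball x0 r \<subseteq> cball x0 R" using r by auto
  have "continuous_on (cball x0 r) (\<lambda>x. norm (\<beta> x))"
    by (intro continuous_intros continuous_on_subset[OF smooth_on_continuous[OF smooth_\<beta>]]) (use sub R in blast)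
  then obtain y where y: "y \<in> cball x0 r" "\<And>x. x \<in> cball x0 r \<Longrightarrow> norm (\<beta> x) \<le> norm (\<beta> y)"
    using continuous_attains_sup[of "cball x0 r" "\<lambda>x. norm (\<beta> x)"] r by auto
  have "norm (\<beta> y - \<beta> x0) \<le> (4 * (M * norm (\<beta> y))) * norm (y - x0)"
  proof (rule differentiable_bound[where S = "cball x0 r"])
    fix x assume x: "x \<in> cball x0 r"
    then have xR: "x \<in> cball x0 R" and xW: "x \<in> W" using sub R by auto
    have pd\<beta>: "pd i \<beta> x = C i x *v \<beta> x" for i using cov_\<beta>[OF xW, of i] by (simp add: cov_def)
    show "(\<beta> has_derivative (\<lambda>v. \<Sum>i\<in>UNIV. v $ i *\<^sub>R (C i x *v \<beta> x))) (at x within cball x0 r)"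
      using has_derivative_at_withinI[OF has_derivative_pd[OF smooth_on_differentiable[OF smooth_\<beta> xW]]]
      by (simp add: pd\<beta>)
    show "onorm (\<lambda>v. \<Sum>i\<in>UNIV. v $ i *\<^sub>R (C i x *v \<beta> x)) \<le> 4 * (M * norm (\<beta> y))"
    proof (rule onorm_le)
      fix v :: "real^4"
      have "norm (v $ i *\<^sub>R (C i x *v \<beta> x)) \<le> norm v * (M * norm (\<beta> y))" for i
      proof -
        have "norm (C i x *v \<beta> x) \<le> M * norm (\<beta> x)" by (rule CM[OF xR])
        also have "\<dots> \<le> M * norm (\<beta> y)" using y(2)[OF x] M by simp
        finally show ?thesis using component_le_norm_cart[of v i] by (auto intro!: mult_mono)
      qed
      then have "norm (\<Sum>i\<in>UNIV. v $ i *\<^sub>R (C i x *v \<beta> x))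
          \<le> of_nat (card (UNIV :: 4 set)) * (norm v * (M * norm (\<beta> y)))"
        by (intro sum_norm_bound) auto
      then show "norm (\<Sum>i\<in>UNIV. v $ i *\<^sub>R (C i x *v \<beta> x)) \<le> 4 * (M * norm (\<beta> y)) * norm v"
        by (simp add: mult_ac)
    qed
  qed (use y r in auto)
  also have "\<dots> \<le> (4 * (M * norm (\<beta> y))) * r"
    using y(1) M by (intro mult_left_mono) (auto simp: dist_norm norm_minus_commute)
  also have "\<dots> = (8 * M * r) * (norm (\<beta> y) / 2)" by simp
  also have "\<dots> \<le> 1 * (norm (\<beta> y) / 2)" using rM by (intro mult_right_mono) auto
  finally have "norm (\<beta> y) = 0" using x0(2) norm_ge_zero[of "\<beta> y"] by simp
  then have "\<beta> x = 0" if "x \<in> ball x0 r" for x using y(2)[of x] that by auto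
  then show ?thesis using that r R sub by (metis ball_subset_cball order_trans)
qed

text \<open>In a coframe the metric is expressed by the inverse of the Gram matrix of covectors; the
  normal forms needed here are their own inverses.\<close>

lemma gram_imp_metric:
  fixes \<Theta> N :: "real^4^4"
  assumes x: "x \<in> W" and "\<Theta> ** h x ** transpose \<Theta> = N" "N ** N = mat 1"
  shows "transpose \<Theta> ** N ** \<Theta> = g x"
proof -
  have "\<Theta> ** (h x ** transpose \<Theta> ** N) = mat 1" using assms(2,3) by (simp add: matrix_mul_assoc)
  then have "h x ** transpose \<Theta> ** N ** \<Theta> = mat 1" by (rule iffD1[OF matrix_left_right_inverse])
  then have "g x ** (h x ** transpose \<Theta> ** N ** \<Theta>) = g x" by simp
  then show ?thesis by (simp add: matrix_mul_assoc g_h[OF x])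
qed

text \<open>With \<open>I\<close> the complement of {1} this is the Poincare lemma on hypersurfaces
  of constant first coordinate, with that coordinate as a smooth parameter.\<close>

lemma coframe_closed_imp_exact:
  assumes "ball c r \<subseteq> W" "smooth_on (ball c r) Y"
    "\<And>x i j. x \<in> ball c r \<Longrightarrow> i \<in> I \<Longrightarrow> j \<in> I \<Longrightarrow> cov i Y x $ j = cov j Y x $ i"
  obtains f where "smooth_on (ball c r) f" "\<And>x i. x \<in> ball c r \<Longrightarrow> i \<in> I \<Longrightarrow> pd i f x = Y x $ i"
proof -
  obtain f where "smooth_on (ball c r) f" "\<And>i x. i \<in> I \<Longrightarrow> x \<in> ball c r \<Longrightarrow> pd i f x = Y x $ i"
  proof (rule poincare_slice[of c r "\<lambda>j x. Y x $ j" I])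
    show "smooth_on (ball c r) (\<lambda>x. Y x $ j)" for j by (intro smooth_on_vec_nth assms(2)) auto
    show "pd i (\<lambda>x. Y x $ j) x = pd j (\<lambda>x. Y x $ i) x" if "i \<in> I" "j \<in> I" "x \<in> ball c r" for i j x
    proof -
      have "x \<in> W" using that assms(1) by blast
      from cov_antisym[OF this smooth_on_differentiable[OF assms(2) that(3)], of i j] assms(3)[OF that(3,1,2)]
      show ?thesis by simp
    qed
  qed blast
  then show ?thesis using that by blast
qed

lemma flat_coordinates:
  assumes x0: "x0 \<in> W" "ip x0 (\<beta> x0) (\<beta> x0) \<noteq> 0"
  obtains r \<Phi> k where "r > 0" "ball x0 r \<subseteq> W" "smooth_on (ball x0 r) \<Phi>"
    "\<And>x. x \<in> ball x0 r \<Longrightarrow> transpose (jacobian_matrix \<Phi> x) ** minkowski ** jacobian_matrix \<Phi> x = g x"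
    "\<And>x. x \<in> ball x0 r \<Longrightarrow> \<beta> x = transpose (jacobian_matrix \<Phi> x) *v k"
proof -
  obtain R where R: "R > 0" "ball x0 R \<subseteq> W" using open_W x0(1) open_contains_ball by blast
  have cov\<beta>: "cov i \<beta> x = 0" if "x \<in> ball x0 R" for i x
    using cov_\<beta> R(2) that by blast
  have flat: "curv m n x = 0" if x: "x \<in> ball x0 R" for m n x
  proof -
    have xW: "x \<in> W" using x R by blast
    have n: "ip x (\<beta> x) (\<beta> x) \<noteq> 0"
      using ip_constant[OF R(2) smooth_on_subset[OF smooth_\<beta> R(2)] smooth_on_subset[OF smooth_\<beta> R(2)] cov\<beta> cov\<beta> x]
        x0(2) by simp
    then have "\<beta> x \<noteq> 0" by (auto simp: ip_simps)
    then obtain \<Theta> p q s where T: "\<Theta> $ 1 = \<beta> x" "\<Theta> ** h x ** transpose \<Theta> = block_gram p q s" "p * s - q\<^sup>2 \<noteq> 0"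
      by (rule adapted_coframe[OF xW]) blast
    have "block_gram p q s $ 1 $ 1 = ip x (\<beta> x) (\<beta> x)"
      unfolding T(2)[symmetric] gram_nth T(1) ..
    then have "p \<noteq> 0" using n by (simp add: block_gram_def)
    then show ?thesis by (rule curvature_in_coframe(2)[OF xW T])
  qed
  obtain r where r: "0 < r" "r \<le> R"
    "\<And>y0. \<exists>Y. smooth_on (ball x0 r) Y \<and> Y x0 = y0 \<and> (\<forall>x\<in>ball x0 r. \<forall>i. pd i Y x = C i x *v Y x)"
  proof (rule flat_linear_system[of R x0 C])
    show "smooth_on (ball x0 R) (C i)" for i by (rule smooth_on_subset[OF smooth_C R(2)])
    show "pd i (C j) x + C j x ** C i x = pd j (C i) x + C i x ** C j x" if "x \<in> ball x0 R" for x i j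
      using flat[OF that, of i j] by (simp add: curv_def algebra_simps)
  qed (use R in auto)
  have sub: "ball x0 r \<subseteq> W" using r R by (meson order_trans subset_ball)
  obtain \<Theta> where \<Theta>: "\<Theta> ** h x0 ** transpose \<Theta> = minkowski" by (rule orthonormal_coframe[OF x0(1)])
  obtain Y where Y: "\<And>a. smooth_on (ball x0 r) (Y a)" "\<And>a. Y a x0 = \<Theta> $ a"
    "\<And>a x i. x \<in> ball x0 r \<Longrightarrow> pd i (Y a) x = C i x *v Y a x"
    using r(3)[of "\<Theta> $ a" for a] by metis
  have covY: "cov i (Y a) x = 0" if "x \<in> ball x0 r" for i a x
    using Y(3)[OF that] by (simp add: cov_def)
  have "\<exists>f. smooth_on (ball x0 r) f \<and> (\<forall>x\<in>ball x0 r. \<forall>i. pd i f x = Y a x $ i)" for a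
    by (rule coframe_closed_imp_exact[OF sub Y(1), of UNIV a]) (auto simp: covY)
  then obtain f where f: "\<And>a. smooth_on (ball x0 r) (f a)" "\<And>a x i. x \<in> ball x0 r \<Longrightarrow> pd i (f a) x = Y a x $ i"
    by metis
  define \<Phi> where "\<Phi> x = (\<chi> a. f a x)" for x
  have J: "jacobian_matrix \<Phi> x $ a = Y a x" if "x \<in> ball x0 r" for x a
    using f(2)[OF that] by (simp add: jacobian_matrix_def \<Phi>_def vec_eq_iff)
  \<comment> \<open>The products of \<beta> with a parallel coframe are constant;
    \<open>minkowski\<close> turns them into the components of \<beta> in that coframe.\<close>
  define k where "k = minkowski *v (\<chi> a. ip x0 (Y a x0) (\<beta> x0))"
  show ?thesis
  proof (rule that[OF r(1) sub, of \<Phi> k])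
    show "smooth_on (ball x0 r) \<Phi>" unfolding \<Phi>_def[abs_def] by (intro smooth_on_vec_lambda f) auto
    fix x assume x: "x \<in> ball x0 r"
    have xW: "x \<in> W" using x sub by blast
    let ?J = "jacobian_matrix \<Phi> x"
    have "ip x (Y a x) (Y b x) = minkowski $ a $ b" for a b
      using ip_constant[OF sub Y(1) Y(1) covY covY x, of a b] \<Theta> by (simp add: Y(2) gram_nth[symmetric])
    then have "?J ** h x ** transpose ?J = minkowski" by (simp add: vec_eq_iff[of _ minkowski] vec_eq_iff[of _ "minkowski $ _"] gram_nth J[OF x])
    then show g: "transpose ?J ** minkowski ** ?J = g x"
      by (rule gram_imp_metric[OF xW _ minkowski_square])
    have "?J *v (h x *v \<beta> x) = (\<chi> a. ip x0 (Y a x0) (\<beta> x0))"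
    proof -
      have "ip x (Y a x) (\<beta> x) = ip x0 (Y a x0) (\<beta> x0)" for a
        by (rule ip_constant[OF sub Y(1) smooth_on_subset[OF smooth_\<beta> sub] covY _ x])
          (use sub cov_\<beta> in blast)+
      then show ?thesis by (simp add: vec_eq_iff matrix_vector_mul_component J[OF x] ip_def)
    qed
    then have "transpose ?J *v k = (transpose ?J ** minkowski ** ?J) *v (h x *v \<beta> x)"
      unfolding k_def by (simp only: matrix_vector_mul_assoc[symmetric])
    also have "\<dots> = \<beta> x" unfolding g by (simp add: matrix_vector_mul_assoc g_h[OF xW])
    finally show "\<beta> x = transpose ?J *v k" ..
  qed
qed

text \<open>The preliminary change of coordinates: b becomes a coordinate differential throughout,
  but the metric is normalised at x0 only. That is enough for the coordinate covectors to serve as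
  the start of an orthogonalisation.\<close>

lemma null_coordinate:
  assumes x0: "x0 \<in> W" "\<beta> x0 \<noteq> 0" "ip x0 (\<beta> x0) (\<beta> x0) = 0"
  obtains r \<Phi> where "r > 0" "ball x0 r \<subseteq> W" "smooth_on (ball x0 r) \<Phi>"
    "\<And>x. x \<in> ball x0 r \<Longrightarrow> jacobian_matrix \<Phi> x $ 1 = \<beta> x"
    "transpose (jacobian_matrix \<Phi> x0) ** block_gram 0 (-1) 0 ** jacobian_matrix \<Phi> x0 = g x0"
proof -
  obtain r where r: "r > 0" "ball x0 r \<subseteq> W" using open_W x0(1) open_contains_ball by blast
  obtain \<Theta> p q s where T: "\<Theta> $ 1 = \<beta> x0" "\<Theta> ** h x0 ** transpose \<Theta> = block_gram p q s"
    "p = 0 \<Longrightarrow> q = -1 \<and> s = 0"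
    by (rule adapted_coframe[OF x0(1,2)]) blast
  have "block_gram p q s $ 1 $ 1 = ip x0 (\<beta> x0) (\<beta> x0)"
    unfolding T(2)[symmetric] gram_nth T(1) ..
  then have "p = 0" using x0(3) by (simp add: block_gram_def)
  then have T2: "\<Theta> ** h x0 ** transpose \<Theta> = block_gram 0 (-1) 0" using T(2,3) by simp
  obtain u where u: "smooth_on (ball x0 r) u" "\<And>x i. x \<in> ball x0 r \<Longrightarrow> pd i u x = \<beta> x $ i"
    by (rule coframe_closed_imp_exact[OF r(2) smooth_on_subset[OF smooth_\<beta> r(2)], of UNIV])
      (use cov_\<beta> r(2) in \<open>auto simp: subset_iff\<close>)
  \<comment> \<open>The linear map \<Theta> with its first component, which is the differential of
    \<open>u\<close> at x0, replaced by \<open>u\<close> itself. The first row of the Jacobian is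
    then b everywhere, while at x0 the Jacobian is \<Theta>.\<close>
  define \<Phi> where "\<Phi> x = \<Theta> *v x + (u x - \<beta> x0 \<bullet> x) *\<^sub>R axis 1 1" for x
  have sm: "smooth_on (ball x0 r) \<Phi>"
    unfolding \<Phi>_def[abs_def]
    by (intro smooth_on_add smooth_on_scaleR smooth_on_diff smooth_on_const u smooth_on_inner smooth_on_ident
        smooth_on_matrix_vector) auto
  have J: "jacobian_matrix \<Phi> x $ a = \<Theta> $ a + (if a = 1 then \<beta> x - \<beta> x0 else 0)" if x: "x \<in> ball x0 r" for x a
  proof -
    have "\<Phi> z $ a = \<Theta> $ a \<bullet> z + (if a = 1 then u z - \<beta> x0 \<bullet> z else 0)" for z
      by (simp add: \<Phi>_def matrix_vector_mul_component axis_one_nth)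
    moreover have "pd i (\<lambda>z. v \<bullet> z) x = v $ i" for v i
      using pd_linear[OF bounded_linear_inner_right, of "\<lambda>x. x" x i v] by (simp add: pd_def inner_axis)
    moreover have "u differentiable (at x)" "(\<lambda>z. v \<bullet> z) differentiable (at x)" for v
      using smooth_on_differentiable[OF u(1) x] bounded_linear_imp_differentiable[OF bounded_linear_inner_right] by auto
    ultimately show ?thesis
      using u(2)[OF x] by (simp add: jacobian_matrix_def vec_eq_iff pd_add pd_diff)
  qed
  have "jacobian_matrix \<Phi> x0 = \<Theta>" using J[of x0] r by (simp add: vec_eq_iff)
  then show ?thesis
    using that[OF r sm] J T(1) gram_imp_metric[OF x0(1) T2 block_gram_pp_square] by simp
qed

end


lemma smooth_positive_near:
  assumes "smooth_on (ball c r) f" "0 < r" "0 < (f c :: real)"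
  obtains r' where "0 < r'" "r' \<le> r" "\<And>x. x \<in> ball c r' \<Longrightarrow> 0 < f x"
proof -
  have "open ({x. 0 < f x} \<inter> ball c r)"
  proof -
    have "{x \<in> ball c r. f x \<in> {0<..}} = {x. 0 < f x} \<inter> ball c r" by auto
    then show ?thesis
      using continuous_open_preimage[OF smooth_on_continuous[OF assms(1)] open_ball, of "{0<..}"]
      by (simp add: vimage_def Int_def conj_commute)
  qed
  moreover have "c \<in> {x. 0 < f x} \<inter> ball c r" using assms by auto
  ultimately obtain e where e: "e > 0" "ball c e \<subseteq> {x. 0 < f x} \<inter> ball c r"
    using open_contains_ball by blast
  show ?thesis by (rule that[of "min e r"]) (use e assms in auto)
qed

lemma pd_real_compose:
  fixes f :: "real \<Rightarrow> real"
  assumes "(f has_real_derivative D) (at (u x))" "u differentiable (at x)"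
  shows "pd i (\<lambda>z. f (u z)) x = D * pd i u x"
proof -
  have "((\<lambda>z. f (u z)) has_derivative (\<lambda>v. D * frechet_derivative u (at x) v)) (at x)"
    using has_derivative_compose[OF frechet_derivative_works[THEN iffD1, OF assms(2)]
        assms(1)[unfolded has_field_derivative_def]] .
  from pd_eqI[OF this] show ?thesis by (simp add: pd_def)
qed

lemma block_gram_sandwich:
  "(transpose M ** block_gram p q s ** M) $ i $ j =
    p * (M $ 1 $ i * M $ 1 $ j) + q * (M $ 1 $ i * M $ 2 $ j + M $ 2 $ i * M $ 1 $ j)
    + s * (M $ 2 $ i * M $ 2 $ j) + M $ 3 $ i * M $ 3 $ j + M $ 4 $ i * M $ 4 $ j"
  by (simp add: matrix_matrix_mult_def sum_4 block_gram_def transpose_def algebra_simps)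

lemma second_deriv_along:
  fixes f :: "real^4 \<Rightarrow> real"
  assumes W: "open W" and f: "smooth_on W f" and z: "z + t *\<^sub>R axis i 1 \<in> W"
  shows "(deriv ^^ 2) (\<lambda>s. f (z + s *\<^sub>R axis i 1)) t = pd i (pd i f) (z + t *\<^sub>R axis i 1)"
proof -
  have d: "deriv (\<lambda>s. k (z + s *\<^sub>R axis i 1)) s = pd i k (z + s *\<^sub>R axis i 1)"
    if "z + s *\<^sub>R axis i 1 \<in> W" "smooth_on W k" for s and k :: "real^4 \<Rightarrow> real"
    using has_vector_derivative_pd[OF smooth_on_differentiable[OF that(2,1)], of UNIV]
    by (auto intro!: DERIV_imp_deriv simp: has_real_derivative_iff_has_vector_derivative)
  have "open ((\<lambda>s. z + s *\<^sub>R axis i 1) -` W)"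
    by (rule open_vimage[OF W]) (auto intro!: continuous_intros)
  then have "\<forall>\<^sub>F s in nhds t. s \<in> (\<lambda>s. z + s *\<^sub>R axis i 1) -` W"
    using z by (intro eventually_nhds_in_open) auto
  then have "\<forall>\<^sub>F s in nhds t. deriv (\<lambda>s. f (z + s *\<^sub>R axis i 1)) s = pd i f (z + s *\<^sub>R axis i 1)"
    by eventually_elim (use d[OF _ f] in auto)
  then have "deriv (deriv (\<lambda>s. f (z + s *\<^sub>R axis i 1))) t = deriv (\<lambda>s. pd i f (z + s *\<^sub>R axis i 1)) t"
    by (intro deriv_cong_ev refl)
  also have "\<dots> = pd i (pd i f) (z + t *\<^sub>R axis i 1)"
    by (rule d[OF z smooth_on_pd[OF f]])
  finally show ?thesis by (simp add: numeral_2_eq_2)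
qed

section \<open>Coordinates adapted to a null parallel form\<close>

context lorentz_chart
begin

text \<open>The off-diagonal block exchanges b and \<psi>: the coefficient along one of them is
  minus the product with the other.\<close>

lemma coframe_expansion:
  assumes x: "x \<in> W"
    and T: "vector [b, \<psi>, e, e'] ** h x ** transpose (vector [b, \<psi>, e, e']) = block_gram 0 (-1) 0"
  shows "Z = - ip x Z \<psi> *\<^sub>R b - ip x Z b *\<^sub>R \<psi> + ip x Z e *\<^sub>R e + ip x Z e' *\<^sub>R e'"
proof -
  let ?T = "vector [b, \<psi>, e, e'] :: real^4^4"
  have g: "g x = transpose ?T ** block_gram 0 (-1) 0 ** ?T"
    by (rule gram_imp_metric[OF x T block_gram_pp_square, symmetric])
  have "Z $ i = - ip x Z \<psi> * b $ i - ip x Z b * \<psi> $ i + ip x Z e * e $ i + ip x Z e' * e' $ i" for i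
  proof -
    have ipZ: "ip x Z Y = (\<Sum>j\<in>UNIV. Y $ j * (h x *v Z) $ j)" for Y
      using ip_commute[OF x, of Z Y] by (simp add: ip_def inner_vec_def)
    have "Z $ i = (g x *v (h x *v Z)) $ i" by (simp add: matrix_vector_mul_assoc g_h[OF x])
    also have "\<dots> = (\<Sum>j\<in>UNIV. g x $ i $ j * (h x *v Z) $ j)"
      by (simp only: matrix_vector_mult_def[of "g x"] vec_lambda_beta)
    also have "\<dots> = - (\<Sum>j\<in>UNIV. \<psi> $ j * (h x *v Z) $ j) * b $ i - (\<Sum>j\<in>UNIV. b $ j * (h x *v Z) $ j) * \<psi> $ i
       + (\<Sum>j\<in>UNIV. e $ j * (h x *v Z) $ j) * e $ i + (\<Sum>j\<in>UNIV. e' $ j * (h x *v Z) $ j) * e' $ i"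
      unfolding g block_gram_sandwich vector_4_nth
      by (simp add: sum.distrib sum_subtractf sum_negf sum_distrib_right sum_distrib_left ring_distribs mult_ac)
    finally show ?thesis by (simp add: ipZ)
  qed
  then show ?thesis by (simp add: vec_eq_iff)
qed

text \<open>Gram-Schmidt, starting from the coordinate covectors at \<open>c\<close>.\<close>

lemma null_gram_schmidt:
  assumes c: "c \<in> W" "g c = block_gram 0 (-1) 0"
    and null: "\<And>x. x \<in> W \<Longrightarrow> ip x (axis 1 1) (axis 1 1) = 0"
  obtains r E3 E4 \<zeta> where "0 < r" "ball c r \<subseteq> W"
    "smooth_on (ball c r) E3" "smooth_on (ball c r) E4" "smooth_on (ball c r) \<zeta>"
    "\<And>x. x \<in> ball c r \<Longrightarrow> ip x (axis 1 1) (E3 x) = 0 \<and> ip x (axis 1 1) (E4 x) = 0 \<and>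
       ip x (E3 x) (E3 x) = 1 \<and> ip x (E4 x) (E4 x) = 1 \<and> ip x (E3 x) (E4 x) = 0 \<and> ip x (\<zeta> x) (axis 1 1) = -1"
proof -
  have hc: "h c = block_gram 0 (-1) 0"
    unfolding h_def by (rule matrix_inv_eqI) (simp add: c(2) block_gram_pp_square)
  have ipc: "ip c (axis i 1) (axis j 1) = block_gram 0 (-1) 0 $ i $ j" for i j
    by (simp add: ip_def hc inner_axis' matrix_vector_mul_component inner_axis)
  obtain R where R: "R > 0" "ball c R \<subseteq> W" using open_W c(1) open_contains_ball by blast
  let ?b = "axis 1 1 :: real^4" and ?e = "axis 2 1 :: real^4"
  have "smooth_on (ball c R) (\<lambda>x. - ip x ?b ?e)"
    by (intro smooth_on_uminus smooth_ip[OF open_ball R(2)] smooth_on_const) auto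
  then obtain r1 where r1: "0 < r1" "r1 \<le> R" "\<And>x. x \<in> ball c r1 \<Longrightarrow> 0 < - ip x ?b ?e"
    by (rule smooth_positive_near) (auto simp: R ipc block_gram_def)
  have s1: "ball c r1 \<subseteq> W" using r1 R by (meson order_trans subset_ball)
  have q: "ip x ?b ?e \<noteq> 0" if "x \<in> ball c r1" for x using r1(3)[OF that] by auto
  \<comment> \<open>Near \<open>c\<close> the second coordinate covector has nonzero product with b.
    Subtracting a multiple of it makes a covector orthogonal to b and leaves the third and fourth
    unchanged at \<open>c\<close>.\<close>
  define F where "F k x = axis k 1 - (ip x ?b (axis k 1) / ip x ?b ?e) *\<^sub>R ?e" for k x
  have smF: "smooth_on (ball c r1) (F k)" for k
    unfolding F_def[abs_def]
    by (intro smooth_on_diff smooth_on_scaleR smooth_on_divide smooth_ip[OF open_ball s1] smooth_on_const q) auto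
  have bF: "ip x ?b (F k x) = 0" if "x \<in> ball c r1" for k x
    using q[OF that] by (simp add: F_def ip_simps)
  have Fc: "F 3 c = axis 3 1" "F 4 c = axis 4 1" by (simp_all add: F_def ipc block_gram_def)
  have "smooth_on (ball c r1) (\<lambda>x. ip x (F 3 x) (F 3 x))"
    by (intro smooth_ip[OF open_ball s1] smF)
  then obtain r2 where r2: "0 < r2" "r2 \<le> r1" "\<And>x. x \<in> ball c r2 \<Longrightarrow> 0 < ip x (F 3 x) (F 3 x)"
    by (rule smooth_positive_near) (auto simp: r1 ipc Fc block_gram_def)
  have s2: "ball c r2 \<subseteq> ball c r1" "ball c r2 \<subseteq> W" using r2 s1 by auto
  define E3 where "E3 x = (1 / sqrt (ip x (F 3 x) (F 3 x))) *\<^sub>R F 3 x" for x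
  have smE3: "smooth_on (ball c r2) E3"
    unfolding E3_def[abs_def]
    by (intro smooth_on_scaleR smooth_on_divide smooth_on_sqrt smooth_ip[OF open_ball s2(2)] smooth_on_const
        smooth_on_subset[OF smF s2(1)] r2(3)) (use r2(3) in force)+
  have E3E3: "ip x (E3 x) (E3 x) = 1" if "x \<in> ball c r2" for x
    using r2(3)[OF that] by (simp add: E3_def ip_simps field_simps)
  have bE3: "ip x ?b (E3 x) = 0" if "x \<in> ball c r2" for x
    using bF s2 that by (auto simp: E3_def ip_simps)
  have E3c: "E3 c = axis 3 1" by (simp add: E3_def Fc ipc block_gram_def)
  define F' where "F' x = F 4 x - ip x (F 4 x) (E3 x) *\<^sub>R E3 x" for x
  have smF': "smooth_on (ball c r2) F'"
    unfolding F'_def[abs_def]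
    by (intro smooth_on_diff smooth_on_scaleR smooth_ip[OF open_ball s2(2)] smooth_on_subset[OF smF s2(1)] smE3) auto
  have F'c: "F' c = axis 4 1" by (simp add: F'_def Fc E3c ipc block_gram_def)
  have "smooth_on (ball c r2) (\<lambda>x. ip x (F' x) (F' x))"
    by (intro smooth_ip[OF open_ball s2(2)] smF')
  then obtain r3 where r3: "0 < r3" "r3 \<le> r2" "\<And>x. x \<in> ball c r3 \<Longrightarrow> 0 < ip x (F' x) (F' x)"
    by (rule smooth_positive_near) (auto simp: r2 ipc F'c block_gram_def)
  have s3: "ball c r3 \<subseteq> ball c r2" "ball c r3 \<subseteq> W" "ball c r3 \<subseteq> ball c r1" using r3 s2 by auto
  define E4 where "E4 x = (1 / sqrt (ip x (F' x) (F' x))) *\<^sub>R F' x" for x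
  have smE4: "smooth_on (ball c r3) E4"
    unfolding E4_def[abs_def]
    by (intro smooth_on_scaleR smooth_on_divide smooth_on_sqrt smooth_ip[OF open_ball s3(2)] smooth_on_const
        smooth_on_subset[OF smF' s3(1)] r3(3)) (use r3(3) in force)+
  have E4E4: "ip x (E4 x) (E4 x) = 1" if "x \<in> ball c r3" for x
    using r3(3)[OF that] by (simp add: E4_def ip_simps field_simps)
  have bE4: "ip x ?b (E4 x) = 0" if "x \<in> ball c r3" for x
    using bF[of x 4] bE3[of x] s2 s3 that by (auto simp: E4_def F'_def ip_simps subset_iff)
  have E3E4: "ip x (E3 x) (E4 x) = 0" if "x \<in> ball c r3" for x
  proof -
    have "x \<in> W" using that s3 by blast
    then show ?thesis using E3E3[of x] s3 that ip_commute[of x "F 4 x" "E3 x"]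
      by (auto simp: E4_def F'_def ip_simps subset_iff)
  qed
  \<comment> \<open>Raw material for the second null covector: only its product with b is
    normalised, the rest is corrected in \<open>null_completion\<close>.\<close>
  define \<zeta> where "\<zeta> x = (- 1 / ip x ?b ?e) *\<^sub>R ?e" for x
  have sm\<zeta>: "smooth_on (ball c r3) \<zeta>"
    unfolding \<zeta>_def[abs_def]
    by (intro smooth_on_scaleR smooth_on_divide smooth_ip[OF open_ball s3(2)] smooth_on_const q) (use s3 in auto)
  have \<zeta>b: "ip x (\<zeta> x) ?b = -1" if "x \<in> ball c r3" for x
  proof -
    have "x \<in> W" "ip x ?b ?e \<noteq> 0" using that s3 q by blast+
    then show ?thesis using ip_commute[of x ?b ?e] by (simp add: \<zeta>_def ip_simps)
  qed
  show ?thesis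
    by (rule that[of r3 E3 E4 \<zeta>])
      (use r3(1) s3 smE3 smE4 sm\<zeta> bE3 bE4 E3E3 E4E4 E3E4 \<zeta>b in \<open>auto intro: smooth_on_subset\<close>)
qed

text \<open>After removing the components along E3 and E4, adding s b changes the squared length by
  -2 s, because b is null and its product with \<psi>1 is -1. Half the squared length is therefore
  the multiple that makes \<psi> null. The lemma serves twice: for the provisional coframe and for
  the one containing dx and dy.\<close>

lemma null_completion:
  assumes S: "ball c r \<subseteq> W" and sm: "smooth_on (ball c r) E3" "smooth_on (ball c r) E4" "smooth_on (ball c r) \<zeta>"
    and null: "\<And>x. x \<in> W \<Longrightarrow> ip x b b = 0"
    and rel: "\<And>x. x \<in> ball c r \<Longrightarrow> ip x b (E3 x) = 0 \<and> ip x b (E4 x) = 0 \<and>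
       ip x (E3 x) (E3 x) = 1 \<and> ip x (E4 x) (E4 x) = 1 \<and> ip x (E3 x) (E4 x) = 0 \<and> ip x (\<zeta> x) b = -1"
  obtains \<psi> where "smooth_on (ball c r) \<psi>"
    "\<And>x. x \<in> ball c r \<Longrightarrow> vector [b, \<psi> x, E3 x, E4 x] ** h x ** transpose (vector [b, \<psi> x, E3 x, E4 x])
       = block_gram 0 (-1) 0"
proof -
  define \<psi>1 where "\<psi>1 x = \<zeta> x - ip x (\<zeta> x) (E3 x) *\<^sub>R E3 x - ip x (\<zeta> x) (E4 x) *\<^sub>R E4 x" for x
  define \<psi> where "\<psi> x = \<psi>1 x + (ip x (\<psi>1 x) (\<psi>1 x) / 2) *\<^sub>R b" for x
  have sm1: "smooth_on (ball c r) \<psi>1" unfolding \<psi>1_def[abs_def]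
    by (intro smooth_on_diff smooth_on_scaleR smooth_ip[OF open_ball S] sm) auto
  show ?thesis
  proof (rule that)
    show "smooth_on (ball c r) \<psi>" unfolding \<psi>_def[abs_def]
      by (intro smooth_on_add smooth_on_scaleR smooth_on_divide smooth_ip[OF open_ball S] sm1 smooth_on_const) auto
    fix x assume x: "x \<in> ball c r"
    then have xW: "x \<in> W" using S by blast
    note com = ip_commute[OF xW]
    have r1: "ip x b (E3 x) = 0" "ip x b (E4 x) = 0" "ip x (E3 x) (E3 x) = 1" "ip x (E4 x) (E4 x) = 1"
      "ip x (E3 x) (E4 x) = 0" "ip x (\<zeta> x) b = -1"
      using rel[OF x] by auto
    have r2: "ip x (E3 x) b = 0" "ip x (E4 x) b = 0" "ip x (E4 x) (E3 x) = 0" "ip x b (\<zeta> x) = -1" "ip x b b = 0"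
      using r1 com[of "E3 x" b] com[of "E4 x" b] com[of "E4 x" "E3 x"] com[of b "\<zeta> x"] null[OF xW] by auto
    have 1: "ip x (\<psi>1 x) b = -1" "ip x b (\<psi>1 x) = -1" "ip x (\<psi>1 x) (E3 x) = 0" "ip x (\<psi>1 x) (E4 x) = 0"
      unfolding \<psi>1_def using r1 r2 com[of "E3 x" "\<zeta> x"] by (simp_all add: ip_simps)
    have 2: "ip x (\<psi> x) b = -1" "ip x (\<psi> x) (E3 x) = 0" "ip x (\<psi> x) (E4 x) = 0" "ip x (\<psi> x) (\<psi> x) = 0"
      unfolding \<psi>_def using r1 r2 1 by (simp_all add: ip_simps)
    have 3: "ip x b (\<psi> x) = -1" "ip x (E3 x) (\<psi> x) = 0" "ip x (E4 x) (\<psi> x) = 0"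
      using 2 com by auto
    show "vector [b, \<psi> x, E3 x, E4 x] ** h x ** transpose (vector [b, \<psi> x, E3 x, E4 x]) = block_gram 0 (-1) 0"
      unfolding vec_eq_iff forall_4 gram_nth using r1 r2 2 3 by (simp add: block_gram_def)
  qed
qed

lemma gram_block_ip:
  assumes "vector [b, \<psi>, e, e'] ** h x ** transpose (vector [b, \<psi>, e, e']) = block_gram 0 (-1) 0"
  shows "ip x b b = 0" "ip x b \<psi> = -1" "ip x \<psi> b = -1" "ip x \<psi> \<psi> = 0"
    "ip x b e = 0" "ip x b e' = 0" "ip x e b = 0" "ip x e' b = 0"
    "ip x \<psi> e = 0" "ip x \<psi> e' = 0" "ip x e \<psi> = 0" "ip x e' \<psi> = 0"
    "ip x e e = 1" "ip x e' e' = 1" "ip x e e' = 0" "ip x e' e = 0"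
proof -
  have *: "ip x (vector [b, \<psi>, e, e'] $ i) (vector [b, \<psi>, e, e'] $ j) = block_gram 0 (-1) 0 $ i $ j" for i j
    using assms by (metis gram_nth)
  show "ip x b b = 0" "ip x b \<psi> = -1" "ip x \<psi> b = -1" "ip x \<psi> \<psi> = 0"
    "ip x b e = 0" "ip x b e' = 0" "ip x e b = 0" "ip x e' b = 0"
    "ip x \<psi> e = 0" "ip x \<psi> e' = 0" "ip x e \<psi> = 0" "ip x e' \<psi> = 0"
    "ip x e e = 1" "ip x e' e' = 1" "ip x e e' = 0" "ip x e' e = 0"
    using *[of 1 1] *[of 1 2] *[of 2 1] *[of 2 2] *[of 1 3] *[of 1 4] *[of 3 1] *[of 4 1]
      *[of 2 3] *[of 2 4] *[of 3 2] *[of 4 2] *[of 3 3] *[of 4 4] *[of 3 4] *[of 4 3]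
    by (simp_all add: block_gram_def)
qed

lemma ip_cov_of_constant:
  assumes S: "ball c r \<subseteq> W" "x \<in> ball c r" and sm: "smooth_on (ball c r) Y" "smooth_on (ball c r) Z"
    and k: "\<And>z. z \<in> ball c r \<Longrightarrow> ip z (Y z) (Z z) = k"
  shows "ip x (cov i Y x) (Z x) + ip x (Y x) (cov i Z x) = 0"
proof -
  have xW: "x \<in> W" using S by blast
  have "pd i (\<lambda>z. ip z (Y z) (Z z)) x = pd i (\<lambda>z. k) x"
    by (rule pd_cong[OF open_ball S(2) k], assumption)
      (rule smooth_on_differentiable[OF smooth_ip[OF open_ball S(1) sm] S(2)])
  then show ?thesis
    using pd_ip[OF xW smooth_on_differentiable[OF sm(1) S(2)] smooth_on_differentiable[OF sm(2) S(2)]] by simp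
qed

text \<open>Here \<open>f\<close> is just some function of the old coordinates. Its independence of
  v and the Laplace equation are derived afterwards, in the new chart.\<close>

lemma pp_coordinates:
  assumes c: "c \<in> W" "g c = block_gram 0 (-1) 0" and \<beta>: "\<And>x. x \<in> W \<Longrightarrow> \<beta> x = axis 1 1"
  obtains r \<Phi> f where "0 < r" "ball c r \<subseteq> W" "smooth_on (ball c r) \<Phi>"
    "\<And>x. x \<in> ball c r \<Longrightarrow> jacobian_matrix \<Phi> x $ 1 = axis 1 1"
    "\<And>x. x \<in> ball c r \<Longrightarrow>
       transpose (jacobian_matrix \<Phi> x) ** block_gram (f x) (-1) 0 ** jacobian_matrix \<Phi> x = g x"
proof -
  define b :: "real^4" where "b = axis 1 1"
  have b_nth: "b $ i = (if i = 1 then 1 else 0)" for i by (simp add: b_def axis_one_nth)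
  have covb: "cov i (\<lambda>_. b) x = 0" if "x \<in> W" for i x
  proof -
    have "pd i \<beta> x = pd i (\<lambda>_. b) x"
      by (rule pd_cong[OF open_W that _ smooth_on_differentiable[OF smooth_\<beta> that]]) (simp add: \<beta> b_def)
    then show ?thesis using cov_\<beta>[OF that, of i] by (simp add: cov_def \<beta>[OF that] b_def)
  qed
  have hc: "h c = block_gram 0 (-1) 0"
    unfolding h_def by (rule matrix_inv_eqI) (simp add: c(2) block_gram_pp_square)
  have bbc: "ip c b b = 0"
    by (simp add: ip_def hc b_def inner_axis' matrix_vector_mul_component inner_axis block_gram_def)
  obtain R where R: "R > 0" "ball c R \<subseteq> W" using open_W c(1) open_contains_ball by blast
  have bb: "ip x b b = 0" if "x \<in> ball c R" for x
  proof -
    have "smooth_on (ball c R) (\<lambda>_. b)" by (simp add: smooth_on_const)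
    from ip_constant[OF R(2) this this _ _ that] show ?thesis using covb R(2) bbc by (simp add: subset_iff)
  qed
  \<comment> \<open>\<open>W\<close> need not be connected, so b is known to be null only on the
    ball; the chart is restricted to it.\<close>
  interpret B: lorentz_chart "ball c R" g \<beta>
  proof
    fix x i j assume "x \<in> ball c R"
    then have x: "x \<in> W" using R by blast
    show "transpose (g x) = g x" by (rule sym_g[OF x])
    show "\<exists>E. transpose E ** g x ** E = minkowski" by (rule lorentz[OF x])
    show "ricci g i j x = 0" by (rule ricci_flat[OF x])
    show "partial_deriv i (\<lambda>z. \<beta> z $ j) x - (\<Sum>k\<in>UNIV. christoffel g k i j x * \<beta> x $ k) = 0"
      by (rule parallel[OF x])
  qed (use smooth_on_subset[OF smooth_g R(2)] smooth_on_subset[OF smooth_\<beta> R(2)] in auto)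
  have cR: "c \<in> ball c R" using R by simp
  obtain r E3 E4 \<zeta> where r: "0 < r" "ball c r \<subseteq> ball c R"
    and smE: "smooth_on (ball c r) E3" "smooth_on (ball c r) E4" "smooth_on (ball c r) \<zeta>"
    and rel: "\<And>x. x \<in> ball c r \<Longrightarrow> ip x b (E3 x) = 0 \<and> ip x b (E4 x) = 0 \<and>
       ip x (E3 x) (E3 x) = 1 \<and> ip x (E4 x) (E4 x) = 1 \<and> ip x (E3 x) (E4 x) = 0 \<and> ip x (\<zeta> x) b = -1"
    by (rule B.null_gram_schmidt[OF cR c(2)]) (use bb in \<open>auto simp: b_def\<close>)
  have S: "ball c r \<subseteq> W" using r R by blast
  have inW: "x \<in> W" if "x \<in> ball c r" for x using that S by blast
  have inR: "x \<in> ball c R" if "x \<in> ball c r" for x using that r by blast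
  have smb: "smooth_on (ball c r) (\<lambda>_. b)" by (simp add: smooth_on_const)
  obtain \<psi>0 where \<psi>0: "smooth_on (ball c r) \<psi>0" "\<And>x. x \<in> ball c r \<Longrightarrow>
      vector [b, \<psi>0 x, E3 x, E4 x] ** h x ** transpose (vector [b, \<psi>0 x, E3 x, E4 x]) = block_gram 0 (-1) 0"
    by (rule B.null_completion[OF r(2) smE bb rel]) auto
  \<comment> \<open>The connection form of E3, E4 modulo b.\<close>
  define A where "A i x = ip x (cov i E3 x) (E4 x)" for i x
  have smcov: "smooth_on (ball c r) (cov i Y)" if "smooth_on (ball c r) Y" for i Y
    by (rule smooth_cov[OF open_ball S that])
  have smA: "smooth_on (ball c r) (A i)" for i
    unfolding A_def[abs_def] by (intro smooth_ip[OF open_ball S] smcov smE)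
  have zero: "ip x (cov i Y x) b = 0" if "x \<in> ball c r" "smooth_on (ball c r) Y"
    "\<And>z. z \<in> ball c r \<Longrightarrow> ip z (Y z) b = k" for x i Y k
    using ip_cov_of_constant[OF S that(1,2) smb that(3), of i] covb[OF inW[OF that(1)]] by (simp add: ip_simps)
  have covE3: "cov i E3 x = A i x *\<^sub>R E4 x - ip x (cov i E3 x) (\<psi>0 x) *\<^sub>R b"
    and covE4: "cov i E4 x = (- A i x) *\<^sub>R E3 x - ip x (cov i E4 x) (\<psi>0 x) *\<^sub>R b"
    and E44: "ip x (E4 x) (cov i E4 x) = 0" and Eb: "ip x b (cov i E4 x) = 0"
    if x: "x \<in> ball c r" for i x
  proof -
    note com = ip_commute[OF inW[OF x]]
    note G = gram_block_ip[OF \<psi>0(2)]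
    have 1: "ip x (cov i E3 x) b = 0" "ip x (cov i E4 x) b = 0"
      by (rule zero[OF x smE(1), of 0], simp add: G) (rule zero[OF x smE(2), of 0], simp add: G)
    have 2: "ip x (cov i E3 x) (E3 x) = 0"
      using ip_cov_of_constant[OF S x smE(1) smE(1) G(13), of i] com[of "E3 x" "cov i E3 x"] by simp
    have 3: "ip x (cov i E4 x) (E4 x) = 0"
      using ip_cov_of_constant[OF S x smE(2) smE(2) G(14), of i] com[of "E4 x" "cov i E4 x"] by simp
    have 4: "ip x (cov i E4 x) (E3 x) = - A i x"
      using ip_cov_of_constant[OF S x smE(1) smE(2) G(15), of i] com[of "E3 x" "cov i E4 x"] by (simp add: A_def)
    show "cov i E3 x = A i x *\<^sub>R E4 x - ip x (cov i E3 x) (\<psi>0 x) *\<^sub>R b"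
      by (subst coframe_expansion[OF inW[OF x] \<psi>0(2)[OF x]]) (simp add: 1 2 A_def)
    show "cov i E4 x = (- A i x) *\<^sub>R E3 x - ip x (cov i E4 x) (\<psi>0 x) *\<^sub>R b"
      by (subst coframe_expansion[OF inW[OF x] \<psi>0(2)[OF x]]) (simp add: 1 3 4)
    show "ip x (E4 x) (cov i E4 x) = 0" "ip x b (cov i E4 x) = 0"
      using 1 3 com by auto
  qed
  \<comment> \<open>The differential of \<open>A\<close> is a curvature component. The quadratic
    term, the product of the derivatives of E3 and E4, vanishes because cov E3 lies in the span of
    E4 and b, both orthogonal to cov E4.\<close>
  have A_closed: "pd i (A j) x = pd j (A i) x" if x: "x \<in> ball c r" for i j x
  proof -
    have pA: "pd i (A j) x = ip x (cov i (cov j E3) x) (E4 x)" for i j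
    proof -
      have "ip x (cov j E3 x) (cov i E4 x) = 0"
        by (subst covE3[OF x]) (simp add: ip_simps E44[OF x] Eb[OF x])
      then show ?thesis
        unfolding A_def[abs_def]
        using pd_ip[OF inW[OF x] smooth_on_differentiable[OF smcov[OF smE(1)] x] smooth_on_differentiable[OF smE(2) x], of i j]
        by simp
    qed
    have "ip x (curv i j x *v E3 x) (E4 x) = 0"
      using curvature_in_coframe(1)[OF inW[OF x] _ \<psi>0(2)[OF x], of i j] by (simp add: \<beta>[OF inW[OF x]] b_def)
    then have "ip x (cov i (cov j E3) x - cov j (cov i E3) x) (E4 x) = 0"
      unfolding cov_cov[OF open_ball S x smE(1)] by (simp add: ip_simps)
    then show ?thesis by (simp add: pA ip_simps)
  qed
  obtain \<alpha> where \<alpha>: "smooth_on (ball c r) \<alpha>" "\<And>i x. x \<in> ball c r \<Longrightarrow> pd i \<alpha> x = A i x"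
    using poincare_slice[of c r A UNIV, OF smA A_closed] by auto
  \<comment> \<open>Since d\<alpha> = A, differentiating the angle cancels the parts of cov E3 and
    cov E4 along each other, and only multiples of b remain.\<close>
  define X3 where "X3 x = cos (\<alpha> x) *\<^sub>R E3 x - sin (\<alpha> x) *\<^sub>R E4 x" for x
  define X4 where "X4 x = sin (\<alpha> x) *\<^sub>R E3 x + cos (\<alpha> x) *\<^sub>R E4 x" for x
  have smX: "smooth_on (ball c r) X3" "smooth_on (ball c r) X4"
    unfolding X3_def[abs_def] X4_def[abs_def]
    by (intro smooth_on_diff smooth_on_add smooth_on_scaleR smooth_on_sin smooth_on_cos \<alpha> smE; simp)+
  have relX: "ip x b (X3 x) = 0 \<and> ip x b (X4 x) = 0 \<and>
       ip x (X3 x) (X3 x) = 1 \<and> ip x (X4 x) (X4 x) = 1 \<and> ip x (X3 x) (X4 x) = 0" if x: "x \<in> ball c r" for x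
  proof -
    note G = gram_block_ip[OF \<psi>0(2)[OF x]]
    have "cos (\<alpha> x) * cos (\<alpha> x) + sin (\<alpha> x) * sin (\<alpha> x) = 1"
      using sin_cos_squared_add[of "\<alpha> x"] by (simp add: power2_eq_square)
    then show ?thesis unfolding X3_def X4_def by (simp add: ip_simps G algebra_simps)
  qed
  have covX: "\<exists>t. cov i X3 x = t *\<^sub>R b" "\<exists>t. cov i X4 x = t *\<^sub>R b" if x: "x \<in> ball c r" for i x
  proof -
    have d: "\<alpha> differentiable (at x)" "E3 differentiable (at x)" "E4 differentiable (at x)"
      "(\<lambda>z. cos (\<alpha> z)) differentiable (at x)" "(\<lambda>z. sin (\<alpha> z)) differentiable (at x)"
      "(\<lambda>z. cos (\<alpha> z) *\<^sub>R E3 z) differentiable (at x)" "(\<lambda>z. sin (\<alpha> z) *\<^sub>R E3 z) differentiable (at x)"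
      "(\<lambda>z. cos (\<alpha> z) *\<^sub>R E4 z) differentiable (at x)" "(\<lambda>z. sin (\<alpha> z) *\<^sub>R E4 z) differentiable (at x)"
      by (rule smooth_on_differentiable[OF _ x],
          (intro smooth_on_scaleR smooth_on_sin smooth_on_cos \<alpha> smE; simp)?)+
    have p: "pd i (\<lambda>z. cos (\<alpha> z)) x = - sin (\<alpha> x) * A i x" "pd i (\<lambda>z. sin (\<alpha> z)) x = cos (\<alpha> x) * A i x"
      using pd_real_compose[OF DERIV_cos d(1)] pd_real_compose[OF DERIV_sin d(1)] \<alpha>(2)[OF x] by auto
    define t3 where "t3 = - ip x (cov i E3 x) (\<psi>0 x)"
    define t4 where "t4 = - ip x (cov i E4 x) (\<psi>0 x)"
    have c3: "cov i E3 x = A i x *\<^sub>R E4 x + t3 *\<^sub>R b" using covE3[OF x, of i] by (simp add: t3_def)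
    have c4: "cov i E4 x = (- A i x) *\<^sub>R E3 x + t4 *\<^sub>R b" using covE4[OF x, of i] by (simp add: t4_def)
    have "cov i X3 x = cos (\<alpha> x) *\<^sub>R cov i E3 x + (- sin (\<alpha> x) * A i x) *\<^sub>R E3 x
        - (sin (\<alpha> x) *\<^sub>R cov i E4 x + (cos (\<alpha> x) * A i x) *\<^sub>R E4 x)"
      unfolding X3_def[abs_def] cov_simps(2)[OF d(6,9)] cov_scaleR[OF d(4,2)] cov_scaleR[OF d(5,3)] p ..
    also have "\<dots> = (cos (\<alpha> x) * t3 - sin (\<alpha> x) * t4) *\<^sub>R b"
      unfolding c3 c4 by (simp add: vec_eq_iff algebra_simps)
    finally show "\<exists>t. cov i X3 x = t *\<^sub>R b" ..
    have "cov i X4 x = sin (\<alpha> x) *\<^sub>R cov i E3 x + (cos (\<alpha> x) * A i x) *\<^sub>R E3 x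
        + (cos (\<alpha> x) *\<^sub>R cov i E4 x + (- sin (\<alpha> x) * A i x) *\<^sub>R E4 x)"
      unfolding X4_def[abs_def] cov_simps(1)[OF d(7,8)] cov_scaleR[OF d(5,2)] cov_scaleR[OF d(4,3)] p ..
    also have "\<dots> = (sin (\<alpha> x) * t3 + cos (\<alpha> x) * t4) *\<^sub>R b"
      unfolding c3 c4 by (simp add: vec_eq_iff algebra_simps)
    finally show "\<exists>t. cov i X4 x = t *\<^sub>R b" ..
  qed
  \<comment> \<open>As b has only a first component, X is closed along the slices, which gives f
    with df = X + m b. The covariant derivatives of df are again multiples of b, and by symmetry of
    second derivatives only the (1, 1) component remains. So df is parallel in every direction but
    the first, as the closedness of \<psi> will require.\<close>
  have exact: "\<exists>f. smooth_on (ball c r) f \<and> (\<exists>m. smooth_on (ball c r) m \<and>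
      (\<forall>x\<in>ball c r. (\<chi> i. pd i f x) = X x + m x *\<^sub>R b)) \<and>
      (\<forall>x\<in>ball c r. \<forall>i. i \<noteq> 1 \<longrightarrow> cov i (\<lambda>x. \<chi> i. pd i f x) x = 0)"
    if sm: "smooth_on (ball c r) X" and cv: "\<And>i x. x \<in> ball c r \<Longrightarrow> \<exists>t. cov i X x = t *\<^sub>R b" for X
  proof -
    obtain f where f: "smooth_on (ball c r) f" "\<And>x i. x \<in> ball c r \<Longrightarrow> i \<in> - {1} \<Longrightarrow> pd i f x = X x $ i"
    proof (rule coframe_closed_imp_exact[OF S sm, of "- {1}"])
      fix x and i j :: 4 assume x: "x \<in> ball c r" and ij: "i \<in> - {1}" "j \<in> - {1}"
      have "cov i X x $ j = 0" if "j \<noteq> 1" for i j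
        using cv[OF x, of i] that by (auto simp: b_nth)
      then show "cov i X x $ j = cov j X x $ i" using ij by auto
    qed blast
    define m where "m x = pd 1 f x - X x $ 1" for x
    have smm: "smooth_on (ball c r) m" unfolding m_def[abs_def]
      by (intro smooth_on_diff smooth_on_pd f smooth_on_vec_nth sm) auto
    have eq: "(\<chi> i. pd i f x) = X x + m x *\<^sub>R b" if "x \<in> ball c r" for x
      using f(2)[OF that] by (auto simp: vec_eq_iff m_def b_nth)
    have smg: "smooth_on (ball c r) (\<lambda>x. \<chi> i. pd i f x)"
      by (intro smooth_on_vec_lambda smooth_on_pd f) auto
    have "cov i (\<lambda>x. \<chi> i. pd i f x) x = 0" if x: "x \<in> ball c r" and i: "i \<noteq> 1" for x i
    proof -
      have mul: "\<exists>t. cov i (\<lambda>x. \<chi> i. pd i f x) x = t *\<^sub>R b" for i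
      proof -
        have "pd i (\<lambda>x. \<chi> i. pd i f x) x = pd i (\<lambda>x. X x + m x *\<^sub>R b) x"
          by (rule pd_cong[OF open_ball x eq smooth_on_differentiable[OF smg x]])
        then have "cov i (\<lambda>x. \<chi> i. pd i f x) x = cov i (\<lambda>x. X x + m x *\<^sub>R b) x"
          by (simp add: cov_def eq[OF x])
        also have "\<dots> = cov i X x + cov i (\<lambda>x. m x *\<^sub>R b) x"
          by (intro cov_simps smooth_on_differentiable[OF _ x] sm smooth_on_scaleR smm smb) auto
        also have "cov i (\<lambda>x. m x *\<^sub>R b) x = pd i m x *\<^sub>R b"
          using cov_scaleR[OF smooth_on_differentiable[OF smm x] smooth_on_differentiable[OF smb x]] covb[OF inW[OF x]] by simp
        finally show ?thesis using cv[OF x, of i] by (metis scaleR_left_distrib)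
      qed
      have "cov i (\<lambda>x. \<chi> i. pd i f x) x $ 1 = cov 1 (\<lambda>x. \<chi> i. pd i f x) x $ i"
        using cov_antisym[OF inW[OF x] smooth_on_differentiable[OF smg x], of i 1]
          pd_commute[OF open_ball x f(1), of i 1] by simp
      also have "\<dots> = 0" using mul[of 1] i by (auto simp: b_nth)
      finally show ?thesis using mul[of i] by (auto simp: b_nth)
    qed
    then show ?thesis using f smm eq by blast
  qed
  obtain f3 m3 where f3: "smooth_on (ball c r) f3" "smooth_on (ball c r) m3"
    "\<And>x. x \<in> ball c r \<Longrightarrow> (\<chi> i. pd i f3 x) = X3 x + m3 x *\<^sub>R b"
    "\<And>x i. x \<in> ball c r \<Longrightarrow> i \<noteq> 1 \<Longrightarrow> cov i (\<lambda>x. \<chi> i. pd i f3 x) x = 0"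
    using exact[OF smX(1) covX(1)] by blast
  obtain f4 m4 where f4: "smooth_on (ball c r) f4" "smooth_on (ball c r) m4"
    "\<And>x. x \<in> ball c r \<Longrightarrow> (\<chi> i. pd i f4 x) = X4 x + m4 x *\<^sub>R b"
    "\<And>x i. x \<in> ball c r \<Longrightarrow> i \<noteq> 1 \<Longrightarrow> cov i (\<lambda>x. \<chi> i. pd i f4 x) x = 0"
    using exact[OF smX(2) covX(2)] by blast
  define D3 where "D3 x = (\<chi> i. pd i f3 x)" for x
  define D4 where "D4 x = (\<chi> i. pd i f4 x)" for x
  have smD: "smooth_on (ball c r) D3" "smooth_on (ball c r) D4"
    unfolding D3_def[abs_def] D4_def[abs_def] by (intro smooth_on_vec_lambda smooth_on_pd f3 f4; simp)+
  \<comment> \<open>The multiples of b added to X3 and X4 change none of the products, because b is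
    null and orthogonal to both.\<close>
  have relD: "ip x b (D3 x) = 0 \<and> ip x b (D4 x) = 0 \<and>
       ip x (D3 x) (D3 x) = 1 \<and> ip x (D4 x) (D4 x) = 1 \<and> ip x (D3 x) (D4 x) = 0 \<and> ip x (\<zeta> x) b = -1"
    if x: "x \<in> ball c r" for x
    using relX[OF x] rel[OF x] bb[OF inR[OF x]] ip_commute[OF inW[OF x], of "X3 x" b] ip_commute[OF inW[OF x], of "X4 x" b]
    unfolding D3_def D4_def f3(3)[OF x] f4(3)[OF x] by (simp add: ip_simps)
  obtain \<psi> where \<psi>: "smooth_on (ball c r) \<psi>" "\<And>x. x \<in> ball c r \<Longrightarrow>
      vector [b, \<psi> x, D3 x, D4 x] ** h x ** transpose (vector [b, \<psi> x, D3 x, D4 x]) = block_gram 0 (-1) 0"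
    by (rule B.null_completion[OF r(2) smD smE(3) bb relD]) auto
  \<comment> \<open>In these directions the other three covectors are parallel and all products are
    constant, so every coefficient of the derivative of \<psi> vanishes.\<close>
  have cov\<psi>: "cov i \<psi> x = 0" if x: "x \<in> ball c r" and i: "i \<noteq> 1" for i x
  proof -
    note com = ip_commute[OF inW[OF x]]
    note G = gram_block_ip[OF \<psi>(2)]
    have 0: "cov i D3 x = 0" "cov i D4 x = 0"
      unfolding D3_def[abs_def] D4_def[abs_def] using f3(4)[OF x i] f4(4)[OF x i] by auto
    have 1: "ip x (cov i \<psi> x) b = 0" by (rule zero[OF x \<psi>(1), of "-1"]) (simp add: G)
    have 2: "ip x (cov i \<psi> x) (\<psi> x) = 0"
      using ip_cov_of_constant[OF S x \<psi>(1) \<psi>(1) G(4), of i] com[of "\<psi> x" "cov i \<psi> x"] by simp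
    have 3: "ip x (cov i \<psi> x) (D3 x) = 0" "ip x (cov i \<psi> x) (D4 x) = 0"
      using ip_cov_of_constant[OF S x \<psi>(1) smD(1) G(9), of i] ip_cov_of_constant[OF S x \<psi>(1) smD(2) G(10), of i]
      by (simp_all add: 0 ip_simps)
    show ?thesis
      by (subst coframe_expansion[OF inW[OF x] \<psi>(2)[OF x]]) (simp add: 1 2 3)
  qed
  obtain v where v: "smooth_on (ball c r) v" "\<And>x i. x \<in> ball c r \<Longrightarrow> i \<in> - {1} \<Longrightarrow> pd i v x = \<psi> x $ i"
    by (rule coframe_closed_imp_exact[OF S \<psi>(1), of "- {1}"]) (use cov\<psi> in auto)
  define \<Phi> :: "real^4 \<Rightarrow> real^4" where "\<Phi> x = (\<chi> a. if a = 1 then x $ 1 else if a = 2 then v x else if a = 3 then f3 x else f4 x)"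
    for x
  \<comment> \<open>Thus \<psi> = dv + m du, and -2 du \<psi> = -2 du dv - 2 m du^2.\<close>
  define m where "m x = \<psi> x $ 1 - pd 1 v x" for x
  have J: "jacobian_matrix \<Phi> x $ 1 = b" "jacobian_matrix \<Phi> x $ 2 = \<psi> x - m x *\<^sub>R b"
    "jacobian_matrix \<Phi> x $ 3 = D3 x" "jacobian_matrix \<Phi> x $ 4 = D4 x" if x: "x \<in> ball c r" for x
    using v(2)[OF x] by (auto simp: jacobian_matrix_def \<Phi>_def vec_eq_iff b_nth pd_coord D3_def D4_def m_def)
  show ?thesis
  proof (rule that[of r \<Phi> "\<lambda>x. - 2 * m x"])
    have "smooth_on (ball c r) (\<lambda>x. if a = 1 then x $ 1 else if a = 2 then v x else if a = 3 then f3 x else f4 x)" for a :: 4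
      using v(1) f3(1) f4(1) smooth_on_vec_nth[OF open_ball smooth_on_ident[OF open_ball], of c r 1]
      by (cases "a = 1"; cases "a = 2"; cases "a = 3") simp_all
    then show "smooth_on (ball c r) \<Phi>"
      unfolding \<Phi>_def[abs_def] by (intro smooth_on_vec_lambda) auto
    fix x assume x: "x \<in> ball c r"
    show "jacobian_matrix \<Phi> x $ 1 = axis 1 1" using J(1)[OF x] by (simp add: b_def)
    have "g x = transpose (vector [b, \<psi> x, D3 x, D4 x]) ** block_gram 0 (-1) 0 ** vector [b, \<psi> x, D3 x, D4 x]"
      by (rule gram_imp_metric[OF inW[OF x] \<psi>(2)[OF x] block_gram_pp_square, symmetric])
    then show "transpose (jacobian_matrix \<Phi> x) ** block_gram (- 2 * m x) (-1) 0 ** jacobian_matrix \<Phi> x = g x"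
      by (simp add: vec_eq_iff block_gram_sandwich J[OF x] algebra_simps)
  qed (use r S in auto)
qed

end


section \<open>The vacuum equation for the profile of the wave\<close>

context lorentz_chart
begin

text \<open>A vanishing v derivative gives constancy along segments only. In a ball every line in
  the v direction through one of its points cuts out a segment that meets the hyperplane through the
  centre, where H is read off.\<close>

lemma pp_wave_harmonic:
  assumes W: "W = ball w R" and \<beta>: "\<And>x. x \<in> W \<Longrightarrow> \<beta> x = axis 1 1"
    and g: "\<And>x. x \<in> W \<Longrightarrow> g x = block_gram (f x) (-1) 0"
  obtains H :: "real \<times> real \<times> real \<Rightarrow> real" where
    "\<And>\<xi>. \<xi> \<in> W \<Longrightarrow> g \<xi> = pp_wave_matrix (H (\<xi>$1, \<xi>$3, \<xi>$4))"
    "smooth_on ((\<lambda>\<xi>. (\<xi>$1, \<xi>$3, \<xi>$4)) ` W) H"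
    "\<forall>(u, x, y)\<in>(\<lambda>\<xi>. (\<xi>$1, \<xi>$3, \<xi>$4)) ` W.
       (deriv ^^ 2) (\<lambda>s. H (u, s, y)) x + (deriv ^^ 2) (\<lambda>s. H (u, x, s)) y = 0"
proof -
  define k where "k x = g x $ 1 $ 1" for x
  have smk: "smooth_on W k" unfolding k_def[abs_def] by (rule smooth_g_nth)
  have g': "g x = block_gram (k x) (-1) 0" if "x \<in> W" for x
    using g[OF that] by (simp add: k_def block_gram_def)
  have pdg: "pd m (\<lambda>z. g z $ i $ j) x = (if i = 1 \<and> j = 1 then pd m k x else 0)" if x: "x \<in> W" for m i j x
  proof (cases "i = 1 \<and> j = 1")
    case False
    have "pd m (\<lambda>z. g z $ i $ j) x = pd m (\<lambda>z. block_gram 0 (-1) 0 $ i $ j) x"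
    proof (rule pd_cong[OF open_W x _ smooth_on_differentiable[OF smooth_g_nth x]])
      fix y assume "y \<in> W"
      then show "g y $ i $ j = block_gram 0 (-1) 0 $ i $ j"
        unfolding g'[OF \<open>y \<in> W\<close>] using False exhaust_4[of i] exhaust_4[of j]
        by (elim disjE) (simp_all add: block_gram_def)
    qed
    then show ?thesis using False by auto
  qed (simp add: k_def[abs_def])
  have h: "h x = block_gram 0 (-1) (- k x)" if "x \<in> W" for x
    unfolding h_def g'[OF that]
    by (rule matrix_inv_eqI) (use block_gram_inverse[of "k x" 0 "-1"] in simp)
  have chr: "christoffel g 1 i j x = pd 2 (\<lambda>z. g z $ i $ j) x / 2"
    "christoffel g 2 i j x = (k x * pd 2 (\<lambda>z. g z $ i $ j) x
        - (if j = 1 then pd i k x else 0) - (if i = 1 then pd j k x else 0) + (if i = 1 \<and> j = 1 then pd 1 k x else 0)) / 2"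
    "christoffel g 3 i j x = - (if i = 1 \<and> j = 1 then pd 3 k x else 0) / 2"
    "christoffel g 4 i j x = - (if i = 1 \<and> j = 1 then pd 4 k x else 0) / 2" if x: "x \<in> W" for i j x
    unfolding christoffel_eq by (simp_all add: sum_4 h[OF x] pdg[OF x] block_gram_def)
  \<comment> \<open>The (1, 1) component of the equation for a parallel b reduces to the vanishing
    of one Christoffel symbol, which is half the v derivative of \<open>k\<close>.\<close>
  have k2: "pd 2 k x = 0" if x: "x \<in> W" for x
  proof -
    have "partial_deriv 1 (\<lambda>z. \<beta> z $ 1) x = pd 1 (\<lambda>z. 1) x"
      unfolding partial_deriv_eq_pd
      by (rule pd_cong[OF open_W x _ smooth_on_differentiable[OF smooth_on_vec_nth[OF open_W smooth_\<beta>] x]])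
        (simp add: \<beta>)
    then have "christoffel g 1 1 1 x = 0"
      using parallel[OF x, of 1 1] by (simp add: \<beta>[OF x] axis_one_nth sum_4)
    then show ?thesis by (simp add: chr(1)[OF x] pdg[OF x])
  qed
  have chr': "christoffel g 1 i j x = 0"
    "christoffel g 2 i j x = - (if i = 1 then pd j k x else if j = 1 then pd i k x else 0) / 2" if x: "x \<in> W" for i j x
    using chr(1,2)[OF x, of i j] by (simp_all add: pdg[OF x] k2[OF x] split: if_splits)
  note chr'' = chr' chr(3,4)
  have harm: "pd 3 (pd 3 k) x + pd 4 (pd 4 k) x = 0" if x: "x \<in> W" for x
  proof -
    have smC': "(\<lambda>z. christoffel g r i j z) differentiable (at x)" for r i j
      using differentiable_nth[OF differentiable_nth[OF diff_C[OF x, of i], of j], of r] by (simp add: C_def)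
    have dk: "pd m k differentiable (at x)" for m
      by (rule smooth_on_differentiable[OF smooth_on_pd[OF smk] x])
    have half: "pd m (\<lambda>z. - (p z / 2)) x = - (pd m p x / 2)" if "p differentiable (at x)" for m and p :: "real^4 \<Rightarrow> real"
      using pd_linear[OF bounded_linear_mult_right that, of m "-1/2"] by simp
    have d1: "partial_deriv m (christoffel g r i j) x = pd m G x"
      if "\<And>y. y \<in> W \<Longrightarrow> christoffel g r i j y = G y" for m r i j G
      unfolding partial_deriv_eq_pd by (rule pd_cong[OF open_W x that smC'])
    have D1: "partial_deriv m (christoffel g 1 i j) x = 0" for m i j
      using d1[of 1 i j "\<lambda>_. 0"] chr'' by simp
    have D2: "partial_deriv 2 (christoffel g 2 1 1) x = 0" "partial_deriv 1 (christoffel g 2 2 1) x = 0"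
    proof -
      have "pd 2 (\<lambda>z. - pd 1 k z / 2) x = 0"
      proof -
        have "pd 2 (pd 1 k) x = pd 1 (pd 2 k) x" by (rule pd_commute[OF open_W x smk])
        also have "\<dots> = pd 1 (\<lambda>z. 0) x" by (rule pd_cong[OF open_W x k2 dk])
        finally show ?thesis by (simp add: half[OF dk])
      qed
      then show "partial_deriv 2 (christoffel g 2 1 1) x = 0"
        using d1[of 2 1 1 "\<lambda>z. - pd 1 k z / 2"] chr'' by simp
      show "partial_deriv 1 (christoffel g 2 2 1) x = 0"
        using d1[of 2 2 1 "\<lambda>z. 0"] chr'' k2 by simp
    qed
    have D3: "partial_deriv 3 (christoffel g 3 1 1) x = - pd 3 (pd 3 k) x / 2" "partial_deriv 1 (christoffel g 3 3 1) x = 0"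
      using d1[of 3 1 1 "\<lambda>z. - pd 3 k z / 2"] d1[of 3 3 1 "\<lambda>z. 0"] chr'' by (simp_all add: half[OF dk])
    have D4: "partial_deriv 4 (christoffel g 4 1 1) x = - pd 4 (pd 4 k) x / 2" "partial_deriv 1 (christoffel g 4 4 1) x = 0"
      using d1[of 4 1 1 "\<lambda>z. - pd 4 k z / 2"] d1[of 4 4 1 "\<lambda>z. 0"] chr'' by (simp_all add: half[OF dk])
    \<comment> \<open>Every product of Christoffel symbols vanishes in this component, so it is
      linear in \<open>k\<close>.\<close>
    have "ricci g 1 1 x = - pd 3 (pd 3 k) x / 2 - pd 4 (pd 4 k) x / 2"
      unfolding ricci_def riemann_def
      by (simp add: sum_4 D1 D2 D3 D4 chr''[OF x] k2[OF x])
    then show ?thesis using ricci_flat[OF x, of 1 1] by simp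
  qed
  \<comment> \<open>A section of the projection to (u, x, y), with v frozen at its value at the
    centre; this replacement keeps a point inside the ball.\<close>
  define emb :: "real \<times> real \<times> real \<Rightarrow> real^4" where
    "emb p = fst p *\<^sub>R axis 1 1 + (w $ 2) *\<^sub>R axis 2 1 + fst (snd p) *\<^sub>R axis 3 1 + snd (snd p) *\<^sub>R axis 4 1" for p
  have emb_nth: "emb p $ 1 = fst p" "emb p $ 2 = w $ 2" "emb p $ 3 = fst (snd p)" "emb p $ 4 = snd (snd p)" for p
    by (simp_all add: emb_def axis_one_nth)
  define H where "H p = k (emb p)" for p
  let ?\<pi> = "\<lambda>\<xi>::real^4. (\<xi>$1, \<xi>$3, \<xi>$4)"
  have emb_W: "emb (?\<pi> \<xi>) \<in> W" if "\<xi> \<in> W" for \<xi>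
  proof -
    have "norm (emb (?\<pi> \<xi>) - w) \<le> norm (\<xi> - w)"
    proof (rule norm_le_componentwise_cart)
      fix i show "norm ((emb (?\<pi> \<xi>) - w) $ i) \<le> norm ((\<xi> - w) $ i)"
        using exhaust_4[of i] by (elim disjE) (simp_all add: emb_nth)
    qed
    then show ?thesis using that by (simp add: W dist_norm norm_minus_commute)
  qed
  have im: "?\<pi> ` W = emb -` W"
  proof
    show "?\<pi> ` W \<subseteq> emb -` W" using emb_W by auto
    show "emb -` W \<subseteq> ?\<pi> ` W"
    proof
      fix p assume "p \<in> emb -` W"
      moreover have "p = ?\<pi> (emb p)" by (simp add: emb_nth)
      ultimately show "p \<in> ?\<pi> ` W" by blast
    qed
  qed
  have sm_emb: "smooth_on S emb" if "open S" for S
  proof -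
    have "bounded_linear (\<lambda>p::real\<times>real\<times>real. fst (snd p))" "bounded_linear (\<lambda>p::real\<times>real\<times>real. snd (snd p))"
      by (intro bounded_linear_intros)+
    then show ?thesis unfolding emb_def[abs_def]
      using that smooth_on_linear[OF _ that]
      by (intro smooth_on_add smooth_on_scaleR smooth_on_const that) (auto intro: smooth_on_linear bounded_linear_fst)
  qed
  have open_im: "open (?\<pi> ` W)"
    unfolding im by (rule open_vimage[OF open_W smooth_on_continuous[OF sm_emb[OF open_UNIV]]])
  \<comment> \<open>The segment from the section to \<xi> runs in the v direction and lies in the
    ball by convexity.\<close>
  have kH: "k \<xi> = H (?\<pi> \<xi>)" if \<xi>: "\<xi> \<in> W" for \<xi>
  proof -
    let ?d = "\<xi> $ 2 - w $ 2"
    have line: "\<xi> = emb (?\<pi> \<xi>) + ?d *\<^sub>R axis 2 1"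
      by (simp add: vec_eq_iff forall_4 emb_nth axis_one_nth)
    have seg: "emb (?\<pi> \<xi>) + (t * ?d) *\<^sub>R axis 2 1 \<in> W" if "t \<in> {0..1}" for t
    proof -
      have "(1 - t) *\<^sub>R emb (?\<pi> \<xi>) + t *\<^sub>R \<xi> \<in> W"
        using convexD_alt[of W "emb (?\<pi> \<xi>)" \<xi> t] emb_W[OF \<xi>] \<xi> that W by auto
      also have "(1 - t) *\<^sub>R emb (?\<pi> \<xi>) + t *\<^sub>R \<xi> = emb (?\<pi> \<xi>) + (t * ?d) *\<^sub>R axis 2 1"
        by (subst (2) line) (simp add: algebra_simps)
      finally show ?thesis .
    qed
    have vd: "((\<lambda>t. k (emb (?\<pi> \<xi>) + (t * ?d) *\<^sub>R axis 2 1)) has_vector_derivative 0) (at t within {0..1})"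
      if t: "t \<in> {0..1}" for t
    proof -
      have "((\<lambda>t. emb (?\<pi> \<xi>) + (t * ?d) *\<^sub>R axis 2 1) has_vector_derivative ?d *\<^sub>R axis 2 1) (at t within {0..1})"
        by (auto intro!: derivative_eq_intros)
      from has_vector_derivative_along[OF smooth_on_differentiable[OF smk seg[OF t]] this]
      show ?thesis by (simp add: sum_4 axis_one_nth k2[OF seg[OF t]])
    qed
    obtain c where "\<And>t. t \<in> {0..1} \<Longrightarrow> k (emb (?\<pi> \<xi>) + (t * ?d) *\<^sub>R axis 2 1) = c"
      using has_vector_derivative_zero_constant[OF convex_real_interval(5) vd] by blast
    from this[of 0] this[of 1] show ?thesis using line by (simp add: H_def)
  qed
  show ?thesis
  proof (rule that[of H])
    show "g \<xi> = pp_wave_matrix (H (?\<pi> \<xi>))" if "\<xi> \<in> W" for \<xi>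
      using g'[OF that] kH[OF that] by (simp add: pp_wave_matrix_eq)
    show "smooth_on (?\<pi> ` W) H"
      unfolding H_def[abs_def]
      by (rule smooth_on_compose[OF open_im open_W sm_emb[OF open_im] smk]) (simp add: im)
    show "\<forall>(u, x, y)\<in>?\<pi> ` W. (deriv ^^ 2) (\<lambda>s. H (u, s, y)) x + (deriv ^^ 2) (\<lambda>s. H (u, x, s)) y = 0"
    proof clarify
      fix \<xi> assume \<xi>: "\<xi> \<in> W"
      let ?u = "\<xi>$1" and ?x = "\<xi>$3" and ?y = "\<xi>$4"
      have e: "emb (?u, ?x, ?y) \<in> W" using emb_W[OF \<xi>] by simp
      have 3: "emb (?u, s, ?y) = emb (?u, 0, ?y) + s *\<^sub>R axis 3 1" for s
        by (simp add: emb_def)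
      have 4: "emb (?u, ?x, s) = emb (?u, ?x, 0) + s *\<^sub>R axis 4 1" for s
        by (simp add: emb_def)
      have "(deriv ^^ 2) (\<lambda>s. H (?u, s, ?y)) ?x = pd 3 (pd 3 k) (emb (?u, ?x, ?y))"
      proof -
        have "(\<lambda>s. H (?u, s, ?y)) = (\<lambda>s. k (emb (?u, 0, ?y) + s *\<^sub>R axis 3 1))"
          by (simp add: H_def emb_def add_ac)
        then show ?thesis
          using second_deriv_along[OF open_W smk, of "emb (?u, 0, ?y)" ?x 3] e 3[of ?x] by metis
      qed
      moreover have "(deriv ^^ 2) (\<lambda>s. H (?u, ?x, s)) ?y = pd 4 (pd 4 k) (emb (?u, ?x, ?y))"
      proof -
        have "(\<lambda>s. H (?u, ?x, s)) = (\<lambda>s. k (emb (?u, ?x, 0) + s *\<^sub>R axis 4 1))"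
          by (simp add: H_def emb_def add_ac)
        then show ?thesis
          using second_deriv_along[OF open_W smk, of "emb (?u, ?x, 0)" ?y 4] e 4[of ?y] by metis
      qed
      ultimately show "(deriv ^^ 2) (\<lambda>s. H (?u, s, ?y)) ?x + (deriv ^^ 2) (\<lambda>s. H (?u, ?x, s)) ?y = 0"
        using harm[OF e] by simp
    qed
  qed
qed

end


section \<open>Charts of a four-dimensional manifold\<close>

lemma cancel_congruence:
  fixes J G G' :: "real^4^4"
  assumes "invertible J" "transpose J ** G ** J = transpose J ** G' ** J"
  shows "G = G'"
proof -
  let ?K = "matrix_inv J"
  have JK: "J ** ?K = mat 1" using matrix_inv_right[OF assms(1)] .
  have KJ: "transpose ?K ** transpose J = mat 1"
    by (simp add: matrix_transpose_mul[symmetric] JK transpose_mat)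
  have "transpose ?K ** (transpose J ** M ** J) ** ?K = M" for M :: "real^4^4"
  proof -
    have "transpose ?K ** (transpose J ** M ** J) ** ?K = (transpose ?K ** transpose J) ** M ** (J ** ?K)"
      by (simp only: matrix_mul_assoc)
    then show ?thesis by (simp add: JK KJ)
  qed
  then show ?thesis using assms(2) by metis
qed

lemma cancel_transpose:
  fixes J :: "real^4^4"
  assumes "invertible J" "transpose J *v v = transpose J *v w"
  shows "v = w"
proof -
  have "transpose (matrix_inv J) ** transpose J = mat 1"
    by (simp add: matrix_transpose_mul[symmetric] matrix_inv_right[OF assms(1)] transpose_mat)
  then have "transpose (matrix_inv J) *v (transpose J *v u) = u" for u
    by (simp only: matrix_vector_mul_assoc matrix_vector_mul_lid)
  then show ?thesis using assms(2) by metis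
qed

lemma invertible_of_congruence:
  fixes J G N :: "real^4^4"
  assumes "transpose J ** N ** J = G" "invertible G"
  shows "invertible J"
proof -
  have "det (transpose J) * det N * det J = det G" using assms(1) by (metis det_mul)
  then show ?thesis using assms(2) by (auto simp: invertible_det_nz)
qed

lemma row_1_transpose: "transpose (J::real^4^4) *v axis 1 1 = J $ 1"
  by (simp add: vec_eq_iff matrix_vector_mul_component inner_axis transpose_def)

lemma transpose_mult_nth: "(transpose A ** B) $ i $ j = (\<Sum>k\<in>UNIV. A $ k $ i * B $ k $ j)"
  by (simp add: matrix_matrix_mult_def transpose_def)

text \<open>Since \<open>P\<close> has only two values, the unions of the neighbourhoods belonging
  to either value would separate \<open>C\<close>.\<close>

lemma locally_constant_on_connected:
  fixes P :: "'a \<Rightarrow> bool"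
  assumes C: "connectedin X C" and loc: "\<And>p. p \<in> C \<Longrightarrow> \<exists>U. openin X U \<and> p \<in> U \<and> (\<forall>q\<in>U. P q = P p)"
    and pq: "p \<in> C" "q \<in> C"
  shows "P p = P q"
proof (rule ccontr)
  assume neq: "P p \<noteq> P q"
  obtain U where U: "\<And>p. p \<in> C \<Longrightarrow> openin X (U p)" "\<And>p. p \<in> C \<Longrightarrow> p \<in> U p" "\<And>p q. p \<in> C \<Longrightarrow> q \<in> U p \<Longrightarrow> P q = P p"
    using loc by metis
  define E where "E t = \<Union>(U ` {z \<in> C. P z = t})" for t
  have op: "openin X (E t)" for t unfolding E_def using U(1) by (intro openin_Union) auto
  have E: "P z = t" if "z \<in> E t" for z t using that U(3) unfolding E_def by blast
  have "C \<subseteq> E (P p) \<union> E (P q)"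
  proof
    fix z assume z: "z \<in> C"
    have zE: "z \<in> E (P z)" unfolding E_def using z U(2) by blast
    have "P z = P p \<or> P z = P q" using neq by (cases "P z"; cases "P p"; cases "P q") auto
    then show "z \<in> E (P p) \<union> E (P q)"
    proof
      assume "P z = P p"
      from zE[unfolded this] show ?thesis by (rule UnI1)
    next
      assume "P z = P q"
      from zE[unfolded this] show ?thesis by (rule UnI2)
    qed
  qed
  moreover have "E (P p) \<inter> E (P q) \<inter> C = {}" using E neq by blast
  moreover have "E (P p) \<inter> C \<noteq> {}" "E (P q) \<inter> C \<noteq> {}" using pq U(2) unfolding E_def by blast+
  ultimately show False using C op[of "P p"] op[of "P q"] unfolding connectedin by blast
qed

locale smooth_4_manifold =
  fixes X :: "'a topology" and S :: "'a chart set"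
  assumes smooth_manifold: "smooth_manifold X S"
begin

lemma chart: "c \<in> S \<Longrightarrow> chart_on X c"
  and cover: "(\<Union>c\<in>S. fst c) = topspace X"
  and compatible: "c \<in> S \<Longrightarrow> d \<in> S \<Longrightarrow> smoothly_compatible c d"
  and maximal: "chart_on X c \<Longrightarrow> (\<And>d. d \<in> S \<Longrightarrow> smoothly_compatible c d) \<Longrightarrow> c \<in> S"
proof -
  note * = smooth_manifold[unfolded smooth_manifold_def smooth_structure_def, THEN conjunct2, THEN conjunct2]
  show "c \<in> S \<Longrightarrow> chart_on X c" using * by blast
  show "(\<Union>c\<in>S. fst c) = topspace X" using * by blast
  show "c \<in> S \<Longrightarrow> d \<in> S \<Longrightarrow> smoothly_compatible c d" using * by blast
  show "chart_on X c \<Longrightarrow> (\<And>d. d \<in> S \<Longrightarrow> smoothly_compatible c d) \<Longrightarrow> c \<in> S" using *[THEN conjunct2, THEN conjunct2, THEN conjunct2] by blast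
qed

lemma openin_domain: "c \<in> S \<Longrightarrow> openin X (fst c)"
  and open_image: "c \<in> S \<Longrightarrow> open (snd c ` fst c)"
  and homeo: "c \<in> S \<Longrightarrow> homeomorphic_map (subtopology X (fst c)) (top_of_set (snd c ` fst c)) (snd c)"
  using chart by (auto simp: chart_on_def)

lemma topspace_domain: "c \<in> S \<Longrightarrow> topspace (subtopology X (fst c)) = fst c"
  using openin_subset[OF openin_domain, of c] by (simp add: Int_absorb1)

lemma inj_chart: "c \<in> S \<Longrightarrow> inj_on (snd c) (fst c)"
  using homeomorphic_imp_injective_map[OF homeo] topspace_domain by metis

lemma chart_inv_chart: "c \<in> S \<Longrightarrow> p \<in> fst c \<Longrightarrow> chart_inv c (snd c p) = p"
  by (simp add: chart_inv_def inj_chart)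

lemma transition_chart: "c \<in> S \<Longrightarrow> p \<in> fst c \<Longrightarrow> transition c d (snd c p) = snd d p"
  by (simp add: transition_def chart_inv_chart)

lemma open_chart_image:
  assumes "c \<in> S" "openin X U"
  shows "open (snd c ` (fst c \<inter> U))"
proof -
  have "openin (subtopology X (fst c)) (fst c \<inter> U)"
    using assms(2) by (auto simp: openin_subtopology)
  then have "openin (top_of_set (snd c ` fst c)) (snd c ` (fst c \<inter> U))"
    using homeomorphic_imp_open_map[OF homeo[OF assms(1)]] by (simp add: open_map_def)
  then show ?thesis using open_image[OF assms(1)] by (simp add: openin_open_eq)
qed

lemma openin_chart_preimage:
  assumes "c \<in> S" "open V"
  shows "openin X {p \<in> fst c. snd c p \<in> V}"
proof -
  have "continuous_map (subtopology X (fst c)) euclidean (snd c)"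
    using homeomorphic_imp_continuous_map[OF homeo[OF assms(1)]] continuous_map_into_fulltopology by blast
  then have "openin (subtopology X (fst c)) {p \<in> topspace (subtopology X (fst c)). snd c p \<in> V}"
    by (rule openin_continuous_map_preimage) (use assms in auto)
  then have "openin (subtopology X (fst c)) {p \<in> fst c. snd c p \<in> V}"
    unfolding topspace_domain[OF assms(1)] .
  then show ?thesis using openin_trans_full[OF _ openin_domain[OF assms(1)]] by blast
qed

lemma smooth_transition:
  "c \<in> S \<Longrightarrow> d \<in> S \<Longrightarrow> smooth_on (snd c ` (fst c \<inter> fst d)) (transition c d)"
  using compatible by (auto simp: smoothly_compatible_def)

lemma transition_differentiable:
  "c \<in> S \<Longrightarrow> d \<in> S \<Longrightarrow> p \<in> fst c \<Longrightarrow> p \<in> fst d \<Longrightarrow> transition c d differentiable (at (snd c p))"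
  by (rule smooth_on_differentiable[OF smooth_transition]) auto

text \<open>The chain rule for transitions. It makes the tangent vectors well defined: components
  given in one chart extend consistently to all charts around the point.\<close>

lemma transition_cocycle:
  assumes "c \<in> S" "d \<in> S" "e \<in> S" "p \<in> fst c" "p \<in> fst d" "p \<in> fst e"
  shows "frechet_derivative (transition c e) (at (snd c p)) v =
    frechet_derivative (transition d e) (at (snd d p)) (frechet_derivative (transition c d) (at (snd c p)) v)"
proof -
  let ?T = "snd c ` (fst c \<inter> (fst d \<inter> fst e))"
  have "(transition d e \<circ> transition c d has_derivative
      frechet_derivative (transition d e) (at (snd d p)) \<circ> frechet_derivative (transition c d) (at (snd c p)))
      (at (snd c p))"
    by (rule diff_chain_at)
      (use transition_differentiable[of c d p] transition_differentiable[of d e p] assms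
        in \<open>auto simp: frechet_derivative_works[symmetric] transition_chart\<close>)
  then have "(transition c e has_derivative
      frechet_derivative (transition d e) (at (snd d p)) \<circ> frechet_derivative (transition c d) (at (snd c p)))
      (at (snd c p))"
  proof (rule has_derivative_transform_within_open[where s = ?T])
    show "open ?T" using assms by (intro open_chart_image openin_Int openin_domain)
  qed (use assms in \<open>auto simp: transition_chart\<close>)
  then show ?thesis by (simp add: frechet_derivative_eqI)
qed

lemma transition_self:
  assumes "c \<in> S" "p \<in> fst c"
  shows "frechet_derivative (transition c c) (at (snd c p)) v = v"
proof -
  have "(transition c c has_derivative (\<lambda>v. v)) (at (snd c p))"
  proof (rule has_derivative_transform_within_open[OF has_derivative_ident open_image[OF assms(1)]])
    show "snd c p \<in> snd c ` fst c" using assms(2) by (rule imageI)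
    fix x assume "x \<in> snd c ` fst c"
    then show "x = transition c c x" using transition_chart[OF assms(1)] by (metis imageE)
  qed
  then show ?thesis by (simp add: frechet_derivative_eqI)
qed

lemma tangent_spaceI:
  assumes "\<And>c d. c \<in> S \<Longrightarrow> d \<in> S \<Longrightarrow> p \<in> fst c \<Longrightarrow> p \<in> fst d \<Longrightarrow>
      v d = frechet_derivative (transition c d) (at (snd c p)) (v c)"
    "\<And>c. \<not> (c \<in> S \<and> p \<in> fst c) \<Longrightarrow> v c = 0"
  shows "v \<in> tangent_space S p"
  unfolding tangent_space_def using assms by blast

lemma tangent_space_change:
  assumes "v \<in> tangent_space S p" "c \<in> S" "d \<in> S" "p \<in> fst c" "p \<in> fst d"
  shows "v d = frechet_derivative (transition c d) (at (snd c p)) (v c)"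
  using assms unfolding tangent_space_def by blast

lemma tangent_space_zero:
  assumes "v \<in> tangent_space S p" "\<not> (c \<in> S \<and> p \<in> fst c)"
  shows "v c = 0"
  using assms unfolding tangent_space_def by blast

lemma tangent_of_in_tangent_space:
  assumes "c \<in> S" "p \<in> fst c"
  shows "tangent_of S c p y \<in> tangent_space S p"
proof (rule tangent_spaceI)
  show "tangent_of S c p y e = frechet_derivative (transition d e) (at (snd d p)) (tangent_of S c p y d)"
    if "d \<in> S" "e \<in> S" "p \<in> fst d" "p \<in> fst e" for d e
    using transition_cocycle[OF assms(1) that(1,2) assms(2) that(3,4), of y] that by (simp add: tangent_of_def)
qed (simp only: tangent_of_def if_False)

lemma coord_vector_in_tangent_space:
  "c \<in> S \<Longrightarrow> p \<in> fst c \<Longrightarrow> coord_vector S c p i \<in> tangent_space S p"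
  unfolding coord_vector_def by (rule tangent_of_in_tangent_space)

lemma tangent_of_components:
  assumes "c \<in> S" "p \<in> fst c" "v \<in> tangent_space S p"
  shows "tangent_of S c p (v c) = v"
proof
  fix d
  show "tangent_of S c p (v c) d = v d"
  proof (cases "d \<in> S \<and> p \<in> fst d")
    case True
    then show ?thesis
      using tangent_space_change[OF assms(3,1) _ assms(2), of d] by (simp add: tangent_of_def)
  next
    case False
    then show ?thesis
      unfolding tangent_of_def tangent_space_zero[OF assms(3) False] by (simp only: if_False)
  qed
qed

lemma tangent_of_eq_sum:
  assumes "c \<in> S" "p \<in> fst c"
  shows "tangent_of S c p y = (\<lambda>e. \<Sum>k\<in>UNIV. y $ k *\<^sub>R coord_vector S c p k e)"
proof
  fix e
  show "tangent_of S c p y e = (\<Sum>k\<in>UNIV. y $ k *\<^sub>R coord_vector S c p k e)"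
  proof (cases "e \<in> S \<and> p \<in> fst e")
    case True
    then show ?thesis
      using frechet_eq_sum_pd[OF transition_differentiable, of c e p y] assms
      by (simp add: tangent_of_def coord_vector_def pd_def)
  qed (auto simp: tangent_of_def coord_vector_def)
qed

lemma tangent_space_combination:
  assumes "\<And>k. k \<in> K \<Longrightarrow> v k \<in> tangent_space S p" "finite K"
  shows "(\<lambda>e. \<Sum>k\<in>K. r k *\<^sub>R v k e) \<in> tangent_space S p"
proof -
  have "(\<Sum>k\<in>K. r k *\<^sub>R v k d) = frechet_derivative (transition c d) (at (snd c p)) (\<Sum>k\<in>K. r k *\<^sub>R v k c)"
    if "c \<in> S" "d \<in> S" "p \<in> fst c" "p \<in> fst d" for c d
  proof -
    have lin: "linear (frechet_derivative (transition c d) (at (snd c p)))"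
      using linear_frechet_derivative[OF transition_differentiable] that by blast
    have "v k d = frechet_derivative (transition c d) (at (snd c p)) (v k c)" if "k \<in> K" for k
      by (rule tangent_space_change[OF assms(1)[OF that]]) fact+
    then show ?thesis by (simp add: linear_sum[OF lin] linear_cmul[OF lin])
  qed
  moreover have "(\<Sum>k\<in>K. r k *\<^sub>R v k c) = 0" if "\<not> (c \<in> S \<and> p \<in> fst c)" for c
    using tangent_space_zero[OF assms(1) that] by (intro sum.neutral) simp
  ultimately show ?thesis by (rule tangent_spaceI)
qed

lemma linear_on_tangent_sum:
  assumes "linear_on_tangent S p f" "\<And>k. k \<in> K \<Longrightarrow> v k \<in> tangent_space S p" "finite K"
  shows "f (\<lambda>e. \<Sum>k\<in>K. r k *\<^sub>R v k e) = (\<Sum>k\<in>K. r k * f (v k))"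
  using assms(3,2)
proof (induction K)
  case empty
  have "(\<lambda>e. 0) \<in> tangent_space S p" using tangent_space_combination[of "{}" v p r] by simp
  from assms(1)[unfolded linear_on_tangent_def, THEN conjunct2, rule_format, OF this, of 0]
  show ?case by simp
next
  case (insert k K)
  have 1: "(\<lambda>e. r k *\<^sub>R v k e) \<in> tangent_space S p"
    using tangent_space_combination[of "{k}" v p r] insert.prems by simp
  have 2: "(\<lambda>e. \<Sum>k\<in>K. r k *\<^sub>R v k e) \<in> tangent_space S p"
    using insert by (intro tangent_space_combination) auto
  have "f (\<lambda>e. r k *\<^sub>R v k e + (\<Sum>k\<in>K. r k *\<^sub>R v k e)) = f (\<lambda>e. r k *\<^sub>R v k e) + f (\<lambda>e. \<Sum>k\<in>K. r k *\<^sub>R v k e)"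
    by (rule assms(1)[unfolded linear_on_tangent_def, THEN conjunct1, rule_format, OF 1 2])
  moreover have "f (\<lambda>e. r k *\<^sub>R v k e) = r k * f (v k)"
    by (rule assms(1)[unfolded linear_on_tangent_def, THEN conjunct2, rule_format, OF insert.prems]) simp
  ultimately show ?case using insert by simp
qed

section \<open>Transformation of components between charts\<close>

definition chart_jacobian :: "'a chart \<Rightarrow> 'a chart \<Rightarrow> 'a \<Rightarrow> real^4^4" where
  "chart_jacobian c d p = jacobian_matrix (transition c d) (snd c p)"

lemma chart_jacobian_inverse:
  assumes "c \<in> S" "d \<in> S" "p \<in> fst c" "p \<in> fst d"
  shows "chart_jacobian d c p ** chart_jacobian c d p = mat 1"
proof -
  have "(chart_jacobian d c p ** chart_jacobian c d p) *v v = mat 1 *v v" for v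
    using transition_cocycle[of c d c p v] transition_self[of c p v] assms
    by (simp add: frechet_eq_jacobian_matrix transition_differentiable chart_jacobian_def matrix_vector_mul_assoc)
  then show ?thesis using matrix_eq by blast
qed

lemma chart_jacobian_invertible:
  assumes "c \<in> S" "d \<in> S" "p \<in> fst c" "p \<in> fst d"
  shows "invertible (chart_jacobian c d p)"
  using chart_jacobian_inverse[OF assms] invertible_left_inverse by blast

lemma form_eval:
  assumes "one_form X S b" "c \<in> S" "p \<in> fst c" "v \<in> tangent_space S p"
  shows "b p v = (\<Sum>k\<in>UNIV. v c $ k * form_comp S b c (snd c p) $ k)"
proof -
  have pX: "p \<in> topspace X" using assms openin_subset[OF openin_domain] by blast
  have lin: "linear_on_tangent S p (b p)" using assms(1) pX by (simp add: one_form_def)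
  have "v = (\<lambda>e. \<Sum>k\<in>UNIV. v c $ k *\<^sub>R coord_vector S c p k e)"
    using tangent_of_components[OF assms(2-4)] tangent_of_eq_sum[OF assms(2,3)] by metis
  then have "b p v = b p (\<lambda>e. \<Sum>k\<in>UNIV. v c $ k *\<^sub>R coord_vector S c p k e)" by simp
  also have "\<dots> = (\<Sum>k\<in>UNIV. v c $ k * b p (coord_vector S c p k))"
    by (rule linear_on_tangent_sum[OF lin]) (use coord_vector_in_tangent_space assms in auto)
  finally show ?thesis by (simp add: form_comp_def chart_inv_chart assms)
qed

lemma metric_eval:
  assumes "pseudo_riemannian_metric X S a" "c \<in> S" "p \<in> fst c" "v \<in> tangent_space S p" "w \<in> tangent_space S p"
  shows "a p v w = v c \<bullet> (metric_comp S a c (snd c p) *v w c)"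
proof -
  have pX: "p \<in> topspace X" using assms openin_subset[OF openin_domain] by blast
  note co = coord_vector_in_tangent_space[OF assms(2,3)]
  have lin: "linear_on_tangent S p (a p v)" if "v \<in> tangent_space S p" for v
    using assms(1) pX that by (simp add: pseudo_riemannian_metric_def)
  have sym: "a p v w = a p w v" if "v \<in> tangent_space S p" "w \<in> tangent_space S p" for v w
    using assms(1) pX that by (simp add: pseudo_riemannian_metric_def)
  have rep: "v = (\<lambda>e. \<Sum>k\<in>UNIV. v c $ k *\<^sub>R coord_vector S c p k e)" if "v \<in> tangent_space S p" for v
    using tangent_of_components[OF assms(2,3) that] tangent_of_eq_sum[OF assms(2,3)] by metis
  have exp: "a p u v = (\<Sum>k\<in>UNIV. v c $ k * a p u (coord_vector S c p k))"
    if "u \<in> tangent_space S p" "v \<in> tangent_space S p" for u v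
  proof -
    have "a p u v = a p u (\<lambda>e. \<Sum>k\<in>UNIV. v c $ k *\<^sub>R coord_vector S c p k e)"
      using rep[OF that(2)] by simp
    also have "\<dots> = (\<Sum>k\<in>UNIV. v c $ k * a p u (coord_vector S c p k))"
      by (rule linear_on_tangent_sum[OF lin[OF that(1)]]) (use co in auto)
    finally show ?thesis .
  qed
  have "a p v w = (\<Sum>k\<in>UNIV. w c $ k * a p (coord_vector S c p k) v)"
    using exp[OF assms(4,5)] sym[OF assms(4) co] by simp
  also have "\<dots> = (\<Sum>k\<in>UNIV. w c $ k * (\<Sum>l\<in>UNIV. v c $ l * a p (coord_vector S c p k) (coord_vector S c p l)))"
    using exp[OF co assms(4)] by simp
  also have "\<dots> = (\<Sum>k\<in>UNIV. \<Sum>l\<in>UNIV. v c $ l * (metric_comp S a c (snd c p) $ l $ k * w c $ k))"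
    using sym[OF co co] by (simp add: metric_comp_def chart_inv_chart assms(2,3) sum_distrib_left mult_ac)
  also have "\<dots> = v c \<bullet> (metric_comp S a c (snd c p) *v w c)"
    by (subst sum.swap) (simp add: inner_vec_def matrix_vector_mult_def sum_distrib_left)
  finally show ?thesis .
qed

lemma coord_vector_change_component:
  assumes "c \<in> S" "d \<in> S" "p \<in> fst c" "p \<in> fst d"
  shows "coord_vector S c p i d $ k = chart_jacobian c d p $ k $ i"
proof -
  have "coord_vector S c p i d = chart_jacobian c d p *v axis i 1"
    using assms by (simp add: coord_vector_def tangent_of_def frechet_eq_jacobian_matrix transition_differentiable chart_jacobian_def)
  then show ?thesis by (simp add: matrix_vector_mul_component inner_axis)
qed

lemma form_change:
  assumes "one_form X S b" "c \<in> S" "d \<in> S" "p \<in> fst c" "p \<in> fst d"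
  shows "form_comp S b c (snd c p) = transpose (chart_jacobian c d p) *v form_comp S b d (snd d p)"
proof -
  have "form_comp S b c (snd c p) $ i = b p (coord_vector S c p i)" for i
    by (simp add: form_comp_def chart_inv_chart assms)
  then show ?thesis
    using form_eval[OF assms(1,3,5) coord_vector_in_tangent_space[OF assms(2,4)]]
    by (simp add: vec_eq_iff coord_vector_change_component assms matrix_vector_mult_def transpose_def)
qed

lemma metric_change:
  assumes "pseudo_riemannian_metric X S a" "c \<in> S" "d \<in> S" "p \<in> fst c" "p \<in> fst d"
  shows "metric_comp S a c (snd c p)
    = transpose (chart_jacobian c d p) ** metric_comp S a d (snd d p) ** chart_jacobian c d p"
proof -
  let ?J = "chart_jacobian c d p" and ?G = "metric_comp S a d (snd d p)"
  have "metric_comp S a c (snd c p) $ i $ j = (transpose ?J ** ?G ** ?J) $ i $ j" for i j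
  proof -
    have "metric_comp S a c (snd c p) $ i $ j = a p (coord_vector S c p i) (coord_vector S c p j)"
      by (simp add: metric_comp_def chart_inv_chart assms)
    also have "\<dots> = coord_vector S c p i d \<bullet> (?G *v coord_vector S c p j d)"
      by (rule metric_eval[OF assms(1,3,5)]) (use coord_vector_in_tangent_space assms in auto)
    also have "\<dots> = (\<Sum>k\<in>UNIV. ?J $ k $ i * (?G ** ?J) $ k $ j)"
      by (simp add: inner_vec_def matrix_vector_mult_def matrix_matrix_mult_def coord_vector_change_component assms)
    also have "\<dots> = (transpose ?J ** ?G ** ?J) $ i $ j"
      by (simp only: matrix_mul_assoc[of "transpose ?J" ?G ?J, symmetric] transpose_mult_nth)
    finally show ?thesis .
  qed
  then show ?thesis by (simp add: vec_eq_iff)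
qed

text \<open>Membership comes from the maximality of the atlas: transitions to and from the new chart
  are old transitions composed with \<Psi> or \<Phi>, hence smooth.\<close>

lemma restricted_chart:
  assumes c: "c \<in> S" and V: "open V" "V \<subseteq> snd c ` fst c"
    and \<Phi>: "homeomorphism V V' \<Phi> \<Psi>" "open V'" "smooth_on V \<Phi>" "smooth_on V' \<Psi>"
  shows "({p \<in> fst c. snd c p \<in> V}, \<Phi> \<circ> snd c) \<in> S"
proof -
  let ?U = "{p \<in> fst c. snd c p \<in> V}"
  let ?c = "(?U, \<Phi> \<circ> snd c)"
  have U: "openin X ?U" by (rule openin_chart_preimage[OF c V(1)])
  have cU: "snd c ` ?U = V" using V(2) by auto
  have \<Phi>V: "\<Phi> ` V = V'" and \<Psi>\<Phi>: "\<And>x. x \<in> V \<Longrightarrow> \<Psi> (\<Phi> x) = x" and cont: "continuous_on V \<Phi>" "continuous_on V' \<Psi>"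
    and \<Phi>\<Psi>: "\<And>y. y \<in> V' \<Longrightarrow> \<Phi> (\<Psi> y) = y" and \<Psi>V': "\<Psi> ` V' = V"
    using \<Phi>(1) by (auto simp: homeomorphism_def)
  have im: "(\<Phi> \<circ> snd c) ` ?U = V'" using cU \<Phi>V by (metis image_comp)
  have inv: "chart_inv ?c (\<Phi> (snd c p)) = p" if "p \<in> ?U" for p
  proof -
    have "inj_on (\<Phi> \<circ> snd c) ?U"
    proof (rule inj_onI)
      fix p q assume "p \<in> ?U" "q \<in> ?U" "(\<Phi> \<circ> snd c) p = (\<Phi> \<circ> snd c) q"
      then have "snd c p = snd c q" using \<Psi>\<Phi> by (metis (mono_tags, lifting) comp_apply mem_Collect_eq)
      then show "p = q" using inj_chart[OF c] \<open>p \<in> ?U\<close> \<open>q \<in> ?U\<close> by (auto dest: inj_onD)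
    qed
    from inv_into_f_f[OF this that] show ?thesis by (simp add: chart_inv_def)
  qed
  have h1: "homeomorphic_map (subtopology X ?U) (top_of_set V) (snd c)"
  proof -
    have "homeomorphic_map (subtopology (subtopology X (fst c)) ?U) (subtopology (top_of_set (snd c ` fst c)) V) (snd c)"
      by (rule homeomorphic_map_subtopologies[OF homeo[OF c]]) (use topspace_domain[OF c] V(2) in auto)
    moreover have "fst c \<inter> ?U = ?U" "snd c ` fst c \<inter> V = V" using V(2) by auto
    ultimately show ?thesis by (simp add: subtopology_subtopology)
  qed
  have h2: "homeomorphic_map (top_of_set V) (top_of_set V') \<Phi>"
    unfolding homeomorphic_map_maps homeomorphic_maps_def
    by (rule exI[of _ \<Psi>]) (use cont \<Phi>V \<Psi>V' \<Psi>\<Phi> \<Phi>\<Psi> in \<open>auto simp: continuous_map_in_subtopology\<close>)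
  show ?thesis
  proof (rule maximal)
    show "chart_on X ?c"
      unfolding chart_on_def fst_conv snd_conv im using U \<Phi>(2) homeomorphic_map_compose[OF h1 h2] by simp
  next
    fix d assume d: "d \<in> S"
    let ?T = "snd c ` (?U \<inter> fst d)"
    have "?U \<inter> fst d = fst c \<inter> (?U \<inter> fst d)" by auto
    then have oT: "open ?T"
      using open_chart_image[OF c openin_Int[OF U openin_domain[OF d]]] by simp
    have T': "(\<Phi> \<circ> snd c) ` (?U \<inter> fst d) = V' \<inter> \<Psi> -` ?T"
    proof
      show "(\<Phi> \<circ> snd c) ` (?U \<inter> fst d) \<subseteq> V' \<inter> \<Psi> -` ?T" using \<Phi>V \<Psi>\<Phi> by auto
      show "V' \<inter> \<Psi> -` ?T \<subseteq> (\<Phi> \<circ> snd c) ` (?U \<inter> fst d)" using \<Phi>\<Psi> by force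
    qed
    have oT': "open ((\<Phi> \<circ> snd c) ` (?U \<inter> fst d))"
      unfolding T' by (rule continuous_open_preimage[OF cont(2) \<Phi>(2) oT])
    have sm1: "smooth_on ((\<Phi> \<circ> snd c) ` (?U \<inter> fst d)) (\<lambda>x. transition c d (\<Psi> x))"
    proof (rule smooth_on_compose[where f = \<Psi> and g = "transition c d", OF oT' oT])
      show "smooth_on ((\<Phi> \<circ> snd c) ` (?U \<inter> fst d)) \<Psi>" by (rule smooth_on_subset[OF \<Phi>(4)]) (use T' in auto)
      show "smooth_on ?T (transition c d)" by (rule smooth_on_subset[OF smooth_transition[OF c d]]) auto
    qed (use T' in auto)
    have eq1: "transition ?c d x = transition c d (\<Psi> x)" if "x \<in> (\<Phi> \<circ> snd c) ` (?U \<inter> fst d)" for x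
    proof -
      from that obtain p where p: "p \<in> ?U" "p \<in> fst d" "x = \<Phi> (snd c p)" by auto
      then show ?thesis
        using inv[OF p(1)] \<Psi>\<Phi> by (simp add: transition_chart[OF c] transition_def[of ?c])
    qed
    have 1: "smooth_on ((\<Phi> \<circ> snd c) ` (?U \<inter> fst d)) (transition ?c d)"
      by (rule iffD2[OF smooth_on_cong[OF oT' eq1] sm1])
    have oD: "open (snd d ` (?U \<inter> fst d))"
      using open_chart_image[OF d U] by (simp add: Int_commute)
    have "smooth_on (snd d ` (?U \<inter> fst d)) (\<lambda>x. \<Phi> (transition d c x))"
    proof (rule smooth_on_compose[where f = "transition d c" and g = \<Phi>, OF oD V(1)])
      show "smooth_on (snd d ` (?U \<inter> fst d)) (transition d c)"
        by (rule smooth_on_subset[OF smooth_transition[OF d c]]) auto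
    qed (use \<Phi>(3) in \<open>auto simp: transition_chart[OF d]\<close>)
    then have 2: "smooth_on (snd d ` (?U \<inter> fst d)) (transition d ?c)"
      by (rule iffD1[OF smooth_on_cong[OF oD], rotated]) (simp add: transition_def)
    show "smoothly_compatible ?c d"
      unfolding smoothly_compatible_def fst_conv snd_conv using 1 2 by (simp add: Int_commute)
  qed
qed

text \<open>Makes the local coordinates found by analysis members of the atlas. The image is
  arranged to be a ball, which the elimination of v from the metric relies on.\<close>

lemma chart_from_local_diffeomorphism:
  assumes c: "c \<in> S" "p \<in> fst c" and B: "0 < r" "ball (snd c p) r \<subseteq> snd c ` fst c"
    and \<Phi>: "smooth_on (ball (snd c p) r) \<Phi>" "invertible (jacobian_matrix \<Phi> (snd c p))"
  obtains c' R where "c' \<in> S" "p \<in> fst c'" "0 < R" "snd c' ` fst c' = ball (snd c' p) R"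
    "\<And>q. q \<in> fst c' \<Longrightarrow> q \<in> fst c \<and> snd c q \<in> ball (snd c p) r \<and> snd c' q = \<Phi> (snd c q) \<and>
        chart_jacobian c c' q = jacobian_matrix \<Phi> (snd c q)"
proof -
  have x0: "snd c p \<in> ball (snd c p) r" using B by simp
  obtain U V g where UV: "open U" "U \<subseteq> ball (snd c p) r" "snd c p \<in> U" "open V" "homeomorphism U V \<Phi> g"
    "smooth_on V g"
    by (rule smooth_local_inverse[OF open_ball x0 \<Phi>]) blast
  have pV: "\<Phi> (snd c p) \<in> V" using UV(3,5) by (auto simp: homeomorphism_def)
  obtain R where R: "R > 0" "ball (\<Phi> (snd c p)) R \<subseteq> V" using UV(4) pV open_contains_ball by blast
  let ?B = "ball (\<Phi> (snd c p)) R"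
  \<comment> \<open>The domain is cut down on the side of the image, so that \<Phi> maps it onto a
    ball.\<close>
  define U' where "U' = U \<inter> \<Phi> -` ?B"
  have hom: "homeomorphism U' ?B \<Phi> g"
  proof (rule homeomorphism_of_subsets[OF UV(5)])
    show "U' \<subseteq> U" by (simp add: U'_def)
    show "\<Phi> ` U' = ?B"
    proof
      show "?B \<subseteq> \<Phi> ` U'"
      proof
        fix y assume y: "y \<in> ?B"
        then have "g y \<in> U" "\<Phi> (g y) = y" using R(2) UV(5) by (auto simp: homeomorphism_def)
        then show "y \<in> \<Phi> ` U'" using y unfolding U'_def by (metis IntI image_eqI vimageI)
      qed
    qed (auto simp: U'_def)
  qed (use R in auto)
  have "continuous_on U \<Phi>" using UV(5) by (simp add: homeomorphism_def)
  then have oU': "open U'" unfolding U'_def by (rule continuous_open_preimage) (use UV in auto)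
  have U'B: "U' \<subseteq> ball (snd c p) r" using UV(2) by (auto simp: U'_def)
  define c' where "c' = ({p \<in> fst c. snd c p \<in> U'}, \<Phi> \<circ> snd c)"
  have c'S: "c' \<in> S"
    unfolding c'_def
    by (rule restricted_chart[OF c(1) oU' _ hom open_ball smooth_on_subset[OF \<Phi>(1) U'B] smooth_on_subset[OF UV(6) R(2)]])
      (use U'B B in auto)
  have pc': "p \<in> fst c'" using c UV(3) R by (simp add: c'_def U'_def)
  show ?thesis
  proof (rule that[OF c'S pc' R(1)])
    have "snd c ` {p \<in> fst c. snd c p \<in> U'} = U'" using U'B B by auto
    then have "snd c' ` fst c' = \<Phi> ` U'" unfolding c'_def by (metis fst_conv snd_conv image_comp)
    then show "snd c' ` fst c' = ball (snd c' p) R" using hom by (simp add: homeomorphism_def c'_def)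
    fix q assume q: "q \<in> fst c'"
    have "jacobian_matrix (transition c c') (snd c q) = jacobian_matrix \<Phi> (snd c q)"
    proof -
      have "pd j (\<lambda>z. \<Phi> z $ i) (snd c q) = pd j (\<lambda>z. transition c c' z $ i) (snd c q)" for i j
      proof (rule pd_cong[OF oU'])
        show "snd c q \<in> U'" using q by (simp add: c'_def)
        show "\<Phi> y $ i = transition c c' y $ i" if y: "y \<in> U'" for y
        proof -
          obtain p' where "p' \<in> fst c" "y = snd c p'" using y U'B B by blast
          then show ?thesis using transition_chart[OF c(1), of p' c'] by (simp add: c'_def)
        qed
        show "(\<lambda>z. \<Phi> z $ i) differentiable (at (snd c q))"
          by (rule smooth_on_differentiable[OF smooth_on_vec_nth[OF open_ball \<Phi>(1)]]) (use q U'B in \<open>auto simp: c'_def\<close>)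
      qed
      then show ?thesis by (simp add: jacobian_matrix_def)
    qed
    then show "q \<in> fst c \<and> snd c q \<in> ball (snd c p) r \<and> snd c' q = \<Phi> (snd c q) \<and>
        chart_jacobian c c' q = jacobian_matrix \<Phi> (snd c q)"
      using q U'B by (auto simp: c'_def chart_jacobian_def)
  qed
qed

end


section \<open>Spacetimes with a parallel one-form\<close>

locale parallel_form_spacetime = smooth_4_manifold X S
  for X :: "'a topology" and S :: "'a chart set" +
  fixes a :: "'a bilinear_field" and b :: "'a form"
  assumes metric: "pseudo_riemannian_metric X S a" and form: "one_form X S b"
    and vacuum: "vacuum_einstein S a" and cov_const: "covariantly_constant S a b"
    and lorentz_signature: "lorentzian X S a"
begin

lemma domain_in_topspace: "c \<in> S \<Longrightarrow> p \<in> fst c \<Longrightarrow> p \<in> topspace X"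
  using openin_subset[OF openin_domain] by blast

lemma lorentz_chart:
  assumes c: "c \<in> S"
  shows "lorentz_chart (snd c ` fst c) (metric_comp S a c) (form_comp S b c)"
proof
  show "open (snd c ` fst c)" by (rule open_image[OF c])
  show "smooth_on (snd c ` fst c) (metric_comp S a c)"
    using metric c unfolding pseudo_riemannian_metric_def by blast
  show "smooth_on (snd c ` fst c) (form_comp S b c)"
    using form c unfolding one_form_def by blast
  fix x i j assume x: "x \<in> snd c ` fst c"
  then obtain p where p: "p \<in> fst c" "x = snd c p" by blast
  have pX: "p \<in> topspace X" by (rule domain_in_topspace[OF c p(1)])
  have sym: "a p v w = a p w v" if "v \<in> tangent_space S p" "w \<in> tangent_space S p" for v w
    using metric pX that unfolding pseudo_riemannian_metric_def by blast
  show "transpose (metric_comp S a c x) = metric_comp S a c x"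
    using sym[OF coord_vector_in_tangent_space[OF c p(1)] coord_vector_in_tangent_space[OF c p(1)]]
    by (simp add: transpose_def metric_comp_def p(2) chart_inv_chart[OF c p(1)])
  show "ricci (metric_comp S a c) i j x = 0"
    using vacuum c x unfolding vacuum_einstein_def by blast
  show "partial_deriv i (\<lambda>z. form_comp S b c z $ j) x
      - (\<Sum>k\<in>UNIV. christoffel (metric_comp S a c) k i j x * form_comp S b c x $ k) = 0"
    using cov_const c x unfolding covariantly_constant_def by blast
  show "\<exists>E. transpose E ** metric_comp S a c x ** E = minkowski"
  proof -
    have "\<exists>e :: 4 \<Rightarrow> 'a tangent. (\<forall>i. e i \<in> tangent_space S p) \<and> (\<forall>i j. a p (e i) (e j) = minkowski $ i $ j)"
      using lorentz_signature pX unfolding lorentzian_def by (rule bspec)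
    then obtain e :: "4 \<Rightarrow> 'a tangent" where e: "\<And>i. e i \<in> tangent_space S p" "\<And>i j. a p (e i) (e j) = minkowski $ i $ j"
      by metis
    define E where "E = (\<chi> k i. e i c $ k)"
    have "(transpose E ** metric_comp S a c x ** E) $ i $ j = minkowski $ i $ j" for i j
    proof -
      have "(transpose E ** metric_comp S a c x ** E) $ i $ j = (\<Sum>k\<in>UNIV. E $ k $ i * (metric_comp S a c x ** E) $ k $ j)"
        by (simp only: matrix_mul_assoc[of "transpose E" "metric_comp S a c x" E, symmetric] transpose_mult_nth)
      also have "\<dots> = e i c \<bullet> (metric_comp S a c x *v e j c)"
        by (simp add: inner_vec_def matrix_vector_mult_def matrix_matrix_mult_def E_def)
      also have "\<dots> = minkowski $ i $ j"
        using metric_eval[OF metric c p(1) e(1) e(1), of i j] e(2)[of i j] p(2) by simp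
      finally show ?thesis .
    qed
    then show ?thesis by (auto simp: vec_eq_iff)
  qed
qed

section \<open>Zeros and null points of the form\<close>

definition form_zero_at :: "'a \<Rightarrow> bool" where
  "form_zero_at p \<longleftrightarrow> (\<exists>c\<in>S. p \<in> fst c \<and> form_comp S b c (snd c p) = 0)"

text \<open>Zeros of the form count as null points. Both predicates are stated through some chart in
  order to be properties of points; the choice of chart is shown to be immaterial.\<close>

definition form_null_at :: "'a \<Rightarrow> bool" where
  "form_null_at p \<longleftrightarrow> (\<exists>c\<in>S. p \<in> fst c \<and>
     form_comp S b c (snd c p) \<bullet> (matrix_inv (metric_comp S a c (snd c p)) *v form_comp S b c (snd c p)) = 0)"

lemma form_zero_at_chart:
  assumes "c \<in> S" "p \<in> fst c"
  shows "form_zero_at p \<longleftrightarrow> form_comp S b c (snd c p) = 0"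
proof
  assume "form_zero_at p"
  then obtain d where d: "d \<in> S" "p \<in> fst d" "form_comp S b d (snd d p) = 0"
    unfolding form_zero_at_def by blast
  then show "form_comp S b c (snd c p) = 0"
    by (simp add: form_change[OF form assms(1) d(1) assms(2) d(2)])
qed (use assms in \<open>unfold form_zero_at_def, blast\<close>)

text \<open>The inverse metric transforms with the inverse Jacobian \<open>K\<close> and the form
  with the transposed Jacobian, so the factors cancel in pairs.\<close>

lemma norm_change:
  assumes "c \<in> S" "d \<in> S" "p \<in> fst c" "p \<in> fst d"
  shows "form_comp S b c (snd c p) \<bullet> (matrix_inv (metric_comp S a c (snd c p)) *v form_comp S b c (snd c p))
    = form_comp S b d (snd d p) \<bullet> (matrix_inv (metric_comp S a d (snd d p)) *v form_comp S b d (snd d p))"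
proof -
  interpret D: lorentz_chart "snd d ` fst d" "metric_comp S a d" "form_comp S b d"
    by (rule lorentz_chart[OF assms(2)])
  let ?J = "chart_jacobian c d p" and ?G = "metric_comp S a d (snd d p)" and ?\<beta> = "form_comp S b d (snd d p)"
  define K where "K = chart_jacobian d c p"
  have JK: "?J ** K = mat 1" unfolding K_def
    by (rule chart_jacobian_inverse[OF assms(2,1,4,3)])
  have KJ: "transpose ?J ** transpose K = mat 1"
    using chart_jacobian_inverse[OF assms] by (simp add: K_def matrix_transpose_mul[symmetric] transpose_mat)
  have KJt: "transpose K ** transpose ?J = mat 1"
    using JK by (simp add: matrix_transpose_mul[symmetric] transpose_mat)
  have Ginv: "?G ** matrix_inv ?G = mat 1"
    using D.invertible_g[of "snd d p"] assms by (intro matrix_inv_right) auto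
  have "(transpose ?J ** ?G ** ?J) ** (K ** matrix_inv ?G ** transpose K)
    = transpose ?J ** (?G ** (?J ** K) ** matrix_inv ?G) ** transpose K"
    by (simp only: matrix_mul_assoc)
  also have "\<dots> = mat 1" by (simp add: JK Ginv KJ)
  finally have inv: "matrix_inv (metric_comp S a c (snd c p)) = K ** matrix_inv ?G ** transpose K"
    unfolding metric_change[OF metric assms] by (rule matrix_inv_eqI)
  have "(K ** matrix_inv ?G ** transpose K) *v (transpose ?J *v ?\<beta>)
      = K *v (matrix_inv ?G *v ((transpose K ** transpose ?J) *v ?\<beta>))"
    by (simp only: matrix_vector_mul_assoc matrix_mul_assoc)
  also have "\<dots> = K *v (matrix_inv ?G *v ?\<beta>)" by (simp only: KJt matrix_vector_mul_lid)
  finally have "form_comp S b c (snd c p) \<bullet> (matrix_inv (metric_comp S a c (snd c p)) *v form_comp S b c (snd c p))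
    = (transpose ?J *v ?\<beta>) \<bullet> (K *v (matrix_inv ?G *v ?\<beta>))"
    unfolding inv form_change[OF form assms] by (simp only:)
  also have "\<dots> = ?\<beta> \<bullet> (?J *v (K *v (matrix_inv ?G *v ?\<beta>)))"
    unfolding inner_matrix_vector_transpose transpose_transpose ..
  also have "\<dots> = ?\<beta> \<bullet> (matrix_inv ?G *v ?\<beta>)"
    by (simp only: matrix_vector_mul_assoc[of ?J K] JK matrix_vector_mul_lid)
  finally show ?thesis .
qed

lemma form_null_at_chart:
  assumes "c \<in> S" "p \<in> fst c"
  shows "form_null_at p \<longleftrightarrow>
    form_comp S b c (snd c p) \<bullet> (matrix_inv (metric_comp S a c (snd c p)) *v form_comp S b c (snd c p)) = 0"
proof
  assume "form_null_at p"
  then obtain d where d: "d \<in> S" "p \<in> fst d"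
    "form_comp S b d (snd d p) \<bullet> (matrix_inv (metric_comp S a d (snd d p)) *v form_comp S b d (snd d p)) = 0"
    unfolding form_null_at_def by blast
  then show "form_comp S b c (snd c p) \<bullet> (matrix_inv (metric_comp S a c (snd c p)) *v form_comp S b c (snd c p)) = 0"
    using norm_change[OF assms(1) d(1) assms(2) d(2)] by simp
qed (use assms in \<open>unfold form_null_at_def, blast\<close>)

lemma chart_at:
  assumes "p \<in> topspace X"
  obtains c where "c \<in> S" "p \<in> fst c"
  using assms cover by blast

lemma ball_neighbourhood:
  assumes "c \<in> S" "p \<in> fst c" "0 < r"
  shows "openin X {q \<in> fst c. snd c q \<in> ball (snd c p) r}" "p \<in> {q \<in> fst c. snd c q \<in> ball (snd c p) r}"
  using openin_chart_preimage[OF assms(1) open_ball] assms by auto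

text \<open>Near a zero the parallel form vanishes by \<open>parallel_zero_locally\<close>; near any
  other point it stays nonzero by continuity.\<close>

lemma form_zero_locally_constant:
  assumes "p \<in> topspace X"
  shows "\<exists>U. openin X U \<and> p \<in> U \<and> (\<forall>q\<in>U. form_zero_at q = form_zero_at p)"
proof -
  obtain c where c: "c \<in> S" "p \<in> fst c" by (rule chart_at[OF assms])
  interpret L: lorentz_chart "snd c ` fst c" "metric_comp S a c" "form_comp S b c"
    by (rule lorentz_chart[OF c(1)])
  have x0: "snd c p \<in> snd c ` fst c" using c by blast
  have "\<exists>r>0. \<forall>x\<in>ball (snd c p) r \<inter> snd c ` fst c. (form_comp S b c x = 0) = (form_comp S b c (snd c p) = 0)"
  proof (cases "form_comp S b c (snd c p) = 0")
    case True
    obtain r where "r > 0" "\<And>x. x \<in> ball (snd c p) r \<Longrightarrow> form_comp S b c x = 0"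
      by (rule L.parallel_zero_locally[OF x0 True]) blast
    then show ?thesis using True by blast
  next
    case False
    have "continuous_on (snd c ` fst c) (form_comp S b c)" by (rule smooth_on_continuous[OF L.smooth_\<beta>])
    then have "open (snd c ` fst c \<inter> form_comp S b c -` (- {0}))"
      by (rule continuous_open_preimage[OF _ L.open_W]) auto
    then obtain r where "r > 0" "ball (snd c p) r \<subseteq> snd c ` fst c \<inter> form_comp S b c -` (- {0})"
      using x0 False open_contains_ball by blast
    then show ?thesis using False by blast
  qed
  then obtain r where r: "r > 0"
    "\<And>x. x \<in> ball (snd c p) r \<Longrightarrow> x \<in> snd c ` fst c \<Longrightarrow> (form_comp S b c x = 0) = (form_comp S b c (snd c p) = 0)"
    by blast
  have "form_zero_at q = form_zero_at p" if "q \<in> {q \<in> fst c. snd c q \<in> ball (snd c p) r}" for q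
    using that r(2)[of "snd c q"] form_zero_at_chart[OF c(1), of q] form_zero_at_chart[OF c] by blast
  then show ?thesis using ball_neighbourhood[OF c r(1)] by blast
qed

lemma form_null_locally_constant:
  assumes "p \<in> topspace X"
  shows "\<exists>U. openin X U \<and> p \<in> U \<and> (\<forall>q\<in>U. form_null_at q = form_null_at p)"
proof -
  obtain c where c: "c \<in> S" "p \<in> fst c" by (rule chart_at[OF assms])
  interpret L: lorentz_chart "snd c ` fst c" "metric_comp S a c" "form_comp S b c"
    by (rule lorentz_chart[OF c(1)])
  have x0: "snd c p \<in> snd c ` fst c" using c by blast
  obtain r where r: "r > 0" "ball (snd c p) r \<subseteq> snd c ` fst c"
    using x0 L.open_W open_contains_ball by blast
  have null: "form_null_at q = (L.ip (snd c q) (form_comp S b c (snd c q)) (form_comp S b c (snd c q)) = 0)"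
    if "q \<in> fst c" for q
    unfolding form_null_at_chart[OF c(1) that] L.ip_def L.h_def ..
  have "form_null_at q = form_null_at p" if "q \<in> {q \<in> fst c. snd c q \<in> ball (snd c p) r}" for q
  proof -
    have "L.ip (snd c q) (form_comp S b c (snd c q)) (form_comp S b c (snd c q))
      = L.ip (snd c p) (form_comp S b c (snd c p)) (form_comp S b c (snd c p))"
    proof (rule L.ip_constant[OF r(2) smooth_on_subset[OF L.smooth_\<beta> r(2)] smooth_on_subset[OF L.smooth_\<beta> r(2)]])
      show "L.cov i (form_comp S b c) x = 0" if "x \<in> ball (snd c p) r" for x i
        using that r(2) by (intro L.cov_\<beta>) blast
      then show "L.cov i (form_comp S b c) x = 0" if "x \<in> ball (snd c p) r" for x i
        using that by blast
    qed (use that in blast)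
    then show ?thesis using null that c(2) by simp
  qed
  then show ?thesis using ball_neighbourhood[OF c r(1)] by blast
qed

section \<open>Charts of the two classes\<close>

lemma flat_chart:
  assumes p: "p \<in> topspace X" "\<not> form_null_at p"
  obtains c k where "c \<in> S" "p \<in> fst c" "\<And>\<xi>. \<xi> \<in> snd c ` fst c \<Longrightarrow> metric_comp S a c \<xi> = minkowski"
    "\<And>\<xi>. \<xi> \<in> snd c ` fst c \<Longrightarrow> form_comp S b c \<xi> = k"
proof -
  obtain c where c: "c \<in> S" "p \<in> fst c" by (rule chart_at[OF p(1)])
  interpret L: lorentz_chart "snd c ` fst c" "metric_comp S a c" "form_comp S b c"
    by (rule lorentz_chart[OF c(1)])
  have x0: "snd c p \<in> snd c ` fst c" using c by blast
  have "L.ip (snd c p) (form_comp S b c (snd c p)) (form_comp S b c (snd c p)) \<noteq> 0"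
    using p(2) unfolding form_null_at_chart[OF c] L.ip_def L.h_def .
  then obtain r \<Phi> k where \<Phi>: "r > 0" "ball (snd c p) r \<subseteq> snd c ` fst c" "smooth_on (ball (snd c p) r) \<Phi>"
    "\<And>x. x \<in> ball (snd c p) r \<Longrightarrow>
       transpose (jacobian_matrix \<Phi> x) ** minkowski ** jacobian_matrix \<Phi> x = metric_comp S a c x"
    "\<And>x. x \<in> ball (snd c p) r \<Longrightarrow> form_comp S b c x = transpose (jacobian_matrix \<Phi> x) *v k"
    by (rule L.flat_coordinates[OF x0]) blast
  have inv: "invertible (jacobian_matrix \<Phi> x)" if "x \<in> ball (snd c p) r" for x
    by (rule invertible_of_congruence[OF \<Phi>(4)[OF that]]) (use L.invertible_g that \<Phi>(2) in blast)
  have "snd c p \<in> ball (snd c p) r" using \<Phi>(1) by simp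
  from chart_from_local_diffeomorphism[OF c \<Phi>(1-3) inv[OF this]]
  obtain c' where c': "c' \<in> S" "p \<in> fst c'"
    "\<And>q. q \<in> fst c' \<Longrightarrow> q \<in> fst c \<and> snd c q \<in> ball (snd c p) r \<and> snd c' q = \<Phi> (snd c q) \<and>
        chart_jacobian c c' q = jacobian_matrix \<Phi> (snd c q)"
    by metis
  show ?thesis
  proof (rule that[OF c'(1,2)])
    fix \<xi> assume "\<xi> \<in> snd c' ` fst c'"
    then obtain q where q: "q \<in> fst c'" "\<xi> = snd c' q" by blast
    have qc: "q \<in> fst c" "snd c q \<in> ball (snd c p) r"
      and J: "chart_jacobian c c' q = jacobian_matrix \<Phi> (snd c q)"
      using c'(3)[OF q(1)] by auto
    show "metric_comp S a c' \<xi> = minkowski"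
      unfolding q(2)
      by (rule cancel_congruence[OF inv[OF qc(2)] trans[OF
            metric_change[OF metric c(1) c'(1) qc(1) q(1), unfolded J, symmetric] \<Phi>(4)[OF qc(2), symmetric]]])
    show "form_comp S b c' \<xi> = k"
      unfolding q(2)
      by (rule cancel_transpose[OF inv[OF qc(2)] trans[OF
            form_change[OF form c(1) c'(1) qc(1) q(1), unfolded J, symmetric] \<Phi>(5)[OF qc(2)]]])
  qed
qed

text \<open>Three charts: \<open>c0\<close> is arbitrary; in \<open>c1\<close> the form is the first
  coordinate differential, but the metric is normalised at \<open>p\<close> only; in
  \<open>c\<close> the metric has the required shape everywhere and the image is a ball. The
  components in a new chart are found by cancelling the Jacobian from the transformation
  law.\<close>

lemma pp_wave_chart:
  assumes p: "p \<in> topspace X" "form_null_at p" "\<not> form_zero_at p"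
  obtains c and H :: "real \<times> real \<times> real \<Rightarrow> real" where "c \<in> S" "p \<in> fst c"
    "\<And>\<xi>. \<xi> \<in> snd c ` fst c \<Longrightarrow> metric_comp S a c \<xi> = pp_wave_matrix (H (\<xi>$1, \<xi>$3, \<xi>$4))"
    "\<And>\<xi>. \<xi> \<in> snd c ` fst c \<Longrightarrow> form_comp S b c \<xi> = vector [1, 0, 0, 0]"
    "smooth_on ((\<lambda>\<xi>. (\<xi>$1, \<xi>$3, \<xi>$4)) ` (snd c ` fst c)) H"
    "\<forall>(u, x, y)\<in>(\<lambda>\<xi>. (\<xi>$1, \<xi>$3, \<xi>$4)) ` (snd c ` fst c).
       (deriv ^^ 2) (\<lambda>s. H (u, s, y)) x + (deriv ^^ 2) (\<lambda>s. H (u, x, s)) y = 0"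
proof -
  obtain c0 where c0: "c0 \<in> S" "p \<in> fst c0" by (rule chart_at[OF p(1)])
  interpret L0: lorentz_chart "snd c0 ` fst c0" "metric_comp S a c0" "form_comp S b c0"
    by (rule lorentz_chart[OF c0(1)])
  have x0: "snd c0 p \<in> snd c0 ` fst c0" using c0 by blast
  have nz: "form_comp S b c0 (snd c0 p) \<noteq> 0" using p(3) form_zero_at_chart[OF c0] by blast
  have "L0.ip (snd c0 p) (form_comp S b c0 (snd c0 p)) (form_comp S b c0 (snd c0 p)) = 0"
    using p(2) unfolding form_null_at_chart[OF c0] L0.ip_def L0.h_def .
  then obtain r0 \<Phi>0 where \<Phi>0: "r0 > 0" "ball (snd c0 p) r0 \<subseteq> snd c0 ` fst c0" "smooth_on (ball (snd c0 p) r0) \<Phi>0"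
    "\<And>x. x \<in> ball (snd c0 p) r0 \<Longrightarrow> jacobian_matrix \<Phi>0 x $ 1 = form_comp S b c0 x"
    "transpose (jacobian_matrix \<Phi>0 (snd c0 p)) ** block_gram 0 (-1) 0 ** jacobian_matrix \<Phi>0 (snd c0 p)
      = metric_comp S a c0 (snd c0 p)"
    by (rule L0.null_coordinate[OF x0 nz]) blast
  have inv0: "invertible (jacobian_matrix \<Phi>0 (snd c0 p))"
    by (rule invertible_of_congruence[OF \<Phi>0(5) L0.invertible_g[OF x0]])
  from chart_from_local_diffeomorphism[OF c0 \<Phi>0(1-3) inv0]
  obtain c1 where c1: "c1 \<in> S" "p \<in> fst c1"
    "\<And>q. q \<in> fst c1 \<Longrightarrow> q \<in> fst c0 \<and> snd c0 q \<in> ball (snd c0 p) r0 \<and> snd c1 q = \<Phi>0 (snd c0 q) \<and>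
        chart_jacobian c0 c1 q = jacobian_matrix \<Phi>0 (snd c0 q)"
    by metis
  interpret L1: lorentz_chart "snd c1 ` fst c1" "metric_comp S a c1" "form_comp S b c1"
    by (rule lorentz_chart[OF c1(1)])
  have x1: "snd c1 p \<in> snd c1 ` fst c1" using c1 by blast
  have \<beta>1: "form_comp S b c1 \<xi> = axis 1 1" if \<xi>: "\<xi> \<in> snd c1 ` fst c1" for \<xi>
  proof -
    obtain q where q: "q \<in> fst c1" "\<xi> = snd c1 q" using \<xi> by blast
    have qc: "q \<in> fst c0" "snd c0 q \<in> ball (snd c0 p) r0"
      and J: "chart_jacobian c0 c1 q = jacobian_matrix \<Phi>0 (snd c0 q)"
      using c1(3)[OF q(1)] by auto
    have "transpose (chart_jacobian c0 c1 q) *v form_comp S b c1 (snd c1 q)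
      = transpose (chart_jacobian c0 c1 q) *v axis 1 1"
      by (rule trans[OF form_change[OF form c0(1) c1(1) qc(1) q(1), symmetric]])
        (simp only: row_1_transpose J \<Phi>0(4)[OF qc(2)])
    then show ?thesis unfolding q(2) by (rule cancel_transpose[OF chart_jacobian_invertible[OF c0(1) c1(1) qc(1) q(1)]])
  qed
  have g1: "metric_comp S a c1 (snd c1 p) = block_gram 0 (-1) 0"
  proof (rule cancel_congruence[OF inv0])
    have J: "chart_jacobian c0 c1 p = jacobian_matrix \<Phi>0 (snd c0 p)" using c1(3)[OF c1(2)] by blast
    show "transpose (jacobian_matrix \<Phi>0 (snd c0 p)) ** metric_comp S a c1 (snd c1 p) ** jacobian_matrix \<Phi>0 (snd c0 p)
      = transpose (jacobian_matrix \<Phi>0 (snd c0 p)) ** block_gram 0 (-1) 0 ** jacobian_matrix \<Phi>0 (snd c0 p)"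
      unfolding \<Phi>0(5) by (rule metric_change[OF metric c0(1) c1(1) c0(2) c1(2), unfolded J, symmetric])
  qed
  obtain r \<Phi> f where \<Phi>: "0 < r" "ball (snd c1 p) r \<subseteq> snd c1 ` fst c1" "smooth_on (ball (snd c1 p) r) \<Phi>"
    "\<And>x. x \<in> ball (snd c1 p) r \<Longrightarrow> jacobian_matrix \<Phi> x $ 1 = axis 1 1"
    "\<And>x. x \<in> ball (snd c1 p) r \<Longrightarrow>
       transpose (jacobian_matrix \<Phi> x) ** block_gram (f x) (-1) 0 ** jacobian_matrix \<Phi> x = metric_comp S a c1 x"
    by (rule L1.pp_coordinates[OF x1 g1 \<beta>1]) blast+
  have inv: "invertible (jacobian_matrix \<Phi> x)" if "x \<in> ball (snd c1 p) r" for x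
    by (rule invertible_of_congruence[OF \<Phi>(5)[OF that]]) (use L1.invertible_g that \<Phi>(2) in blast)
  have "snd c1 p \<in> ball (snd c1 p) r" using \<Phi>(1) by simp
  from chart_from_local_diffeomorphism[OF c1(1,2) \<Phi>(1-3) inv[OF this]]
  obtain c R where c: "c \<in> S" "p \<in> fst c" "snd c ` fst c = ball (snd c p) R"
    "\<And>q. q \<in> fst c \<Longrightarrow> q \<in> fst c1 \<and> snd c1 q \<in> ball (snd c1 p) r \<and> snd c q = \<Phi> (snd c1 q) \<and>
        chart_jacobian c1 c q = jacobian_matrix \<Phi> (snd c1 q)"
    by metis
  interpret L: lorentz_chart "snd c ` fst c" "metric_comp S a c" "form_comp S b c"
    by (rule lorentz_chart[OF c(1)])
  have \<beta>: "form_comp S b c \<xi> = axis 1 1"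
    and g: "metric_comp S a c \<xi> = block_gram (f (snd c1 (chart_inv c \<xi>))) (-1) 0" if \<xi>: "\<xi> \<in> snd c ` fst c" for \<xi>
  proof -
    obtain q where q: "q \<in> fst c" "\<xi> = snd c q" using \<xi> by blast
    have qc: "q \<in> fst c1" "snd c1 q \<in> ball (snd c1 p) r"
      and J: "chart_jacobian c1 c q = jacobian_matrix \<Phi> (snd c1 q)"
      using c(4)[OF q(1)] by auto
    have "snd c1 q \<in> snd c1 ` fst c1" using qc by blast
    note \<beta>1q = \<beta>1[OF this]
    have "transpose (chart_jacobian c1 c q) *v form_comp S b c (snd c q)
      = transpose (chart_jacobian c1 c q) *v axis 1 1"
      by (rule trans[OF form_change[OF form c1(1) c(1) qc(1) q(1), symmetric]])
        (simp only: row_1_transpose J \<Phi>(4)[OF qc(2)] \<beta>1q)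
    then show "form_comp S b c \<xi> = axis 1 1"
      unfolding q(2) by (rule cancel_transpose[OF chart_jacobian_invertible[OF c1(1) c(1) qc(1) q(1)]])
    have "chart_inv c \<xi> = q" unfolding q(2) by (rule chart_inv_chart[OF c(1) q(1)])
    moreover have "metric_comp S a c (snd c q) = block_gram (f (snd c1 q)) (-1) 0"
      by (rule cancel_congruence[OF inv[OF qc(2)] trans[OF
            metric_change[OF metric c1(1) c(1) qc(1) q(1), unfolded J, symmetric] \<Phi>(5)[OF qc(2), symmetric]]])
    ultimately show "metric_comp S a c \<xi> = block_gram (f (snd c1 (chart_inv c \<xi>))) (-1) 0"
      by (simp only: q(2))
  qed
  obtain H :: "real \<times> real \<times> real \<Rightarrow> real" where H:
    "\<And>\<xi>. \<xi> \<in> snd c ` fst c \<Longrightarrow> metric_comp S a c \<xi> = pp_wave_matrix (H (\<xi>$1, \<xi>$3, \<xi>$4))"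
    "smooth_on ((\<lambda>\<xi>. (\<xi>$1, \<xi>$3, \<xi>$4)) ` (snd c ` fst c)) H"
    "\<forall>(u, x, y)\<in>(\<lambda>\<xi>. (\<xi>$1, \<xi>$3, \<xi>$4)) ` (snd c ` fst c).
       (deriv ^^ 2) (\<lambda>s. H (u, s, y)) x + (deriv ^^ 2) (\<lambda>s. H (u, x, s)) y = 0"
    by (rule L.pp_wave_harmonic[OF c(3) \<beta> g]) blast+
  have "axis 1 1 = (vector [1, 0, 0, 0] :: real^4)" by (simp add: vec_eq_iff forall_4 axis_one_nth)
  then show ?thesis using that[OF c(1,2) H(1) _ H(2,3)] \<beta> by simp
qed

end

text \<open>If b were zero on a component, F would be a constant multiple of \<alpha> there and any
  vacuum metric would be admissible, so b is assumed to be nonzero somewhere on each component.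
  Being parallel, it then vanishes nowhere on it.\<close>

theorem theorem8p1p2:
  fixes X :: "'a topology" and S :: "'a chart set"
    and A :: "('a \<times> 'a tangent) set" and F :: "'a \<times> 'a tangent \<Rightarrow> real"
    and a :: "'a bilinear_field" and b :: "'a form" and \<phi> :: "real \<Rightarrow> real"
  assumes "smooth_manifold X S"
    and "alpha_beta_metric X S A F a b \<phi>"
    and "vacuum_einstein S a"
    and "covariantly_constant S a b"
    and "lorentzian X S a"
    and "\<forall>C\<in>connected_components_of X. \<exists>p\<in>C. \<exists>v\<in>tangent_space S p. b p v \<noteq> 0"
  shows "\<forall>C\<in>connected_components_of X.
           class1_on C S A F a b \<phi> \<or> class2_on C S A F a b \<phi>"
proof
  fix C assume C: "C \<in> connected_components_of X"
  have metric: "pseudo_riemannian_metric X S a" and form: "one_form X S b"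
    and F: "\<forall>w\<in>A. alpha a w \<noteq> 0 \<and> F w = alpha a w * \<phi> (beta b w / alpha a w)"
    using assms(2) unfolding alpha_beta_metric_def by blast+
  interpret parallel_form_spacetime X S a b
    by unfold_locales (rule assms metric form)+
  have F': "\<forall>w\<in>A. fst w \<in> C \<longrightarrow> F w = alpha a w * \<phi> (beta b w / alpha a w)"
    using F by blast
  have con: "connectedin X C" by (rule connectedin_connected_components_of[OF C])
  then have CX: "C \<subseteq> topspace X" by (rule connectedin_subset_topspace)
  obtain p v where pv: "p \<in> C" "v \<in> tangent_space S p" "b p v \<noteq> 0" using assms(6) C by blast
  obtain c where c: "c \<in> S" "p \<in> fst c" by (rule chart_at[of p]) (use pv CX in auto)
  \<comment> \<open>A form with zero components in a chart around \<open>p\<close> would annihilate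
    every tangent vector at \<open>p\<close>.\<close>
  have "\<not> form_zero_at p"
    unfolding form_zero_at_chart[OF c] using form_eval[OF form c pv(2)] pv(3) by auto
  moreover have "form_zero_at q = form_zero_at p" if "q \<in> C" for q
    by (rule locally_constant_on_connected[OF con form_zero_locally_constant that pv(1)]) (use CX in blast)
  ultimately have nz: "\<not> form_zero_at q" if "q \<in> C" for q using that by blast
  \<comment> \<open>A single case distinction at \<open>p\<close> therefore decides the class for
    the whole component.\<close>
  have null: "form_null_at q = form_null_at p" if "q \<in> C" for q
    by (rule locally_constant_on_connected[OF con form_null_locally_constant that pv(1)]) (use CX in blast)
  show "class1_on C S A F a b \<phi> \<or> class2_on C S A F a b \<phi>"
  proof (cases "form_null_at p")
    case False
    have "\<exists>c\<in>S. q \<in> fst c \<and> (\<forall>\<xi>\<in>snd c ` fst c. metric_comp S a c \<xi> = minkowski) \<and>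
        (\<exists>k. \<forall>\<xi>\<in>snd c ` fst c. form_comp S b c \<xi> = k)" if q: "q \<in> C" for q
    proof -
      have "q \<in> topspace X" "\<not> form_null_at q" using q CX null[OF q] False by blast+
      then show ?thesis by (rule flat_chart) blast
    qed
    then have "class1_on C S A F a b \<phi>" unfolding class1_on_def using F' by blast
    then show ?thesis ..
  next
    case True
    have "\<exists>c\<in>S. \<exists>H :: real \<times> real \<times> real \<Rightarrow> real. q \<in> fst c \<and>
        (\<forall>\<xi>\<in>snd c ` fst c. metric_comp S a c \<xi> = pp_wave_matrix (H (\<xi>$1, \<xi>$3, \<xi>$4))) \<and>
        (\<forall>\<xi>\<in>snd c ` fst c. form_comp S b c \<xi> = vector [1, 0, 0, 0]) \<and>
        smooth_on ((\<lambda>\<xi>. (\<xi>$1, \<xi>$3, \<xi>$4)) ` (snd c ` fst c)) H \<and>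
        (\<forall>(u, x, y)\<in>(\<lambda>\<xi>. (\<xi>$1, \<xi>$3, \<xi>$4)) ` (snd c ` fst c).
           (deriv ^^ 2) (\<lambda>s. H (u, s, y)) x + (deriv ^^ 2) (\<lambda>s. H (u, x, s)) y = 0)" if q: "q \<in> C" for q
    proof -
      have q': "q \<in> topspace X" "form_null_at q" "\<not> form_zero_at q" using q CX null[OF q] True nz by blast+
      show ?thesis
      proof (rule pp_wave_chart[OF q'], goal_cases)
        case (1 c H)
        then show ?case by (intro bexI[of _ c] exI[of _ H] conjI) blast+
      qed
    qed
    then have "class2_on C S A F a b \<phi>" unfolding class2_on_def using F' by blast
    then show ?thesis ..
  qed
qed

end
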